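(* Assume the setting below and let $\Psi\in H^3(\Omega)^k\cap H^2_0(\Omega)^k$ be a regular solution of the continuous problem. For any $\overline{\Gamma}\ge0$ there exists $\rho>0$ such that, for every Hessian discretisation $\mathcal{D}$ with companion operator $E_{\mathcal{D}}$ satisfying $$C_{\mathcal{D}}\le\overline{\Gamma},\quad\Gamma(E_{\mathcal{D}})\le\overline{\Gamma},\quad\omega(E_{\mathcal{D}})\le\rho,\quad\alpha_{\mathcal{D}}\le\rho,\quad\gamma_{\mathcal{D}}\le\rho,$$ the discrete linearized problem (find $\Theta_{\mathcal{D}}\in X_{\mathcal{D},0}^k$ with $\mathbb{A}_{\mathcal{D},\Psi}(\Theta_{\mathcal{D}},\Phi_{\mathcal{D}})=\langle G,E_{\mathcal{D}}\Phi_{\mathcal{D}}\rangle_{-1,1}$ for all $\Phi_{\mathcal{D}}\in X_{\mathcal{D},0}^k$, where $G\in H^{-1}(\Omega)^k$) is well-posed.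
   Context: Let $\Omega\subsetneq\mathbb{R}^d$, $d\le3$, be a bounded convex domain, $k\ge1$, $X=H^2_0(\Omega)$. Norms on $E^k$ are written as on $E$; $\|\cdot\|$ is the $L^2$ norm, $\|\cdot\|_{0,4}$ the $L^4$ norm, $\|\cdot\|_m$, $|\cdot|_m$ the $H^m$ norm and seminorm; $\|\cdot\|_{-1}$ is the dual norm on $H^{-1}(\Omega)^k=(H^1_0(\Omega)^k)'$ and $\langle\cdot,\cdot\rangle_{-1,1}$ the duality pairing. $\mathcal{H}$ is the Hessian, acting componentwise. Here $\mathcal{A}(\Phi,\Theta)=\int_\Omega\Phi:\Theta\,dx$ on $L^2(\Omega;\mathbb{R}^{d\times d})^k$ (summed over components) and $\mathcal{B}(\Phi,\Theta,\Xi)=\int_\Omega\Phi:h(\Theta,\Xi)\,dx$ for a bilinear map $h$ on $\mathbb{R}^{dk}\times\mathbb{R}^{dk}$ (with values in $(\mathbb{R}^{d\times d})^k$), such that $\mathcal{B}$ is continuous on $L^2(\Omega;\mathbb{R}^{d\times d})^k\times L^4(\Omega;\mathbb{R}^d)^k\times L^4(\Omega;\mathbb{R}^d)^k$ (norm $\|\mathcal{B}\|$) and $\mathcal{B}(\Xi,\Theta,\Theta)=0$ for all $\Xi,\Theta$; $\mathcal{L}\in H^{-1}(\Omega)^k$. The continuous problem: find $\Psi\in X^k$ with $\mathcal{A}(\mathcal{H}\Psi,\mathcal{H}\Phi)+\mathcal{B}(\mathcal{H}\Psi,\nabla\Psi,\nabla\Phi)=\mathcal{L}(\Phi)$ for all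 $\Phi\in X^k$. Its linearization at $\Psi$: $\mathbb{A}_\Psi(\Theta,\Phi)=\mathcal{A}(\mathcal{H}\Theta,\mathcal{H}\Phi)+\mathcal{B}(\mathcal{H}\Psi,\nabla\Theta,\nabla\Phi)+\mathcal{B}(\mathcal{H}\Theta,\nabla\Psi,\nabla\Phi)$. $\Psi$ is a regular solution if there is $\beta>0$ with $\beta\le\inf_{\Theta\in X^k,|\Theta|_2=1}\sup_{\Phi\in X^k,|\Phi|_2=1}\mathbb{A}_\Psi(\Theta,\Phi)$ (equivalently, for every $G\in H^{-1}(\Omega)^k$ the problem $\mathbb{A}_\Psi(\Theta,\Phi)=\langle G,\Phi\rangle_{-1,1}$ for all $\Phi\in X^k$ has a unique solution $\Theta\in X^k$ with $\|\Theta\|_2\lesssim\|G\|_{-1}$). A Hessian discretisation is $\mathcal{D}=(X_{\mathcal{D},0},\Pi_{\mathcal{D}},\nabla_{\mathcal{D}},\mathcal{H}_{\mathcal{D}})$ with $X_{\mathcal{D},0}$ finite-dimensional and linear maps $\Pi_{\mathcal{D}}:X_{\mathcal{D},0}\to L^2(\Omega)$, $\nabla_{\mathcal{D}}:X_{\mathcal{D},0}\to L^4(\Omega;\mathbb{R}^d)$, $\mathcal{H}_{\mathcal{D}}:X_{\mathcal{D},0}\to L^2(\Omega;\mathbb{R}^{d\times d})$ such that $\|w\|_{\mathcal{D}}:=\|\mathcal{H}_{\mathcal{D}}w\|$ is a norm; a companion operator is a linear $E_{\mathcal{D}}:X_{\mathcal{D},0}\to H^2_0(\Omega)$; all act componentwise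 on $X_{\mathcal{D},0}^k$. With sups over $\psi\in X_{\mathcal{D},0}\setminus\{0\}$: $\omega(E_{\mathcal{D}})=\sup\|\nabla_{\mathcal{D}}\psi-\nabla E_{\mathcal{D}}\psi\|/\|\psi\|_{\mathcal{D}}$, $\Gamma(E_{\mathcal{D}})=\sup\|\mathcal{H}E_{\mathcal{D}}\psi\|/\|\psi\|_{\mathcal{D}}$. $C_{\mathcal{D}}=\max_{w\ne0}\max\{\|\Pi_{\mathcal{D}}w\|,\|\nabla_{\mathcal{D}}w\|_{0,4}\}/\|w\|_{\mathcal{D}}$. $S_{\mathcal{D}}(\varphi)=\min_{w\in X_{\mathcal{D},0}}(\|\Pi_{\mathcal{D}}w-\varphi\|+\|\nabla_{\mathcal{D}}w-\nabla\varphi\|_{0,4}+\|\mathcal{H}_{\mathcal{D}}w-\mathcal{H}\varphi\|)$ for $\varphi\in H^2_0(\Omega)$. For $\xi\in L^2(\Omega;\mathbb{R}^{d\times d})$ with row-wise divergence $\mathrm{div}\xi\in L^2(\Omega;\mathbb{R}^d)$, $\widetilde W_{\mathcal{D}}(\xi)=\max_{w\ne0}\frac{1}{\|w\|_{\mathcal{D}}}\left|\int_\Omega(\xi:\mathcal{H}_{\mathcal{D}}w+\mathrm{div}\xi\cdot\nabla_{\mathcal{D}}w)\,dx\right|$. Set $\alpha_{\mathcal{D}}=\sup_{\phi\in(H^3(\Omega)\cap X)\setminus\{0\}}S_{\mathcal{D}}(\phi)/\|\phi\|_3$ and $\gamma_{\mathcal{D}}=\sup_{\xi\in H^1(\Omega;\mathbb{R}^{d\times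 d})\setminus\{0\}}\widetilde W_{\mathcal{D}}(\xi)/\|\xi\|_1$. The discrete linearized form: $\mathbb{A}_{\mathcal{D},\Psi}(\Theta_{\mathcal{D}},\Phi_{\mathcal{D}})=\mathcal{A}(\mathcal{H}_{\mathcal{D}}\Theta_{\mathcal{D}},\mathcal{H}_{\mathcal{D}}\Phi_{\mathcal{D}})+\mathcal{B}(\mathcal{H}\Psi,\nabla_{\mathcal{D}}\Theta_{\mathcal{D}},\nabla_{\mathcal{D}}\Phi_{\mathcal{D}})+\mathcal{B}(\mathcal{H}_{\mathcal{D}}\Theta_{\mathcal{D}},\nabla\Psi,\nabla_{\mathcal{D}}\Phi_{\mathcal{D}})$. Well-posed means: for every $G\in H^{-1}(\Omega)^k$ the discrete problem has a unique solution. *)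

theory Defs
  imports "HOL-Analysis.Analysis" "HOL-Library.Multiset"
begin

text \<open>Points of R^d are real^'n (d = CARD('n)); vectors real^'n; d x d matrices real^'n^'n
  (whose norm/inner product is the Frobenius one). The k components are indexed by a finite
  type 'k.\<close>

definition Lp :: "(real^'n) set \<Rightarrow> nat \<Rightarrow> (real^'n \<Rightarrow> 'v::real_normed_vector) \<Rightarrow> bool" where
  "Lp \<Omega> p u \<longleftrightarrow> u \<in> borel_measurable (lebesgue_on \<Omega>) \<and>
     integrable (lebesgue_on \<Omega>) (\<lambda>x. norm (u x) ^ p)"

definition lpnorm :: "(real^'n) set \<Rightarrow> nat \<Rightarrow> (real^'n \<Rightarrow> 'v::real_normed_vector) \<Rightarrow> real" where
  "lpnorm \<Omega> p u = (LINT x|lebesgue_on \<Omega>. norm (u x) ^ p) powr (1 / real p)"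

definition lpnormk :: "(real^'n) set \<Rightarrow> nat \<Rightarrow> ('k::finite \<Rightarrow> real^'n \<Rightarrow> 'v::real_normed_vector) \<Rightarrow> real" where
  "lpnormk \<Omega> p U = (\<Sum>c\<in>UNIV. lpnorm \<Omega> p (U c) ^ p) powr (1 / real p)"

definition pd :: "'n::finite \<Rightarrow> (real^'n \<Rightarrow> real) \<Rightarrow> real^'n \<Rightarrow> real" where
  "pd i f x = frechet_derivative f (at x) (axis i 1)"

coinductive smooth_fun :: "(real^'n::finite \<Rightarrow> real) \<Rightarrow> bool" where
  "(\<forall>x. f differentiable (at x)) \<Longrightarrow> (\<forall>i. smooth_fun (pd i f)) \<Longrightarrow> smooth_fun f"

definition test_fn :: "(real^'n::finite) set \<Rightarrow> (real^'n \<Rightarrow> real) \<Rightarrow> bool" where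
  "test_fn \<Omega> \<phi> \<longleftrightarrow> smooth_fun \<phi> \<and> compact (closure {x. \<phi> x \<noteq> 0}) \<and> closure {x. \<phi> x \<noteq> 0} \<subseteq> \<Omega>"

fun Dl :: "'n::finite list \<Rightarrow> (real^'n \<Rightarrow> real) \<Rightarrow> real^'n \<Rightarrow> real" where
  "Dl [] f = f"
| "Dl (i # is) f = pd i (Dl is f)"

definition weak_deriv :: "(real^'n::finite) set \<Rightarrow> 'n list \<Rightarrow> (real^'n \<Rightarrow> real) \<Rightarrow> (real^'n \<Rightarrow> real) \<Rightarrow> bool" where
  "weak_deriv \<Omega> is u g \<longleftrightarrow> (\<forall>\<phi>. test_fn \<Omega> \<phi> \<longrightarrow>
     (LINT x|lebesgue_on \<Omega>. u x * Dl is \<phi> x) = (-1) ^ length is * (LINT x|lebesgue_on \<Omega>. g x * \<phi> x))"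

text \<open>The (a.e. determined) weak derivative D^is u.\<close>
definition wd :: "(real^'n::finite) set \<Rightarrow> 'n list \<Rightarrow> (real^'n \<Rightarrow> real) \<Rightarrow> real^'n \<Rightarrow> real" where
  "wd \<Omega> is u = (SOME g. Lp \<Omega> 2 g \<and> weak_deriv \<Omega> is u g)"

definition Hm :: "(real^'n::finite) set \<Rightarrow> nat \<Rightarrow> (real^'n \<Rightarrow> real) \<Rightarrow> bool" where
  "Hm \<Omega> m u \<longleftrightarrow> Lp \<Omega> 2 u \<and> (\<forall>is. length is \<le> m \<longrightarrow> (\<exists>g. Lp \<Omega> 2 g \<and> weak_deriv \<Omega> is u g))"

text \<open>H^m norm: sum over multi-indices (multisets of directions) of order at most m.\<close>
definition hnorm :: "(real^'n::finite) set \<Rightarrow> nat \<Rightarrow> (real^'n \<Rightarrow> real) \<Rightarrow> real" where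
  "hnorm \<Omega> m u = sqrt (\<Sum>M\<in>{M::'n multiset. size M \<le> m}.
      (lpnorm \<Omega> 2 (wd \<Omega> (SOME is. mset is = M) u)) ^ 2)"

definition H0m :: "(real^'n::finite) set \<Rightarrow> nat \<Rightarrow> (real^'n \<Rightarrow> real) \<Rightarrow> bool" where
  "H0m \<Omega> m u \<longleftrightarrow> Hm \<Omega> m u \<and> (\<forall>\<epsilon>>0. \<exists>\<phi>. test_fn \<Omega> \<phi> \<and> hnorm \<Omega> m (\<lambda>x. u x - \<phi> x) < \<epsilon>)"

abbreviation H20 where "H20 \<Omega> \<equiv> H0m \<Omega> 2"
abbreviation H10 where "H10 \<Omega> \<equiv> H0m \<Omega> 1"

definition wgrad :: "(real^'n::finite) set \<Rightarrow> (real^'n \<Rightarrow> real) \<Rightarrow> real^'n \<Rightarrow> real^'n" where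
  "wgrad \<Omega> u x = (\<chi> i. wd \<Omega> [i] u x)"

definition whess :: "(real^'n::finite) set \<Rightarrow> (real^'n \<Rightarrow> real) \<Rightarrow> real^'n \<Rightarrow> real^'n^'n" where
  "whess \<Omega> u x = (\<chi> i j. wd \<Omega> [i, j] u x)"

definition H1mat :: "(real^'n::finite) set \<Rightarrow> (real^'n \<Rightarrow> real^'n^'n) \<Rightarrow> bool" where
  "H1mat \<Omega> \<xi> \<longleftrightarrow> (\<forall>i j. Hm \<Omega> 1 (\<lambda>x. \<xi> x $ i $ j))"

definition hnorm1mat :: "(real^'n::finite) set \<Rightarrow> (real^'n \<Rightarrow> real^'n^'n) \<Rightarrow> real" where
  "hnorm1mat \<Omega> \<xi> = sqrt (\<Sum>i\<in>UNIV. \<Sum>j\<in>UNIV. (hnorm \<Omega> 1 (\<lambda>x. \<xi> x $ i $ j)) ^ 2)"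

definition wdiv :: "(real^'n::finite) set \<Rightarrow> (real^'n \<Rightarrow> real^'n^'n) \<Rightarrow> real^'n \<Rightarrow> real^'n" where
  "wdiv \<Omega> \<xi> x = (\<chi> i. \<Sum>j\<in>UNIV. wd \<Omega> [j] (\<lambda>y. \<xi> y $ i $ j) x)"

definition Hminus1 :: "(real^'n::finite) set \<Rightarrow> (('k::finite \<Rightarrow> real^'n \<Rightarrow> real) \<Rightarrow> real) \<Rightarrow> bool" where
  "Hminus1 \<Omega> G \<longleftrightarrow>
     (\<forall>U V a b. (\<forall>c. H10 \<Omega> (U c)) \<and> (\<forall>c. H10 \<Omega> (V c)) \<longrightarrow>
        G (\<lambda>c x. a * U c x + b * V c x) = a * G U + b * G V) \<and>
     (\<exists>C. \<forall>U. (\<forall>c. H10 \<Omega> (U c)) \<longrightarrow> \<bar>G U\<bar> \<le> C * sqrt (\<Sum>c\<in>UNIV. (hnorm \<Omega> 1 (U c)) ^ 2))"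

definition Aform :: "(real^'n::finite) set \<Rightarrow> ('k::finite \<Rightarrow> real^'n \<Rightarrow> real^'n^'n)
   \<Rightarrow> ('k \<Rightarrow> real^'n \<Rightarrow> real^'n^'n) \<Rightarrow> real" where
  "Aform \<Omega> P Q = (LINT x|lebesgue_on \<Omega>. (\<Sum>c\<in>UNIV. P c x \<bullet> Q c x))"

definition Bform :: "(real^'n::finite) set \<Rightarrow> (real^'n^'k \<Rightarrow> real^'n^'k \<Rightarrow> real^'n^'n^'k::finite)
   \<Rightarrow> ('k \<Rightarrow> real^'n \<Rightarrow> real^'n^'n) \<Rightarrow> ('k \<Rightarrow> real^'n \<Rightarrow> real^'n) \<Rightarrow> ('k \<Rightarrow> real^'n \<Rightarrow> real^'n) \<Rightarrow> real" where
  "Bform \<Omega> h P T X = (LINT x|lebesgue_on \<Omega>.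
      (\<Sum>c\<in>UNIV. P c x \<bullet> (h (\<chi> c'. T c' x) (\<chi> c'. X c' x) $ c)))"

abbreviation whessk where "whessk \<Omega> U \<equiv> (\<lambda>c. whess \<Omega> (U c))"
abbreviation wgradk where "wgradk \<Omega> U \<equiv> (\<lambda>c. wgrad \<Omega> (U c))"

definition hsemi2k :: "(real^'n::finite) set \<Rightarrow> ('k::finite \<Rightarrow> real^'n \<Rightarrow> real) \<Rightarrow> real" where
  "hsemi2k \<Omega> U = lpnormk \<Omega> 2 (whessk \<Omega> U)"

definition B_continuous where
  "B_continuous \<Omega> h \<longleftrightarrow> (\<exists>C. \<forall>P T X. (\<forall>c. Lp \<Omega> 2 (P c)) \<and> (\<forall>c. Lp \<Omega> 4 (T c)) \<and> (\<forall>c. Lp \<Omega> 4 (X c)) \<longrightarrow>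
      \<bar>Bform \<Omega> h P T X\<bar> \<le> C * lpnormk \<Omega> 2 P * lpnormk \<Omega> 4 T * lpnormk \<Omega> 4 X)"

definition B_antisym where
  "B_antisym \<Omega> h \<longleftrightarrow> (\<forall>P T. (\<forall>c. Lp \<Omega> 2 (P c)) \<and> (\<forall>c. Lp \<Omega> 4 (T c)) \<longrightarrow> Bform \<Omega> h P T T = 0)"

definition is_solution where
  "is_solution \<Omega> h L \<Psi> \<longleftrightarrow> (\<forall>c. H20 \<Omega> (\<Psi> c)) \<and>
     (\<forall>\<Phi>. (\<forall>c. H20 \<Omega> (\<Phi> c)) \<longrightarrow>
        Aform \<Omega> (whessk \<Omega> \<Psi>) (whessk \<Omega> \<Phi>) + Bform \<Omega> h (whessk \<Omega> \<Psi>) (wgradk \<Omega> \<Psi>) (wgradk \<Omega> \<Phi>) = L \<Phi>)"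

definition linA where
  "linA \<Omega> h \<Psi> \<Theta> \<Phi> = Aform \<Omega> (whessk \<Omega> \<Theta>) (whessk \<Omega> \<Phi>)
     + Bform \<Omega> h (whessk \<Omega> \<Psi>) (wgradk \<Omega> \<Theta>) (wgradk \<Omega> \<Phi>)
     + Bform \<Omega> h (whessk \<Omega> \<Theta>) (wgradk \<Omega> \<Psi>) (wgradk \<Omega> \<Phi>)"

definition regular_solution where
  "regular_solution \<Omega> h L \<Psi> \<longleftrightarrow> is_solution \<Omega> h L \<Psi> \<and>
     (\<exists>\<beta>>0. \<forall>\<Theta>. (\<forall>c. H20 \<Omega> (\<Theta> c)) \<and> hsemi2k \<Omega> \<Theta> = 1 \<longrightarrow>
        ereal \<beta> \<le> (SUP \<Phi>\<in>{\<Phi>. (\<forall>c. H20 \<Omega> (\<Phi> c)) \<and> hsemi2k \<Omega> \<Phi> = 1}. ereal (linA \<Omega> h \<Psi> \<Theta> \<Phi>)))"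

text \<open>X_{D,0} is represented (up to isomorphism) as R^N = {w :: nat => real. w i = 0 for i >= N}.\<close>
definition XD :: "nat \<Rightarrow> (nat \<Rightarrow> real) set" where
  "XD N = {w. \<forall>i\<ge>N. w i = 0}"

definition lin_on :: "nat \<Rightarrow> ((nat \<Rightarrow> real) \<Rightarrow> 'a \<Rightarrow> 'v::real_vector) \<Rightarrow> bool" where
  "lin_on N F \<longleftrightarrow> (\<forall>v\<in>XD N. \<forall>w\<in>XD N. \<forall>a b.
     F (\<lambda>i. a * v i + b * w i) = (\<lambda>x. a *\<^sub>R F v x + b *\<^sub>R F w x))"

definition normD where
  "normD \<Omega> HD w = lpnorm \<Omega> 2 (HD w)"

definition hessian_disc :: "(real^'n::finite) set \<Rightarrow> nat \<Rightarrow> ((nat \<Rightarrow> real) \<Rightarrow> real^'n \<Rightarrow> real)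
   \<Rightarrow> ((nat \<Rightarrow> real) \<Rightarrow> real^'n \<Rightarrow> real^'n) \<Rightarrow> ((nat \<Rightarrow> real) \<Rightarrow> real^'n \<Rightarrow> real^'n^'n) \<Rightarrow> bool" where
  "hessian_disc \<Omega> N PiD GD HD \<longleftrightarrow> lin_on N PiD \<and> lin_on N GD \<and> lin_on N HD \<and>
     (\<forall>w\<in>XD N. Lp \<Omega> 2 (PiD w) \<and> Lp \<Omega> 4 (GD w) \<and> Lp \<Omega> 2 (HD w)) \<and>
     (\<forall>w\<in>XD N. normD \<Omega> HD w = 0 \<longrightarrow> w = (\<lambda>_. 0))"

definition companion :: "(real^'n::finite) set \<Rightarrow> nat \<Rightarrow> ((nat \<Rightarrow> real) \<Rightarrow> real^'n \<Rightarrow> real) \<Rightarrow> bool" where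
  "companion \<Omega> N ED \<longleftrightarrow> lin_on N ED \<and> (\<forall>w\<in>XD N. H20 \<Omega> (ED w))"

text \<open>Suprema are taken in the extended reals (sup of the empty set is -infinity).\<close>
definition omegaE where
  "omegaE \<Omega> N GD HD ED = (SUP \<psi>\<in>XD N - {\<lambda>_. 0}.
     ereal (lpnorm \<Omega> 2 (\<lambda>x. GD \<psi> x - wgrad \<Omega> (ED \<psi>) x) / normD \<Omega> HD \<psi>))"

definition GammaE where
  "GammaE \<Omega> N HD ED = (SUP \<psi>\<in>XD N - {\<lambda>_. 0}.
     ereal (lpnorm \<Omega> 2 (whess \<Omega> (ED \<psi>)) / normD \<Omega> HD \<psi>))"

definition CD where
  "CD \<Omega> N PiD GD HD = (SUP w\<in>XD N - {\<lambda>_. 0}.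
     ereal (max (lpnorm \<Omega> 2 (PiD w)) (lpnorm \<Omega> 4 (GD w)) / normD \<Omega> HD w))"

definition SD where
  "SD \<Omega> N PiD GD HD \<phi> = (INF w\<in>XD N.
     lpnorm \<Omega> 2 (\<lambda>x. PiD w x - \<phi> x) + lpnorm \<Omega> 4 (\<lambda>x. GD w x - wgrad \<Omega> \<phi> x)
     + lpnorm \<Omega> 2 (\<lambda>x. HD w x - whess \<Omega> \<phi> x))"

definition WD where
  "WD \<Omega> N GD HD \<xi> = (SUP w\<in>XD N - {\<lambda>_. 0}.
     ereal (\<bar>LINT x|lebesgue_on \<Omega>. (\<xi> x \<bullet> HD w x + wdiv \<Omega> \<xi> x \<bullet> GD w x)\<bar> / normD \<Omega> HD w))"

definition alphaD where
  "alphaD \<Omega> N PiD GD HD = (SUP \<phi>\<in>{\<phi>. Hm \<Omega> 3 \<phi> \<and> H20 \<Omega> \<phi> \<and> hnorm \<Omega> 3 \<phi> \<noteq> 0}.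
     ereal (SD \<Omega> N PiD GD HD \<phi> / hnorm \<Omega> 3 \<phi>))"

definition gammaD where
  "gammaD \<Omega> N GD HD = (SUP \<xi>\<in>{\<xi>. H1mat \<Omega> \<xi> \<and> hnorm1mat \<Omega> \<xi> \<noteq> 0}.
     WD \<Omega> N GD HD \<xi> / ereal (hnorm1mat \<Omega> \<xi>))"

definition discLinA where
  "discLinA \<Omega> h \<Psi> GD HD \<Theta> \<Phi> = Aform \<Omega> (\<lambda>c. HD (\<Theta> c)) (\<lambda>c. HD (\<Phi> c))
     + Bform \<Omega> h (whessk \<Omega> \<Psi>) (\<lambda>c. GD (\<Theta> c)) (\<lambda>c. GD (\<Phi> c))
     + Bform \<Omega> h (\<lambda>c. HD (\<Theta> c)) (wgradk \<Omega> \<Psi>) (\<lambda>c. GD (\<Phi> c))"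

definition disc_well_posed :: "(real^'n::finite) set \<Rightarrow> _ \<Rightarrow> ('k::finite \<Rightarrow> real^'n \<Rightarrow> real) \<Rightarrow> nat \<Rightarrow> _" where
  "disc_well_posed \<Omega> h \<Psi> N GD HD ED \<longleftrightarrow>
     (\<forall>G. Hminus1 \<Omega> G \<longrightarrow>
       (\<exists>!\<Theta>::'k \<Rightarrow> nat \<Rightarrow> real. (\<forall>c. \<Theta> c \<in> XD N) \<and>
          (\<forall>\<Phi>. (\<forall>c. \<Phi> c \<in> XD N) \<longrightarrow>
             discLinA \<Omega> h \<Psi> GD HD \<Theta> \<Phi> = G (\<lambda>c. ED (\<Phi> c)))))"

end

theory Submission
  imports Defs "HOL-Library.Function_Algebras"
begin

text \<open>The discrete problem is a square linear system, so well-posedness means that its kernel is trivial.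
  Otherwise there are, for every \<open>n\<close>, admissible discretisations with \<open>\<rho> = 1 / (n + 1)\<close> and kernel elements
  \<open>\<Theta>\<^sub>n\<close> normalised by \<open>\<parallel>H\<^sub>n \<Theta>\<^sub>n\<parallel> = 1\<close>.  Test functions \<open>\<phi>\<^sub>n\<close> close to \<open>E\<^sub>n \<Theta>\<^sub>n\<close> are bounded in
  \<open>H\<^sup>2\<close>; interpolating test functions (\<open>\<alpha> \<rightarrow> 0\<close>) and using that \<open>H\<^sub>n \<Theta>\<^sub>n\<close> minus the Hessian of \<open>\<phi>\<^sub>n\<close> tends weakly
  to \<open>0\<close> (\<open>\<gamma> \<rightarrow> 0\<close>), the linearised form of \<open>\<phi>\<^sub>n\<close> against any fixed test function tends to \<open>0\<close>.  The inf-sup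
  condition then forces \<open>\<phi>\<^sub>n\<close> to tend weakly to \<open>0\<close>, and by Rellich the gradients tend strongly to \<open>0\<close> in \<open>L\<^sup>2\<close>,
  hence so do the discrete gradients (\<open>\<omega> \<rightarrow> 0\<close>).  Testing the discrete problem with \<open>\<Theta>\<^sub>n\<close> itself, where one
  trilinear term vanishes by antisymmetry, gives \<open>\<parallel>H\<^sub>n \<Theta>\<^sub>n\<parallel> \<rightarrow> 0\<close>, a contradiction.  The embedding of \<open>H\<^sup>2\<^sub>0\<close>
  into \<open>W\<^sup>1\<^sup>,\<^sup>4\<close> comes from the bound on \<open>C\<^sub>D\<close> together with \<open>\<alpha> \<rightarrow> 0\<close>.\<close>

section \<open>Smooth functions and test functions\<close>

text \<open>The difficulty is an imbalance of convergence. The companion is close to the discrete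
  function in its gradient, but its Hessian is merely bounded; Hessians can therefore be compared
  only weakly. Every trilinear term must pair such a Hessian with factors that converge strongly.
  Rellich yields gradients in L^2, whereas the trilinear form is continuous only for gradients in
  L^4; the remedy is to replace one fixed gradient by that of a test function, which is bounded,
  with an L^4 error uniform along the sequence.

  Weak derivatives \<open>wd\<close> are Hilbert choices and linear only almost everywhere. The
  argument therefore lives on families of test functions, whose classical derivatives are exactly
  linear, and \<open>H20\<close> is reached by density. This space is not complete, so no weak limit
  is available to which the inf-sup condition could be applied; it is used quantitatively on convex
  combinations instead.

  Estimates concern integrals of p-th powers rather than norms. The factors 4, 16 and 256 all stem
  from the crude bound
  \<open>norm (a + b) ^ p \<le> 2 ^ p * (norm a ^ p + norm b ^ p)\<close>.\<close>

lemma smooth_fun_differentiable: "smooth_fun f \<Longrightarrow> f differentiable (at x)"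
  by (erule smooth_fun.cases) auto

lemma smooth_fun_pd: "smooth_fun f \<Longrightarrow> smooth_fun (pd i f)"
  by (erule smooth_fun.cases) auto

lemma smooth_fun_continuous_on: "smooth_fun f \<Longrightarrow> continuous_on S f"
  by (meson continuous_at_imp_continuous_on differentiable_imp_continuous_within smooth_fun_differentiable)

lemma smooth_fun_borel_measurable: "smooth_fun f \<Longrightarrow> f \<in> borel_measurable borel"
  by (simp add: borel_measurable_continuous_onI smooth_fun_continuous_on)

lemma frechet_derivative_eq_pd:
  fixes f :: "real^'n::finite \<Rightarrow> real"
  assumes "f differentiable (at x)"
  shows "frechet_derivative f (at x) v = (\<Sum>i\<in>UNIV. v $ i * pd i f x)"
proof -
  have lin: "linear (frechet_derivative f (at x))"
    using assms linear_frechet_derivative by blast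
  have "frechet_derivative f (at x) v = frechet_derivative f (at x) (\<Sum>i\<in>UNIV. v $ i *\<^sub>R axis i 1)"
    by (simp add: basis_expansion scalar_mult_eq_scaleR[symmetric])
  then show ?thesis
    by (simp add: linear_sum[OF lin] linear_cmul[OF lin] pd_def)
qed

lemma has_derivative_pd:
  fixes f :: "real^'n::finite \<Rightarrow> real"
  assumes "smooth_fun f"
  shows "(f has_derivative (\<lambda>v. \<Sum>i\<in>UNIV. v $ i * pd i f x)) (at x)"
proof -
  have d: "f differentiable (at x)" using assms by (rule smooth_fun_differentiable)
  have "frechet_derivative f (at x) = (\<lambda>v. \<Sum>i\<in>UNIV. v $ i * pd i f x)"
    using frechet_derivative_eq_pd[OF d] by (intro ext) simp
  then show ?thesis using d frechet_derivative_works by metis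
qed

lemma pd_eqI: "(f has_derivative f') (at x) \<Longrightarrow> pd i f x = f' (axis i 1)"
  unfolding pd_def using frechet_derivative_at[of f f' x] by simp

lemma pd_const: "pd i (\<lambda>_. c) = (\<lambda>_. 0)"
  by (rule ext) (rule pd_eqI[OF has_derivative_const])

lemma pd_add:
  assumes "f differentiable (at x)" "g differentiable (at x)"
  shows "pd i (\<lambda>x. f x + g x) x = pd i f x + pd i g x"
  using pd_eqI[OF has_derivative_add] assms unfolding pd_def frechet_derivative_works by blast

lemma pd_mult:
  assumes "f differentiable (at x)" "g differentiable (at x)"
  shows "pd i (\<lambda>x. f x * g x :: real) x = f x * pd i g x + pd i f x * g x"
  using pd_eqI[OF has_derivative_mult] assms unfolding pd_def frechet_derivative_works by blast

lemma pd_scale: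
  assumes "f differentiable (at x)"
  shows "pd i (\<lambda>x. c * f x :: real) x = c * pd i f x"
  using pd_mult[of "\<lambda>_. c" x f i] assms by (simp add: pd_const)

text \<open>\<open>flat_exp 0\<close> is the classical flat function. The factor
  \<open>(1 / t) ^ k\<close> is carried along because differentiation raises the exponent, so that
  the family as a whole is closed under derivatives up to linear combinations.\<close>

definition flat_exp :: "nat \<Rightarrow> real \<Rightarrow> real" where
  "flat_exp k t = (if t > 0 then (1 / t) ^ k * exp (- (1 / t)) else 0)"

lemma flat_exp_tendsto_0: "(flat_exp k \<longlongrightarrow> 0) (at_right 0)"
proof -
  have "((\<lambda>s. s ^ k / exp s) \<longlongrightarrow> (0::real)) at_top"
    by (rule tendsto_power_div_exp_0)
  then have "((\<lambda>t. (inverse t) ^ k / exp (inverse t)) \<longlongrightarrow> (0::real)) (at_right 0)"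
    by (rule filterlim_compose) (rule filterlim_inverse_at_top_right)
  then show ?thesis
    by (rule tendsto_cong[THEN iffD1, rotated])
       (auto simp: eventually_at_filter flat_exp_def exp_minus divide_simps)
qed

lemma DERIV_flat_exp:
  "(flat_exp k has_real_derivative flat_exp (k + 2) t - real k * flat_exp (k + 1) t) (at t)"
proof (cases t "0::real" rule: linorder_cases)
  case less
  have "((\<lambda>_. 0) has_real_derivative 0) (at t)" by simp
  moreover have "eventually (\<lambda>s. s < 0) (nhds t)"
    using less eventually_nhds by (metis greaterThan_iff lessThan_iff open_lessThan)
  then have "eventually (\<lambda>s. flat_exp k s = 0) (nhds t)"
    by eventually_elim (simp add: flat_exp_def)
  ultimately have "(flat_exp k has_real_derivative 0) (at t)"
    using DERIV_cong_ev[of t t "flat_exp k" "\<lambda>_. 0" 0 0] by simp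
  then show ?thesis using less by (simp add: flat_exp_def)
next
  case greater
  have "((\<lambda>t. (1 / t) ^ k * exp (- (1 / t))) has_real_derivative
      flat_exp (k + 2) t - real k * flat_exp (k + 1) t) (at t)"
    using greater
    by (auto intro!: derivative_eq_intros simp: flat_exp_def field_simps power2_eq_square)
       (cases k; simp add: field_simps power2_eq_square)
  moreover have "eventually (\<lambda>s. s > 0) (nhds t)"
    using greater eventually_nhds by (metis greaterThan_iff open_greaterThan)
  then have "eventually (\<lambda>s. flat_exp k s = (1 / s) ^ k * exp (- (1 / s))) (nhds t)"
    by eventually_elim (simp add: flat_exp_def)
  ultimately show ?thesis
    using DERIV_cong_ev[of t t "flat_exp k" "\<lambda>t. (1 / t) ^ k * exp (- (1 / t))"] by simp
next
  case equal
  \<comment> \<open>For \<open>h > 0\<close> the quotient equals \<open>flat_exp (k + 1) h\<close>: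
    dividing by \<open>h\<close> adds one factor \<open>1 / h\<close>, which the exponential
    absorbs.\<close>
  have 1: "((\<lambda>h. (flat_exp k (0 + h) - flat_exp k 0) / h) \<longlongrightarrow> 0) (at_right 0)"
    by (rule tendsto_cong[THEN iffD1, OF _ flat_exp_tendsto_0[of "k+1"]])
       (auto simp: eventually_at_filter flat_exp_def)
  have 2: "((\<lambda>h. (flat_exp k (0 + h) - flat_exp k 0) / h) \<longlongrightarrow> 0) (at_left 0)"
    by (rule tendsto_eventually) (auto simp: eventually_at_filter flat_exp_def)
  show ?thesis
    using 1 2 equal by (simp add: DERIV_def filterlim_at_split flat_exp_def)
qed

lemma flat_exp_bounds: "0 \<le> flat_exp 0 t" "flat_exp 0 t \<le> 1"
  by (auto simp: flat_exp_def)

lemma flat_exp_eq_0_iff: "flat_exp k t = 0 \<longleftrightarrow> t \<le> 0"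
  by (auto simp: flat_exp_def)

text \<open>The closure of the smooth functions under the ring operations, together with the cut-off
  profiles, is stable under partial derivatives; hence by coinduction it consists of smooth functions.\<close>

inductive smooth_alg :: "(real^'n::finite \<Rightarrow> real) \<Rightarrow> bool" where
  smooth: "smooth_fun f \<Longrightarrow> smooth_alg f"
| const: "smooth_alg (\<lambda>_. c)"
| coord: "smooth_alg (\<lambda>x. flat_exp k (c * x $ i + d))"
| add: "smooth_alg f \<Longrightarrow> smooth_alg g \<Longrightarrow> smooth_alg (\<lambda>x. f x + g x)"
| mult: "smooth_alg f \<Longrightarrow> smooth_alg g \<Longrightarrow> smooth_alg (\<lambda>x. f x * g x)"

lemma has_derivative_coord:
  fixes x :: "real^'n::finite"
  shows "((\<lambda>x. flat_exp k (c * x $ i + d)) has_derivative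
    (\<lambda>v. (c * v $ i) * (flat_exp (k + 2) (c * x $ i + d) - real k * flat_exp (k + 1) (c * x $ i + d)))) (at x)"
proof -
  have "((\<lambda>x::real^'n. c * x $ i + d) has_derivative (\<lambda>v. c * v $ i)) (at x)"
    by (auto intro!: derivative_eq_intros bounded_linear_imp_has_derivative bounded_linear_vec_nth)
  from DERIV_compose_FDERIV[OF DERIV_flat_exp this, of k] show ?thesis by simp
qed

lemma smooth_alg_differentiable: "smooth_alg f \<Longrightarrow> f differentiable (at x)"
proof (induction rule: smooth_alg.induct)
  case (coord k c i d)
  then show ?case using has_derivative_coord differentiableI by blast
qed (auto intro: smooth_fun_differentiable)

lemma smooth_alg_pd: "smooth_alg f \<Longrightarrow> smooth_alg (pd j f)"
proof (induction rule: smooth_alg.induct)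
  case (smooth f)
  then show ?case by (simp add: smooth_alg.smooth smooth_fun_pd)
next
  case (const c)
  then show ?case by (simp add: pd_const smooth_alg.const)
next
  case (coord k c i d)
  have "pd j (\<lambda>x. flat_exp k (c * x $ i + d)) = (\<lambda>x. (c * axis j 1 $ i) *
      (flat_exp (k + 2) (c * x $ i + d) + (- real k) * flat_exp (k + 1) (c * x $ i + d)))"
    by (rule ext, subst pd_eqI[OF has_derivative_coord]) simp
  then show ?case by (simp only:) (intro smooth_alg.intros)
next
  case (add f g)
  have "pd j (\<lambda>x. f x + g x) = (\<lambda>x. pd j f x + pd j g x)"
    using add by (auto intro!: ext pd_add smooth_alg_differentiable)
  then show ?case using add by (simp add: smooth_alg.add)
next
  case (mult f g)
  have "pd j (\<lambda>x. f x * g x) = (\<lambda>x. f x * pd j g x + pd j f x * g x)"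
    using mult by (auto intro!: ext pd_mult smooth_alg_differentiable)
  then show ?case using mult by (simp add: smooth_alg.intros)
qed

lemma smooth_alg_smooth: "smooth_alg f \<Longrightarrow> smooth_fun f"
  by (coinduction arbitrary: f) (auto intro: smooth_alg_differentiable smooth_alg_pd)

lemma smooth_fun_add: "smooth_fun f \<Longrightarrow> smooth_fun g \<Longrightarrow> smooth_fun (\<lambda>x. f x + g x)"
  by (simp add: smooth_alg_smooth smooth_alg.intros)

lemma smooth_fun_mult: "smooth_fun f \<Longrightarrow> smooth_fun g \<Longrightarrow> smooth_fun (\<lambda>x. f x * g x)"
  by (simp add: smooth_alg_smooth smooth_alg.intros)

lemma smooth_fun_const: "smooth_fun (\<lambda>_. c)"
  by (simp add: smooth_alg_smooth smooth_alg.intros)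

lemma smooth_fun_prod: "finite A \<Longrightarrow> (\<And>a. a \<in> A \<Longrightarrow> smooth_fun (f a)) \<Longrightarrow> smooth_fun (\<lambda>x. \<Prod>a\<in>A. f a x)"
  by (induction A rule: finite_induct) (auto simp: smooth_fun_const smooth_fun_mult)

lemma smooth_fun_Dl: "smooth_fun f \<Longrightarrow> smooth_fun (Dl is f)"
  by (induction "is") (auto simp: smooth_fun_pd)

text \<open>The closure of the support is contained in any compact set off which the function
  vanishes. Naming such a set is easier for sums, products and derivatives than computing
  supports.\<close>

lemma test_fnI:
  assumes "smooth_fun \<phi>" "compact K" "K \<subseteq> \<Omega>" "\<And>x. x \<notin> K \<Longrightarrow> \<phi> x = 0"
  shows "test_fn \<Omega> \<phi>"
proof -
  have "closure {x. \<phi> x \<noteq> 0} \<subseteq> K"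
    by (rule closure_minimal) (use assms compact_imp_closed in auto)
  moreover from this have "compact (closure {x. \<phi> x \<noteq> 0})"
    using assms(2) compact_imp_bounded bounded_subset closure_subset compact_closure by metis
  ultimately show ?thesis using assms unfolding test_fn_def by auto
qed

lemma test_fnE:
  assumes "test_fn \<Omega> \<phi>"
  obtains K where "smooth_fun \<phi>" "compact K" "K \<subseteq> \<Omega>" "\<And>x. x \<notin> K \<Longrightarrow> \<phi> x = 0"
proof (rule that[of "closure {x. \<phi> x \<noteq> 0}"])
  show "\<phi> x = 0" if "x \<notin> closure {x. \<phi> x \<noteq> 0}" for x
    using that closure_subset[of "{x. \<phi> x \<noteq> 0}"] by auto
qed (use assms in \<open>auto simp: test_fn_def\<close>)

lemma test_fn_smooth: "test_fn \<Omega> \<phi> \<Longrightarrow> smooth_fun \<phi>"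
  by (simp add: test_fn_def)

lemma test_fn_outside: "test_fn \<Omega> \<phi> \<Longrightarrow> x \<notin> \<Omega> \<Longrightarrow> \<phi> x = 0"
  using closure_subset[of "{x. \<phi> x \<noteq> 0}"] unfolding test_fn_def by auto

lemma test_fn_mono: "test_fn \<Omega> \<phi> \<Longrightarrow> \<Omega> \<subseteq> \<Omega>' \<Longrightarrow> test_fn \<Omega>' \<phi>"
  unfolding test_fn_def by auto

lemma test_fn_zero: "test_fn \<Omega> (\<lambda>_. 0)"
  by (rule test_fnI[of _ "{}"]) (auto simp: smooth_fun_const)

lemma test_fn_add: "test_fn \<Omega> f \<Longrightarrow> test_fn \<Omega> g \<Longrightarrow> test_fn \<Omega> (\<lambda>x. f x + g x)"
  by (elim test_fnE, rule_tac K = "K \<union> Ka" in test_fnI) (auto simp: smooth_fun_add)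

lemma test_fn_mult: "test_fn \<Omega> f \<Longrightarrow> smooth_fun g \<Longrightarrow> test_fn \<Omega> (\<lambda>x. f x * g x)"
  by (elim test_fnE, rule_tac K = K in test_fnI) (auto simp: smooth_fun_mult)

lemma test_fn_scale: "test_fn \<Omega> f \<Longrightarrow> test_fn \<Omega> (\<lambda>x. c * f x)"
  using test_fn_mult[OF _ smooth_fun_const[of c], of \<Omega> f] by (simp add: mult.commute)

lemma test_fn_diff: "test_fn \<Omega> f \<Longrightarrow> test_fn \<Omega> g \<Longrightarrow> test_fn \<Omega> (\<lambda>x. f x - g x)"
  using test_fn_add[of \<Omega> f "\<lambda>x. (-1) * g x"] test_fn_scale[of \<Omega> g "-1"] by simp

lemma test_fn_sum: "finite A \<Longrightarrow> (\<And>a. a \<in> A \<Longrightarrow> test_fn \<Omega> (f a)) \<Longrightarrow> test_fn \<Omega> (\<lambda>x. \<Sum>a\<in>A. f a x)"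
  by (induction A rule: finite_induct) (auto simp: test_fn_zero test_fn_add)

lemma pd_zero_outside:
  assumes "closed K" "\<And>x. x \<notin> K \<Longrightarrow> f x = 0" "x \<notin> K"
  shows "pd i f x = 0"
proof -
  have "((\<lambda>_. 0::real) has_derivative (\<lambda>_. 0)) (at x)" by simp
  then have "(f has_derivative (\<lambda>_. 0)) (at x)"
    by (rule has_derivative_transform_within_open[of _ _ _ UNIV "- K"]) (use assms in auto)
  from pd_eqI[OF this] show ?thesis .
qed

lemma test_fn_pd: "test_fn \<Omega> f \<Longrightarrow> test_fn \<Omega> (pd i f)"
  by (elim test_fnE, rule_tac K = K in test_fnI)
     (auto simp: smooth_fun_pd intro!: pd_zero_outside compact_imp_closed)

lemma test_fn_Dl: "test_fn \<Omega> f \<Longrightarrow> test_fn \<Omega> (Dl is f)"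
  by (induction "is") (auto simp: test_fn_pd)

lemma test_fn_bounded:
  assumes "test_fn \<Omega> f"
  obtains C where "C > 0" "\<And>x. \<bar>f x\<bar> \<le> C"
proof -
  from assms obtain K where K: "smooth_fun f" "compact K" "\<And>x. x \<notin> K \<Longrightarrow> f x = 0"
    by (rule test_fnE) blast
  have "compact (f ` K)"
    using K smooth_fun_continuous_on compact_continuous_image by blast
  then obtain C where C: "\<And>x. x \<in> K \<Longrightarrow> \<bar>f x\<bar> \<le> C"
    by (metis compact_imp_bounded bounded_iff imageI real_norm_def)
  show ?thesis
  proof (rule that[of "max C 1"])
    show "\<bar>f x\<bar> \<le> max C 1" for x
      using C[of x] K(3)[of x] by (cases "x \<in> K") auto
  qed simp
qed

lemma test_fn_Dl_add:
  assumes "smooth_fun f" "smooth_fun g"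
  shows "Dl is (\<lambda>x. f x + g x) = (\<lambda>x. Dl is f x + Dl is g x)"
  by (induction "is") (auto intro!: ext pd_add smooth_fun_differentiable smooth_fun_Dl assms)

lemma test_fn_Dl_scale:
  assumes "smooth_fun f"
  shows "Dl is (\<lambda>x. c * f x) = (\<lambda>x. c * Dl is f x)"
  by (induction "is") (auto intro!: ext pd_scale smooth_fun_differentiable smooth_fun_Dl assms)

lemma Dl_append: "Dl (is @ js) f = Dl is (Dl js f)"
  by (induction "is") auto

text \<open>The shift by -1 makes a factor vanish within distance \<open>1 / m\<close> of the
  corresponding face, so the support is compact in the open box. Inside the box the arguments tend
  to infinity with \<open>m\<close>, and the value tends to 1.\<close>

definition box_bump :: "real^'n::finite \<Rightarrow> real^'n \<Rightarrow> nat \<Rightarrow> real^'n \<Rightarrow> real" where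
  "box_bump a b m x = (\<Prod>i\<in>UNIV. flat_exp 0 (real m * (x $ i - a $ i) - 1) * flat_exp 0 (real m * (b $ i - x $ i) - 1))"

lemma box_bump_smooth: "smooth_fun (box_bump a b m)"
proof -
  have c: "smooth_fun (\<lambda>x::real^'a. flat_exp 0 (c * x $ i + d))" for i c d
    by (rule smooth_alg_smooth[OF smooth_alg.coord])
  have 1: "real m * (t - s) - 1 = real m * t + (- real m * s - 1)" for t s
    by (simp add: right_diff_distrib)
  have 2: "real m * (s - t) - 1 = (- real m) * t + (real m * s - 1)" for t s
    by (simp add: right_diff_distrib)
  have "smooth_fun (\<lambda>x. flat_exp 0 (real m * (x $ i - a $ i) - 1) * flat_exp 0 (real m * (b $ i - x $ i) - 1))" for i
    unfolding 1[of _ "a $ i"] 2[of "b $ i"] by (rule smooth_fun_mult[OF c c])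
  then have "smooth_fun (\<lambda>x. box_bump a b m x)"
    unfolding box_bump_def by (rule smooth_fun_prod[OF finite])
  then show ?thesis by simp
qed

lemma box_bump_bounds: "0 \<le> box_bump a b m x" "box_bump a b m x \<le> 1"
proof -
  have t: "0 \<le> flat_exp 0 s * flat_exp 0 t" "flat_exp 0 s * flat_exp 0 t \<le> 1" for s t
    using flat_exp_bounds[of s] flat_exp_bounds[of t] by (simp_all add: mult_le_one)
  show "0 \<le> box_bump a b m x" unfolding box_bump_def by (rule prod_nonneg) (rule t)
  show "box_bump a b m x \<le> 1" unfolding box_bump_def by (rule prod_le_1) (simp add: t)
qed

lemma box_bump_outside:
  assumes "x \<notin> cbox (a + (\<chi> i. 1 / real m)) (b - (\<chi> i. 1 / real m))"
  shows "box_bump a b m x = 0"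
proof -
  obtain i where i: "x $ i - a $ i < 1 / real m \<or> b $ i - x $ i < 1 / real m"
  proof -
    obtain i where "\<not> (a $ i + 1 / real m \<le> x $ i \<and> x $ i \<le> b $ i - 1 / real m)"
      using assms unfolding mem_box_cart by auto
    then have "x $ i - a $ i < 1 / real m \<or> b $ i - x $ i < 1 / real m" by linarith
    then show ?thesis using that by blast
  qed
  have le: "real m * c - 1 \<le> 0" if "c < 1 / real m" for c
  proof (cases "m = 0")
    case False
    then have "real m * c \<le> real m * (1 / real m)" using that by (intro mult_left_mono) auto
    then show ?thesis using False by simp
  qed simp
  have "flat_exp 0 (real m * (x $ i - a $ i) - 1) * flat_exp 0 (real m * (b $ i - x $ i) - 1) = 0"
    using i le by (auto simp only: flat_exp_eq_0_iff mult_eq_0_iff)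
  then show ?thesis unfolding box_bump_def by (intro prod_zero[OF finite] bexI[of _ i]) auto
qed

lemma box_bump_outside_box: "x \<notin> box a b \<Longrightarrow> box_bump a b m x = 0"
proof -
  assume "x \<notin> box a b"
  then obtain i where i: "x $ i \<le> a $ i \<or> x $ i \<ge> b $ i"
    by (auto simp: mem_box_cart not_less)
  have le: "real m * c - 1 \<le> 0" if "c \<le> 0" for c
    using mult_nonneg_nonpos[of "real m" c] that by simp
  have "x $ i - a $ i \<le> 0 \<or> b $ i - x $ i \<le> 0" using i by linarith
  then have "flat_exp 0 (real m * (x $ i - a $ i) - 1) * flat_exp 0 (real m * (b $ i - x $ i) - 1) = 0"
    using le by (auto simp only: flat_exp_eq_0_iff mult_eq_0_iff)
  then show ?thesis unfolding box_bump_def by (intro prod_zero[OF finite] bexI[of _ i]) auto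
qed

lemma box_bump_cbox_subset:
  assumes "m > 0" shows "cbox (a + (\<chi> i. 1 / real m)) (b - (\<chi> i. 1 / real m)) \<subseteq> box a b"
proof
  fix x assume x: "x \<in> cbox (a + (\<chi> i. 1 / real m)) (b - (\<chi> i. 1 / real m))"
  have pos: "0 < 1 / real m" using assms by simp
  have "a $ i < x $ i \<and> x $ i < b $ i" for i
  proof -
    have "a $ i + 1 / real m \<le> x $ i" "x $ i \<le> b $ i - 1 / real m"
      using x unfolding mem_box_cart by auto
    with pos show ?thesis by linarith
  qed
  then show "x \<in> box a b" by (auto simp: mem_box_cart)
qed

lemma flat_exp_tendsto_1:
  assumes "c > 0" shows "(\<lambda>m. flat_exp 0 (real m * c - 1)) \<longlonglongrightarrow> 1"
proof -
  have lim: "filterlim (\<lambda>m. real m * c - 1) at_top sequentially"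
    using assms by (auto intro!: filterlim_tendsto_add_at_top[of "\<lambda>_. -1" "-1", simplified]
        filterlim_at_top_mult_tendsto_pos[OF tendsto_const] filterlim_real_sequentially)
  have "(\<lambda>m. exp (- inverse (real m * c - 1))) \<longlonglongrightarrow> exp (- 0)"
    by (intro tendsto_intros tendsto_inverse_0_at_top lim)
  moreover have "eventually (\<lambda>m. real m * c - 1 > 0) sequentially"
    using lim unfolding filterlim_at_top_dense by blast
  then have "eventually (\<lambda>m. exp (- inverse (real m * c - 1)) = flat_exp 0 (real m * c - 1)) sequentially"
    by eventually_elim (simp add: flat_exp_def inverse_eq_divide)
  ultimately show ?thesis using tendsto_cong by fastforce
qed

lemma box_bump_tendsto_1:
  assumes "x \<in> box a b" shows "(\<lambda>m. box_bump a b m x) \<longlonglongrightarrow> 1"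
proof -
  have "(\<lambda>m. box_bump a b m x) \<longlonglongrightarrow> (\<Prod>i\<in>(UNIV::'a set). 1 * 1)"
    unfolding box_bump_def
    by (intro tendsto_prod tendsto_mult flat_exp_tendsto_1)
       (use assms in \<open>auto simp: mem_box_cart\<close>)
  then show ?thesis by simp
qed

text \<open>An open set is a countable union of open boxes, and the first \<open>m\<close> bumps at
  level \<open>m\<close> are merged into one function. This serves to pass from vanishing integrals
  against test functions to vanishing integrals over open sets.\<close>

lemma open_approx_test_fn:
  fixes W :: "(real^'n::finite) set"
  assumes "open W"
  obtains \<phi> where "\<And>m::nat. test_fn W (\<phi> m)" "\<And>m x. 0 \<le> \<phi> m x" "\<And>m x. \<phi> m x \<le> 1"
    "\<And>x. (\<lambda>m. \<phi> m x) \<longlonglongrightarrow> indicator W x"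
proof (cases "W = {}")
  case True
  then show ?thesis by (intro that[of "\<lambda>_ _. 0"]) (auto simp: test_fn_zero)
next
  case False
  obtain D where D: "countable D" "D \<subseteq> Pow W" "\<And>X. X \<in> D \<Longrightarrow> \<exists>a b. X = box a b" "\<Union>D = W"
    using open_countable_Union_open_box[OF assms] by metis
  have Dne: "D \<noteq> {}" using False D by auto
  obtain a b where ab: "\<And>j. from_nat_into D j = box (a j) (b j)"
    using D(3)[OF from_nat_into[OF Dne]] by metis
  define \<eta> where "\<eta> j m = box_bump (a j) (b j) m" for j m
  \<comment> \<open>One minus the product of the complements keeps the values in [0, 1] and
    dominates each bump with \<open>j < m\<close>, so a single bump tending to 1 suffices.\<close>
  define \<phi> where "\<phi> m x = 1 - (\<Prod>j<m. (1 - \<eta> j m x))" for m :: nat and x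
  have sub: "box (a j) (b j) \<subseteq> W" for j using from_nat_into[OF Dne, of j] D(2) ab by auto
  have p: "0 \<le> 1 - \<eta> j m x" "1 - \<eta> j m x \<le> 1" for j m x
    unfolding \<eta>_def using box_bump_bounds[of "a j" "b j" m x] by auto
  show ?thesis
  proof
    show "test_fn W (\<phi> m)" for m
    proof (rule test_fnI[of _ "\<Union>j<m. cbox (a j + (\<chi> i. 1 / real m)) (b j - (\<chi> i. 1 / real m))"])
      have "\<phi> m = (\<lambda>x. 1 + (-1) * (\<Prod>j<m. (1 + (-1) * \<eta> j m x)))" by (auto simp: \<phi>_def)
      moreover have "smooth_fun (\<lambda>x. 1 + (-1) * (\<Prod>j<m. (1 + (-1) * \<eta> j m x)))"
        unfolding \<eta>_def
        by (intro smooth_fun_add smooth_fun_const smooth_fun_mult smooth_fun_prod box_bump_smooth) auto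
      ultimately show "smooth_fun (\<phi> m)" by simp
      show "compact (\<Union>j<m. cbox (a j + (\<chi> i. 1 / real m)) (b j - (\<chi> i. 1 / real m)))"
        by (intro compact_UN) auto
      show "(\<Union>j<m. cbox (a j + (\<chi> i. 1 / real m)) (b j - (\<chi> i. 1 / real m))) \<subseteq> W"
        using box_bump_cbox_subset[of m] sub by (cases "m = 0") blast+
      fix x assume "x \<notin> (\<Union>j<m. cbox (a j + (\<chi> i. 1 / real m)) (b j - (\<chi> i. 1 / real m)))"
      then show "\<phi> m x = 0" unfolding \<phi>_def \<eta>_def by (simp add: box_bump_outside)
    qed
    show "0 \<le> \<phi> m x" "\<phi> m x \<le> 1" for m x
      unfolding \<phi>_def using p by (auto intro!: prod_le_1 prod_nonneg)
    show "(\<lambda>m. \<phi> m x) \<longlonglongrightarrow> indicator W x" for x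
    proof (cases "x \<in> W")
      case True
      then obtain X where "X \<in> D" "x \<in> X" using D by auto
      then obtain j where j: "x \<in> box (a j) (b j)"
        using ab D(1) from_nat_into_surj by metis
      have "(\<lambda>m. \<Prod>j<m. (1 - \<eta> j m x)) \<longlonglongrightarrow> 0"
      proof (rule tendsto_sandwich[of "\<lambda>_. 0" _ _ "\<lambda>m. 1 - \<eta> j m x"])
        show "eventually (\<lambda>m. (\<Prod>j<m. (1 - \<eta> j m x)) \<le> 1 - \<eta> j m x) sequentially"
          using eventually_gt_at_top[of j]
        proof eventually_elim
          case (elim m)
          have "(\<Prod>j<m. (1 - \<eta> j m x)) = (1 - \<eta> j m x) * (\<Prod>j\<in>{..<m} - {j}. (1 - \<eta> j m x))"
            using elim by (intro prod.remove) auto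
          also have "\<dots> \<le> (1 - \<eta> j m x) * 1"
            using p by (intro mult_left_mono prod_le_1) auto
          finally show ?case by simp
        qed
        show "(\<lambda>m. 1 - \<eta> j m x) \<longlonglongrightarrow> 0"
          using tendsto_diff[OF tendsto_const box_bump_tendsto_1[OF j], of 1] by (simp add: \<eta>_def)
      qed (use p in \<open>auto intro!: always_eventually prod_nonneg\<close>)
      from tendsto_diff[OF tendsto_const this, of 1] show ?thesis
        using True by (simp add: \<phi>_def)
    next
      case False
      then have "\<eta> j m x = 0" for j m
        unfolding \<eta>_def using sub by (intro box_bump_outside_box) auto
      then show ?thesis using False by (simp add: \<phi>_def)
    qed
  qed
qed

section \<open>Integration by parts and difference quotients\<close>

definition gr :: "(real^'n::finite \<Rightarrow> real) \<Rightarrow> real^'n \<Rightarrow> real^'n" where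
  "gr f x = (\<chi> i. pd i f x)"

lemma gr_nth [simp]: "gr f x $ i = pd i f x"
  by (simp add: gr_def)

lemma has_derivative_gr: "smooth_fun f \<Longrightarrow> (f has_derivative (\<lambda>v. v \<bullet> gr f x)) (at x)"
  using has_derivative_pd[of f x] by (simp add: inner_vec_def)

lemma test_fn_borel_measurable [measurable]: "test_fn \<Omega> f \<Longrightarrow> f \<in> borel_measurable borel"
  by (simp add: smooth_fun_borel_measurable test_fn_smooth)

lemma test_fn_lborel_integrable:
  assumes "test_fn \<Omega> f" shows "integrable lborel f"
proof -
  obtain K where K: "smooth_fun f" "compact K" "\<And>x. x \<notin> K \<Longrightarrow> f x = 0"
    using assms by (rule test_fnE) blast
  have "integrable lborel (\<lambda>x. indicator K x *\<^sub>R f x)"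
    using K by (intro borel_integrable_compact smooth_fun_continuous_on) auto
  moreover have "(\<lambda>x. indicator K x *\<^sub>R f x) = f"
    using K(3) by (auto simp: indicator_def fun_eq_iff)
  ultimately show ?thesis by simp
qed

lemma lborel_integral_shift:
  fixes f :: "real^'n::finite \<Rightarrow> real"
  assumes "f \<in> borel_measurable borel"
  shows "(\<integral>x. f (x + c) \<partial>lborel) = (\<integral>x. f x \<partial>lborel)"
proof -
  have "(\<integral>x. f x \<partial>lborel) = (\<integral>x. f x \<partial>(distr lborel borel ((+) c)))"
    by (simp add: lborel_distr_plus)
  also have "\<dots> = (\<integral>x. f (c + x) \<partial>lborel)"
    by (rule integral_distr) (use assms in auto)
  finally show ?thesis by (simp add: add.commute)
qed

lemma smooth_fun_shift: "smooth_fun f \<Longrightarrow> smooth_fun (\<lambda>x. f (x + c))"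
  and pd_shift: "smooth_fun f \<Longrightarrow> pd i (\<lambda>x. f (x + c)) = (\<lambda>x. pd i f (x + c))"
proof -
  have der: "((\<lambda>x. f (x + c)) has_derivative (\<lambda>v. v \<bullet> gr f (x + c))) (at x)" if "smooth_fun f" for f x
  proof -
    have "((\<lambda>x. x + c) has_derivative (\<lambda>v. v)) (at x)" by (auto intro!: derivative_eq_intros)
    from has_derivative_compose[OF this has_derivative_gr[OF that]] show ?thesis .
  qed
  have pd: "pd i (\<lambda>x. f (x + c)) = (\<lambda>x. pd i f (x + c))" if "smooth_fun f" for f i
    by (rule ext, subst pd_eqI[OF der[OF that]]) (simp add: inner_axis')
  show "smooth_fun f \<Longrightarrow> pd i (\<lambda>x. f (x + c)) = (\<lambda>x. pd i f (x + c))" by (rule pd)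
  assume f: "smooth_fun f"
  \<comment> \<open>The coinduction invariant ranges over the translates by \<open>c\<close> of all
    smooth functions, because \<open>pd i\<close> of a translate is the translate of another
    function.\<close>
  show "smooth_fun (\<lambda>x. f (x + c))"
  proof (rule smooth_fun.coinduct[of "\<lambda>h. \<exists>g. smooth_fun g \<and> h = (\<lambda>x. g (x + c))"])
    fix h assume "\<exists>g. smooth_fun g \<and> h = (\<lambda>x. g (x + c))"
    then obtain g where g: "smooth_fun g" "h = (\<lambda>x. g (x + c))" by blast
    have "h differentiable (at x)" for x
      unfolding g(2) using der[OF g(1)] by (auto simp: differentiable_def)
    moreover have "\<exists>g'. smooth_fun g' \<and> pd i h = (\<lambda>x. g' (x + c))" for i
      unfolding g(2) pd[OF g(1)] using smooth_fun_pd[OF g(1)] by blast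
    ultimately show "\<exists>f. h = f \<and> (\<forall>x. f differentiable (at x)) \<and>
        (\<forall>i. (\<exists>g. smooth_fun g \<and> pd i f = (\<lambda>x. g (x + c))) \<or> smooth_fun (pd i f))" by blast
  qed (use f in blast)
qed

lemma test_fn_shift: "test_fn UNIV f \<Longrightarrow> test_fn UNIV (\<lambda>x. f (x + c))"
proof -
  assume "test_fn UNIV f"
  then obtain K where K: "smooth_fun f" "compact K" "\<And>x. x \<notin> K \<Longrightarrow> f x = 0"
    by (rule test_fnE) blast
  show ?thesis
  proof (rule test_fnI[of _ "(\<lambda>x. - c + x) ` K"])
    show "compact ((\<lambda>x. - c + x) ` K)" using K(2) by (rule compact_translation)
    show "f (x + c) = 0" if "x \<notin> (\<lambda>x. - c + x) ` K" for x
      using that by (intro K(3)) (metis (no_types, lifting) add.commute add_uminus_conv_diff diff_add_cancel imageI)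
  qed (use K smooth_fun_shift in auto)
qed

lemma smooth_fun_diff: "smooth_fun f \<Longrightarrow> smooth_fun g \<Longrightarrow> smooth_fun (\<lambda>x. f x - g x)"
  using smooth_fun_add[of f "\<lambda>x. (-1) * g x"] smooth_fun_mult[OF smooth_fun_const[of "-1"], of g] by simp

lemma pd_diff:
  assumes "f differentiable (at x)" "g differentiable (at x)"
  shows "pd i (\<lambda>x. f x - g x) x = pd i f x - pd i g x"
  using pd_eqI[OF has_derivative_diff] assms unfolding pd_def frechet_derivative_works by blast

section \<open>Difference quotients, integration by parts and translations\<close>

definition dquot :: "nat \<Rightarrow> real^'n \<Rightarrow> (real^'n::finite \<Rightarrow> real) \<Rightarrow> real^'n \<Rightarrow> real" where
  "dquot m z f x = real (Suc m) * (f (x + (1 / real (Suc m)) *\<^sub>R z) - f x)"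

lemma test_fn_dquot: "test_fn UNIV f \<Longrightarrow> test_fn UNIV (dquot m z f)"
  unfolding dquot_def by (intro test_fn_scale test_fn_diff test_fn_shift)

lemma dquot_tendsto:
  assumes "smooth_fun f" shows "(\<lambda>m. dquot m z f x) \<longlonglongrightarrow> z \<bullet> gr f x"
proof -
  have "((\<lambda>t. f (x + t *\<^sub>R z)) has_derivative (\<lambda>t. (t *\<^sub>R z) \<bullet> gr f (x + 0 *\<^sub>R z))) (at 0)"
    by (rule has_derivative_compose[OF _ has_derivative_gr[OF assms]]) (auto intro!: derivative_eq_intros)
  then have "((\<lambda>t. f (x + t *\<^sub>R z)) has_real_derivative (z \<bullet> gr f x)) (at 0)"
    unfolding has_field_derivative_def by (simp add: mult_commute_abs)
  then have "((\<lambda>h. (f (x + h *\<^sub>R z) - f x) / h) \<longlongrightarrow> z \<bullet> gr f x) (at 0)"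
    by (simp add: DERIV_def)
  moreover have "filterlim (\<lambda>m. 1 / real (Suc m)) (at 0) sequentially"
    using LIMSEQ_inverse_real_of_nat by (auto simp: filterlim_at inverse_eq_divide)
  ultimately have "((\<lambda>m. (f (x + (1 / real (Suc m)) *\<^sub>R z) - f x) / (1 / real (Suc m))) \<longlonglongrightarrow> z \<bullet> gr f x)"
    by (rule filterlim_compose)
  then show ?thesis by (simp add: dquot_def mult.commute)
qed

lemma test_fn_lipschitz:
  assumes "test_fn UNIV f"
  obtains C where "C > 0" "\<And>x y. \<bar>f x - f y\<bar> \<le> C * norm (x - y)"
proof -
  have "\<forall>i. \<exists>C>0. \<forall>x. \<bar>pd i f x\<bar> \<le> C"
    using test_fn_bounded[OF test_fn_pd[OF assms]] by metis
  then obtain B where B: "\<And>i. B i > 0" "\<And>i x. \<bar>pd i f x\<bar> \<le> B i" by metis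
  define C where "C = (\<Sum>i\<in>UNIV. B i)"
  have C: "C > 0" unfolding C_def using B(1) by (intro sum_pos) auto
  have g: "norm (gr f x) \<le> C" for x
  proof -
    have "norm (gr f x) \<le> (\<Sum>i\<in>UNIV. \<bar>gr f x $ i\<bar>)" by (rule norm_le_l1_cart)
    also have "\<dots> \<le> C" unfolding C_def using B(2) by (intro sum_mono) auto
    finally show ?thesis .
  qed
  have "norm (f x - f y) \<le> C * norm (x - y)" for x y
  proof (rule differentiable_bound[of UNIV f "\<lambda>x v. v \<bullet> gr f x"])
    show "(f has_derivative (\<lambda>v. v \<bullet> gr f x)) (at x within UNIV)" for x
      using has_derivative_gr[OF test_fn_smooth[OF assms]] by simp
    show "onorm (\<lambda>v. v \<bullet> gr f x) \<le> C" for x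
    proof (rule onorm_bound)
      fix v :: "real^'a"
      have "norm (v \<bullet> gr f x) \<le> norm v * norm (gr f x)" by (rule Cauchy_Schwarz_ineq2[folded real_norm_def])
      also have "\<dots> \<le> C * norm v" using mult_left_mono[OF g, of "norm v" x] by (simp add: mult.commute)
      finally show "norm (v \<bullet> gr f x) \<le> C * norm v" .
    qed (use C in simp)
  qed auto
  then show ?thesis using C that by auto
qed

lemma dquot_dominated:
  assumes "test_fn UNIV f"
  obtains C R where "C > 0" "\<And>m x. \<bar>dquot m z f x\<bar> \<le> C * indicator (cball 0 R) x"
proof -
  obtain C where C: "C > 0" "\<And>x y. \<bar>f x - f y\<bar> \<le> C * norm (x - y)"
    using test_fn_lipschitz[OF assms] by blast
  obtain K where K: "smooth_fun f" "compact K" "\<And>x. x \<notin> K \<Longrightarrow> f x = 0"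
    using assms by (rule test_fnE) blast
  obtain r where r: "\<And>x. x \<in> K \<Longrightarrow> norm x \<le> r"
    using compact_imp_bounded[OF K(2)] by (auto simp: bounded_iff)
  \<comment> \<open>The radius is enlarged by \<open>norm z\<close> to catch all shifts of the
    support; the added 1 keeps the constant positive for \<open>z = 0\<close>.\<close>
  show ?thesis
  proof (rule that[of "C * (norm z + 1)" "\<bar>r\<bar> + norm z"])
    show "C * (norm z + 1) > 0" using C by (simp add: add_nonneg_pos)
    fix m x
    have le1: "norm ((1 / real (Suc m)) *\<^sub>R z) \<le> norm z"
      by (simp add: divide_simps distrib_left)
    have "\<bar>dquot m z f x\<bar> = real (Suc m) * \<bar>f (x + (1 / real (Suc m)) *\<^sub>R z) - f x\<bar>"
      by (simp add: dquot_def abs_mult)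
    also have "\<dots> \<le> real (Suc m) * (C * norm ((1 / real (Suc m)) *\<^sub>R z))"
      using C(2)[of "x + (1 / real (Suc m)) *\<^sub>R z" x] by (intro mult_left_mono) auto
    also have "\<dots> = C * norm z" by simp
    finally have b: "\<bar>dquot m z f x\<bar> \<le> C * (norm z + 1)" using C(1) by (simp add: algebra_simps)
    show "\<bar>dquot m z f x\<bar> \<le> C * (norm z + 1) * indicator (cball 0 (\<bar>r\<bar> + norm z)) x"
    proof (cases "x \<in> cball 0 (\<bar>r\<bar> + norm z)")
      case True then show ?thesis using b by simp
    next
      case False
      then have nx: "norm x > \<bar>r\<bar> + norm z" by simp
      have "norm (x + (1 / real (Suc m)) *\<^sub>R z) \<ge> norm x - norm ((1 / real (Suc m)) *\<^sub>R z)"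
        by (metis norm_diff_ineq)
      then have "norm (x + (1 / real (Suc m)) *\<^sub>R z) > r" "norm x > r"
        using nx le1 norm_ge_zero[of z] by linarith+
      then have "f (x + (1 / real (Suc m)) *\<^sub>R z) = 0" "f x = 0"
        using K(3) r by (meson not_le)+
      then show ?thesis using False by (simp add: dquot_def)
    qed
  qed
qed

lemma integrable_indicator_cball:
  "integrable lborel (indicat_real (cball (0::real^'n::finite) R))"
  using emeasure_compact_finite[of "cball (0::real^'n) R"] by (auto intro!: integrable_real_indicator)

lemma dquot_integral_tendsto:
  assumes "test_fn UNIV f" "test_fn UNIV g"
  shows "(\<lambda>m. \<integral>x. dquot m z f x * g x \<partial>lborel) \<longlonglongrightarrow> (\<integral>x. (z \<bullet> gr f x) * g x \<partial>lborel)"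
proof -
  obtain C R where C: "C > 0" "\<And>m x. \<bar>dquot m z f x\<bar> \<le> C * indicator (cball 0 R) x"
    using dquot_dominated[OF assms(1)] by blast
  obtain B where B: "B > 0" "\<And>x. \<bar>g x\<bar> \<le> B" using test_fn_bounded[OF assms(2)] by blast
  have pdm: "pd i f \<in> borel_measurable borel" for i
    using test_fn_borel_measurable[OF test_fn_pd[OF assms(1)]] .
  have dm: "dquot m z f \<in> borel_measurable borel" for m
    by (rule test_fn_borel_measurable[OF test_fn_dquot[OF assms(1)]])
  have gm: "g \<in> borel_measurable borel" by (rule test_fn_borel_measurable[OF assms(2)])
  have lim: "(\<lambda>m. dquot m z f x * g x) \<longlonglongrightarrow> (z \<bullet> gr f x) * g x" for x
    by (intro tendsto_intros dquot_tendsto test_fn_smooth[OF assms(1)])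
  have dom: "norm (dquot m z f x * g x) \<le> (C * B) * indicator (cball 0 R) x" for m x
  proof -
    have "\<bar>dquot m z f x\<bar> * \<bar>g x\<bar> \<le> (C * indicator (cball 0 R) x) * B"
      using C B(2) by (intro mult_mono) (auto intro: order_trans[OF abs_ge_zero])
    then show ?thesis by (simp add: abs_mult mult_ac)
  qed
  show ?thesis
    by (rule integral_dominated_convergence[where w = "\<lambda>x. (C * B) * indicator (cball 0 R) x"])
       (use pdm dm gm lim dom in \<open>auto simp: inner_vec_def integrable_indicator_cball\<close>)
qed

lemma dquot_square_integral_tendsto:
  assumes "test_fn UNIV f"
  shows "(\<lambda>m. \<integral>x. (dquot m z f x)\<^sup>2 \<partial>lborel) \<longlonglongrightarrow> (\<integral>x. (z \<bullet> gr f x)\<^sup>2 \<partial>lborel)"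
proof -
  obtain C R where C: "C > 0" "\<And>m x. \<bar>dquot m z f x\<bar> \<le> C * indicator (cball 0 R) x"
    using dquot_dominated[OF assms(1)] by blast
  have pdm: "pd i f \<in> borel_measurable borel" for i
    using test_fn_borel_measurable[OF test_fn_pd[OF assms(1)]] .
  have dm: "dquot m z f \<in> borel_measurable borel" for m
    by (rule test_fn_borel_measurable[OF test_fn_dquot[OF assms(1)]])
  have lim: "(\<lambda>m. (dquot m z f x)\<^sup>2) \<longlonglongrightarrow> (z \<bullet> gr f x)\<^sup>2" for x
    by (intro tendsto_intros dquot_tendsto test_fn_smooth[OF assms(1)])
  have dom: "norm ((dquot m z f x)\<^sup>2) \<le> C\<^sup>2 * indicator (cball 0 R) x" for m x
    using power_mono[OF C(2)[of m x] abs_ge_zero, of 2]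
    by (auto simp: power_mult_distrib indicator_def split: if_splits)
  show ?thesis
    by (rule integral_dominated_convergence[where w = "\<lambda>x. C\<^sup>2 * indicator (cball 0 R) x"])
       (use pdm dm lim dom in \<open>auto simp: inner_vec_def integrable_indicator_cball\<close>)
qed

text \<open>Translation invariance makes the integral of every difference quotient vanish, and
  dominated convergence carries this over to the derivative.\<close>

lemma integral_pd_eq_0:
  assumes "test_fn UNIV f" shows "(\<integral>x. pd i f x \<partial>lborel) = 0"
proof -
  obtain C R where C: "C > 0" "\<And>m x. \<bar>dquot m (axis i 1) f x\<bar> \<le> C * indicator (cball 0 R) x"
    using dquot_dominated[OF assms(1)] by blast
  have lim: "(\<lambda>m. dquot m (axis i 1) f x) \<longlonglongrightarrow> pd i f x" for x
    using dquot_tendsto[OF test_fn_smooth[OF assms], of "axis i 1" x] by (simp add: inner_axis')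
  have "(\<lambda>m. \<integral>x. dquot m (axis i 1) f x \<partial>lborel) \<longlonglongrightarrow> (\<integral>x. pd i f x \<partial>lborel)"
    by (rule integral_dominated_convergence[where w = "\<lambda>x. C * indicator (cball 0 R) x"])
       (use C(2) lim test_fn_borel_measurable[OF test_fn_pd[OF assms]]
         test_fn_borel_measurable[OF test_fn_dquot[OF assms]] in \<open>auto simp: integrable_indicator_cball\<close>)
  moreover have "(\<integral>x. dquot m (axis i 1) f x \<partial>lborel) = 0" for m
    unfolding dquot_def
    using test_fn_lborel_integrable[OF assms] test_fn_lborel_integrable[OF test_fn_shift[OF assms]]
    by (simp add: lborel_integral_shift[OF test_fn_borel_measurable[OF assms]])
  ultimately show ?thesis by (simp add: LIMSEQ_const_iff)
qed

lemma integral_by_parts: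
  assumes "test_fn UNIV f" "test_fn UNIV g"
  shows "(\<integral>x. pd i f x * g x \<partial>lborel) = - (\<integral>x. f x * pd i g x \<partial>lborel)"
proof -
  note sm = test_fn_smooth[OF assms(1)] test_fn_smooth[OF assms(2)]
  have int: "integrable lborel (\<lambda>x. pd i f x * g x)" "integrable lborel (\<lambda>x. f x * pd i g x)"
    using assms sm by (auto intro!: test_fn_lborel_integrable test_fn_mult test_fn_pd smooth_fun_pd)
  have "pd i (\<lambda>x. f x * g x) = (\<lambda>x. f x * pd i g x + pd i f x * g x)"
    using sm by (auto intro!: ext pd_mult smooth_fun_differentiable)
  with integral_pd_eq_0[OF test_fn_mult[OF assms(1) sm(2)], of i]
  have "(\<integral>x. f x * pd i g x + pd i f x * g x \<partial>lborel) = 0" by simp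
  with int show ?thesis by simp
qed

text \<open>Symmetry of second derivatives, in integrated form only. A difference quotient in one
  direction commutes exactly with \<open>pd\<close> in another, so integrating by parts before and
  after the limit gives both orders.\<close>

lemma integral_pd_commute:
  assumes f: "test_fn UNIV f" and g: "test_fn UNIV g"
  shows "(\<integral>x. pd i (pd j f) x * g x \<partial>lborel) = (\<integral>x. pd j (pd i f) x * g x \<partial>lborel)"
proof -
  note sm = test_fn_smooth[OF f]
  have pdd: "pd i (dquot m (axis j 1) f) = dquot m (axis j 1) (pd i f)" for m
  proof
    fix x
    let ?c = "(1 / real (Suc m)) *\<^sub>R (axis j 1 :: real^'a)"
    have "pd i (dquot m (axis j 1) f) x = real (Suc m) * pd i (\<lambda>x. f (x + ?c) - f x) x"
      unfolding dquot_def[abs_def]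
      by (intro pd_scale smooth_fun_differentiable smooth_fun_diff smooth_fun_shift sm)
    also have "pd i (\<lambda>x. f (x + ?c) - f x) x = pd i f (x + ?c) - pd i f x"
      using sm by (subst pd_diff) (auto intro: smooth_fun_differentiable smooth_fun_shift simp: pd_shift)
    finally show "pd i (dquot m (axis j 1) f) x = dquot m (axis j 1) (pd i f) x"
      by (simp only: dquot_def[abs_def])
  qed
  have "(\<lambda>m. \<integral>x. dquot m (axis j 1) f x * pd i g x \<partial>lborel) \<longlonglongrightarrow> (\<integral>x. pd j f x * pd i g x \<partial>lborel)"
    using dquot_integral_tendsto[OF f test_fn_pd[OF g], of "axis j 1"] by (simp add: inner_axis')
  moreover have "(\<integral>x. dquot m (axis j 1) f x * pd i g x \<partial>lborel)
      = - (\<integral>x. dquot m (axis j 1) (pd i f) x * g x \<partial>lborel)" for m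
    using integral_by_parts[OF test_fn_dquot[OF f] g, of i m "axis j 1"] by (simp add: pdd)
  moreover have "(\<lambda>m. - (\<integral>x. dquot m (axis j 1) (pd i f) x * g x \<partial>lborel)) \<longlonglongrightarrow> - (\<integral>x. pd j (pd i f) x * g x \<partial>lborel)"
    using dquot_integral_tendsto[OF test_fn_pd[OF f] g, of "axis j 1"]
    by (intro tendsto_minus) (simp add: inner_axis')
  ultimately have "(\<integral>x. pd j f x * pd i g x \<partial>lborel) = - (\<integral>x. pd j (pd i f) x * g x \<partial>lborel)"
    using LIMSEQ_unique by fastforce
  with integral_by_parts[OF test_fn_pd[OF f] g, of i j] show ?thesis by simp
qed

text \<open>Telescoping along the segment from \<open>x\<close> to \<open>x + z\<close> in \<open>m\<close> equal steps bounds the left-hand side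
  by the squared \<open>L\<^sup>2\<close> norm of a difference quotient, uniformly in \<open>m\<close>.\<close>

lemma translation_estimate:
  assumes f: "test_fn UNIV f"
  shows "(\<integral>x. (f (x + z) - f x)\<^sup>2 \<partial>lborel) \<le> (norm z)\<^sup>2 * (\<integral>x. (norm (gr f x))\<^sup>2 \<partial>lborel)"
proof -
  have sq: "integrable lborel (\<lambda>x. (g x)\<^sup>2)" if "test_fn UNIV g" for g :: "real^'a \<Rightarrow> real"
    using test_fn_lborel_integrable[OF test_fn_mult[OF that test_fn_smooth[OF that]]]
    by (simp add: power2_eq_square)
  have le: "(\<integral>x. (f (x + z) - f x)\<^sup>2 \<partial>lborel) \<le> (\<integral>x. (dquot m z f x)\<^sup>2 \<partial>lborel)" for m
  proof -
    define k where "k = Suc m"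
    define c where "c j = (real j / real k) *\<^sub>R z" for j
    have ck: "c k = z" "c 0 = 0" by (simp_all add: c_def k_def)
    have cS: "c (Suc j) = c j + (1 / real k) *\<^sub>R z" for j
      by (simp add: c_def scaleR_add_left[symmetric] add_divide_distrib add.commute)
    have tele: "f (x + z) - f x = (\<Sum>j<k. f (x + c (Suc j)) - f (x + c j))" for x
      using sum_lessThan_telescope[of "\<lambda>j. f (x + c j)" k] by (simp add: ck)
    have t: "test_fn UNIV (\<lambda>x. f (x + c (Suc j)) - f (x + c j))" for j
      by (intro test_fn_diff test_fn_shift f)
    have each: "(\<integral>x. (f (x + c (Suc j)) - f (x + c j))\<^sup>2 \<partial>lborel) = (\<integral>x. (f (x + c 1) - f x)\<^sup>2 \<partial>lborel)" for j
    proof -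
      have "test_fn UNIV (\<lambda>x. f (x + c 1) - f x)" by (intro test_fn_diff test_fn_shift f)
      then have "(\<lambda>x. (f (x + c 1) - f x)\<^sup>2) \<in> borel_measurable borel"
        using test_fn_borel_measurable by measurable
      from lborel_integral_shift[OF this, of "c j"] show ?thesis
        using cS[of j] cS[of 0] by (simp add: ck ac_simps)
    qed
    have "(\<integral>x. (f (x + z) - f x)\<^sup>2 \<partial>lborel)
        \<le> (\<integral>x. (\<Sum>j<k. (f (x + c (Suc j)) - f (x + c j))\<^sup>2) * real k \<partial>lborel)"
    proof (rule integral_mono)
      show "integrable lborel (\<lambda>x. (f (x + z) - f x)\<^sup>2)"
        by (intro sq test_fn_diff test_fn_shift f)
      show "integrable lborel (\<lambda>x. (\<Sum>j<k. (f (x + c (Suc j)) - f (x + c j))\<^sup>2) * real k)"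
        using sq[OF t] by (intro integrable_mult_left Bochner_Integration.integrable_sum) auto
      show "(f (x + z) - f x)\<^sup>2 \<le> (\<Sum>j<k. (f (x + c (Suc j)) - f (x + c j))\<^sup>2) * real k" for x
        unfolding tele using sum_squared_le_sum_of_squares[of _ "{..<k}"] by simp
    qed
    also have "\<dots> = (\<Sum>j<k. (\<integral>x. (f (x + c (Suc j)) - f (x + c j))\<^sup>2 \<partial>lborel)) * real k"
      using sq[OF t] by (simp add: Bochner_Integration.integral_sum)
    \<comment> \<open>One factor \<open>k\<close> is from the Cauchy-Schwarz inequality for the sum,
      the other from the \<open>k\<close> equal summands; together they are the squared
      normalisation of \<open>dquot\<close>.\<close>
    also have "\<dots> = real k ^ 2 * (\<integral>x. (f (x + c 1) - f x)\<^sup>2 \<partial>lborel)"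
      by (simp only: each) (simp add: power2_eq_square)
    also have "\<dots> = (\<integral>x. (dquot m z f x)\<^sup>2 \<partial>lborel)"
      unfolding dquot_def c_def k_def by (simp add: power_mult_distrib)
    finally show ?thesis .
  qed
  have "(\<integral>x. (f (x + z) - f x)\<^sup>2 \<partial>lborel) \<le> (\<integral>x. (z \<bullet> gr f x)\<^sup>2 \<partial>lborel)"
    by (rule LIMSEQ_le_const[OF dquot_square_integral_tendsto[OF f]]) (use le in blast)
  also have "\<dots> \<le> (\<integral>x. (norm z)\<^sup>2 * (norm (gr f x))\<^sup>2 \<partial>lborel)"
  proof (rule integral_mono)
    have "test_fn UNIV (\<lambda>x. \<Sum>i\<in>UNIV. z $ i * pd i f x)"
      by (intro test_fn_sum test_fn_scale test_fn_pd f) auto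
    from sq[OF this] show "integrable lborel (\<lambda>x. (z \<bullet> gr f x)\<^sup>2)" by (simp add: inner_vec_def)
    have "integrable lborel (\<lambda>x. \<Sum>i\<in>UNIV. (pd i f x)\<^sup>2)"
      by (intro Bochner_Integration.integrable_sum sq test_fn_pd f)
    then show "integrable lborel (\<lambda>x. (norm z)\<^sup>2 * (norm (gr f x))\<^sup>2)"
      by (intro integrable_mult_right) (simp add: power2_norm_eq_inner inner_vec_def power2_eq_square[of "pd _ f _"])
    show "(z \<bullet> gr f x)\<^sup>2 \<le> (norm z)\<^sup>2 * (norm (gr f x))\<^sup>2" for x
      using Cauchy_Schwarz_ineq[of z "gr f x"] by (simp add: power2_norm_eq_inner)
  qed
  also have "\<dots> = (norm z)\<^sup>2 * (\<integral>x. (norm (gr f x))\<^sup>2 \<partial>lborel)" by simp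
  finally show ?thesis .
qed

section \<open>Lebesgue spaces\<close>

text \<open>The positive and the negative part of \<open>g\<close> are densities of two finite
  measures that agree on the open sets, an intersection-stable generator of the Borel sets. Equal
  measures have densities that are equal almost everywhere.\<close>

lemma AE_zero_of_open_integrals:
  fixes g :: "real^'n::finite \<Rightarrow> real"
  assumes g: "integrable lborel g"
    and zero: "\<And>U. open U \<Longrightarrow> (\<integral>x. indicator U x * g x \<partial>lborel) = 0"
  shows "AE x in lborel. g x = 0"
proof -
  have gm [measurable]: "g \<in> borel_measurable borel" using g by auto
  define P where "P = density lborel (\<lambda>x. ennreal (g x))"
  define Q where "Q = density lborel (\<lambda>x. ennreal (- g x))"
  have em: "emeasure (density lborel (\<lambda>x. ennreal (h x))) U = ennreal (\<integral>x. indicator U x * max 0 (h x) \<partial>lborel)"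
    if "open U" "integrable lborel h" for U and h :: "real^'n \<Rightarrow> real"
  proof -
    have [measurable]: "h \<in> borel_measurable borel" "U \<in> sets borel" using that by auto
    have "integrable lborel (\<lambda>x. indicator U x *\<^sub>R max 0 (h x))"
      using that by (intro integrable_mult_indicator) auto
    then have "(\<integral>\<^sup>+x. ennreal (indicator U x * max 0 (h x)) \<partial>lborel) = ennreal (\<integral>x. indicator U x * max 0 (h x) \<partial>lborel)"
      by (intro nn_integral_eq_integral) auto
    moreover have "ennreal (indicator U x * max 0 (h x)) = ennreal (h x) * indicator U x" for x
      by (auto simp: indicator_def max_def ennreal_neg)
    ultimately show ?thesis by (simp add: emeasure_density)
  qed
  have "P = Q"
  proof (rule measure_eqI_generator_eq[of "{S. open S}" UNIV P Q "\<lambda>_. UNIV"])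
    show "Int_stable {S :: (real^'n) set. open S}" by (auto simp: Int_stable_def)
    show "emeasure P U = emeasure Q U" if "U \<in> {S. open S}" for U
    proof -
      have U: "open U" using that by simp
      have i: "integrable lborel (\<lambda>x. indicator U x *\<^sub>R max 0 (g x))" "integrable lborel (\<lambda>x. indicator U x *\<^sub>R max 0 (- g x))"
        using g U by (auto intro!: integrable_mult_indicator[of U lborel "\<lambda>x. max 0 (g x)", simplified]
          integrable_mult_indicator[of U lborel "\<lambda>x. max 0 (- g x)", simplified] integrable_max)
      have "(\<integral>x. indicator U x * max 0 (g x) \<partial>lborel) - (\<integral>x. indicator U x * max 0 (- g x) \<partial>lborel)
          = (\<integral>x. indicator U x * max 0 (g x) - indicator U x * max 0 (- g x) \<partial>lborel)"
        using i by (simp add: Bochner_Integration.integral_diff)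
      also have "\<dots> = (\<integral>x. indicator U x * g x \<partial>lborel)"
        by (intro Bochner_Integration.integral_cong) (auto simp: max_def indicator_def)
      finally show ?thesis
        using em[OF U g] em[OF U, of "\<lambda>x. - g x"] g zero[OF U] by (simp add: P_def Q_def)
    qed
    show "sets P = sigma_sets UNIV {S. open S}" "sets Q = sigma_sets UNIV {S. open S}"
      by (simp_all add: P_def Q_def borel_def)
    show "emeasure P UNIV \<noteq> \<infinity>" for i :: nat
      using em[OF open_UNIV g] by (simp add: P_def)
  qed auto
  then have "AE x in lborel. ennreal (g x) = ennreal (- g x)"
    unfolding P_def Q_def by (intro sigma_finite_measure.density_unique[OF sigma_finite_lborel]) auto
  then show ?thesis
  proof eventually_elim
    case (elim x)
    then show ?case
      using ennreal_neg[of "g x"] ennreal_neg[of "- g x"] ennreal_eq_0_iff[of "g x"] ennreal_eq_0_iff[of "- g x"]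
      by (cases "g x \<le> 0") auto
  qed
qed

text \<open>The optimal parameter is \<open>t = sqrt (B / A)\<close>. If \<open>A\<close> or
  \<open>B\<close> is 0, large or small \<open>t\<close> push the right-hand side to 0
  instead.\<close>

lemma square_le_of_AM_GM:
  fixes A B X :: real
  assumes "A \<ge> 0" "B \<ge> 0" "X \<ge> 0" and le: "\<And>t. t > 0 \<Longrightarrow> 2 * X \<le> t * A + B / t"
  shows "X\<^sup>2 \<le> A * B"
proof (cases "A = 0 \<or> B = 0")
  case False
  then have pos: "A > 0" "B > 0" using assms by auto
  have "2 * X \<le> sqrt (B / A) * A + B / sqrt (B / A)" using le[of "sqrt (B / A)"] pos by simp
  also have "sqrt (B / A) * A = sqrt A * sqrt B"
    using pos by (simp add: real_sqrt_divide field_simps)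
  also have "B / sqrt (B / A) = sqrt A * sqrt B"
    using pos by (simp add: real_sqrt_divide field_simps)
  finally have "X \<le> sqrt A * sqrt B" by simp
  then have "X\<^sup>2 \<le> (sqrt A * sqrt B)\<^sup>2" using assms by (intro power_mono) auto
  then show ?thesis using pos by (simp add: power_mult_distrib)
next
  case True
  have "X \<le> 0"
  proof (rule field_le_epsilon)
    fix e :: real assume e: "e > 0"
    show "X \<le> 0 + e"
    proof (cases "A = 0")
      case True
      \<comment> \<open>\<open>t = (B + 1) / e\<close> makes \<open>B / t\<close> at most
        \<open>e\<close>; the added 1 keeps \<open>t\<close> positive when
        \<open>B = 0\<close>.\<close>
      then have "2 * X \<le> B / ((B + 1) / e)" using le[of "(B + 1) / e"] e assms by (simp add: add_nonneg_pos)
      also have "\<dots> \<le> e" using e assms by (simp add: field_simps)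
      finally show ?thesis using e by simp
    next
      case False
      then have "B = 0" "A > 0" using True assms by auto
      then have "2 * X \<le> e / A * A" using le[of "e / A"] e by simp
      then show ?thesis using \<open>A > 0\<close> e by simp
    qed
  qed
  then show ?thesis using assms by simp
qed

text \<open>Integrate the pointwise inequality
  \<open>2 * \<bar>a * b\<bar> \<le> t * a\<^sup>2 + b\<^sup>2 / t\<close> and optimise in
  \<open>t\<close> only afterwards. The case \<open>t = 1\<close> gives integrability of the
  product.\<close>

lemma integral_Cauchy_Schwarz:
  fixes f g :: "'a \<Rightarrow> real"
  assumes "f \<in> borel_measurable M" "g \<in> borel_measurable M"
    and i: "integrable M (\<lambda>x. (f x)\<^sup>2)" "integrable M (\<lambda>x. (g x)\<^sup>2)"
  shows "integrable M (\<lambda>x. f x * g x)" "(\<integral>x. \<bar>f x * g x\<bar> \<partial>M)\<^sup>2 \<le> (\<integral>x. (f x)\<^sup>2 \<partial>M) * (\<integral>x. (g x)\<^sup>2 \<partial>M)"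
proof -
  have amgm: "2 * \<bar>a * b\<bar> \<le> t * a\<^sup>2 + b\<^sup>2 / t" if "t > 0" for a b t :: real
  proof -
    have "0 \<le> (t * \<bar>a\<bar> - \<bar>b\<bar>)\<^sup>2 / t" using that by simp
    also have "\<dots> = t * a\<^sup>2 + b\<^sup>2 / t - 2 * \<bar>a * b\<bar>"
      using that by (simp add: power2_diff power_mult_distrib abs_mult field_simps power2_eq_square)
    finally show ?thesis by simp
  qed
  show fg: "integrable M (\<lambda>x. f x * g x)"
  proof (rule Bochner_Integration.integrable_bound)
    show "integrable M (\<lambda>x. (f x)\<^sup>2 + (g x)\<^sup>2)" using i by simp
    have "norm (f x * g x) \<le> norm ((f x)\<^sup>2 + (g x)\<^sup>2)" for x
      using amgm[of 1 "f x" "g x"] by simp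
    then show "AE x in M. norm (f x * g x) \<le> norm ((f x)\<^sup>2 + (g x)\<^sup>2)" by simp
  qed (use assms in measurable)
  show "(\<integral>x. \<bar>f x * g x\<bar> \<partial>M)\<^sup>2 \<le> (\<integral>x. (f x)\<^sup>2 \<partial>M) * (\<integral>x. (g x)\<^sup>2 \<partial>M)"
  proof (rule square_le_of_AM_GM)
    fix t :: real assume t: "t > 0"
    have "2 * (\<integral>x. \<bar>f x * g x\<bar> \<partial>M) = (\<integral>x. 2 * \<bar>f x * g x\<bar> \<partial>M)" by simp
    also have "\<dots> \<le> (\<integral>x. t * (f x)\<^sup>2 + (g x)\<^sup>2 / t \<partial>M)"
      using fg i amgm[OF t] by (intro integral_mono) auto
    also have "\<dots> = t * (\<integral>x. (f x)\<^sup>2 \<partial>M) + (\<integral>x. (g x)\<^sup>2 \<partial>M) / t" using i by simp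
    finally show "2 * (\<integral>x. \<bar>f x * g x\<bar> \<partial>M) \<le> t * (\<integral>x. (f x)\<^sup>2 \<partial>M) + (\<integral>x. (g x)\<^sup>2 \<partial>M) / t" .
  qed (auto intro!: Bochner_Integration.integral_nonneg)
qed

text \<open>The p-th power of \<open>lpnorm\<close>. It involves no roots, and for
  \<open>p = 2\<close> it is additive over components, so the estimates below are phrased with
  it.\<close>

definition pint :: "(real^'n) set \<Rightarrow> nat \<Rightarrow> (real^'n \<Rightarrow> 'v::real_normed_vector) \<Rightarrow> real" where
  "pint \<Omega> p u = (LINT x|lebesgue_on \<Omega>. norm (u x) ^ p)"

lemma pint_nonneg [simp]: "0 \<le> pint \<Omega> p u"
  by (simp add: pint_def)

lemma lpnorm_pow: "p > 0 \<Longrightarrow> lpnorm \<Omega> p u ^ p = pint \<Omega> p u"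
  unfolding lpnorm_def pint_def[symmetric]
  by (cases "pint \<Omega> p u = 0") (auto simp: powr_powr simp flip: powr_realpow)

lemma lpnorm_nonneg [simp]: "0 \<le> lpnorm \<Omega> p u"
  by (simp add: lpnorm_def)

lemma pint_cong_AE:
  "u \<in> borel_measurable (lebesgue_on \<Omega>) \<Longrightarrow> v \<in> borel_measurable (lebesgue_on \<Omega>) \<Longrightarrow>
   AE x in lebesgue_on \<Omega>. u x = v x \<Longrightarrow> pint \<Omega> p u = pint \<Omega> p v"
  unfolding pint_def by (intro integral_cong_AE) auto

lemma pint_uminus: "pint \<Omega> p (\<lambda>x. - u x) = pint \<Omega> p u"
  by (simp add: pint_def)

lemma pint_scale: "pint \<Omega> p (\<lambda>x. c *\<^sub>R u x) = \<bar>c\<bar> ^ p * pint \<Omega> p u"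
  by (simp add: pint_def power_mult_distrib)

lemma Lp_scale: "Lp \<Omega> p u \<Longrightarrow> Lp \<Omega> p (\<lambda>x. c *\<^sub>R u x)"
  unfolding Lp_def by (auto simp: power_mult_distrib)

lemma Lp_measurable: "Lp \<Omega> p u \<Longrightarrow> u \<in> borel_measurable (lebesgue_on \<Omega>)"
  by (simp add: Lp_def)

lemma Lp_bound:
  assumes "Lp \<Omega> p v" "u \<in> borel_measurable (lebesgue_on \<Omega>)" "AE x in lebesgue_on \<Omega>. norm (u x) \<le> norm (v x)"
  shows "Lp \<Omega> p u" "pint \<Omega> p u \<le> pint \<Omega> p v"
proof -
  have v: "integrable (lebesgue_on \<Omega>) (\<lambda>x. norm (v x) ^ p)" using assms(1) by (simp add: Lp_def)
  have le: "AE x in lebesgue_on \<Omega>. norm (u x) ^ p \<le> norm (v x) ^ p"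
    using assms(3) by eventually_elim (simp add: power_mono)
  have u: "integrable (lebesgue_on \<Omega>) (\<lambda>x. norm (u x) ^ p)"
    by (rule Bochner_Integration.integrable_bound[OF v]) (use assms(2) le in auto)
  show "Lp \<Omega> p u" using u assms by (simp add: Lp_def)
  show "pint \<Omega> p u \<le> pint \<Omega> p v" unfolding pint_def by (rule integral_mono_AE[OF u v le])
qed

text \<open>Takes the place of Minkowski's inequality: only boundedness and convergence to 0 matter
  later, so the constant \<open>2 ^ p\<close> does no harm.\<close>

lemma norm_add_power_le:
  fixes a b :: "'v::real_normed_vector"
  shows "norm (a + b) ^ p \<le> 2 ^ p * (norm a ^ p + norm b ^ p)"
proof -
  have "norm (a + b) ^ p \<le> (2 * max (norm a) (norm b)) ^ p"
    by (intro power_mono) (auto intro: order_trans[OF norm_triangle_ineq])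
  also have "\<dots> = 2 ^ p * max (norm a) (norm b) ^ p" by (simp add: power_mult_distrib)
  also have "\<dots> \<le> 2 ^ p * (norm a ^ p + norm b ^ p)" by (intro mult_left_mono) (auto simp: max_def)
  finally show ?thesis .
qed

lemma Lp_add:
  assumes "Lp \<Omega> p (u :: real^'n::finite \<Rightarrow> 'v::euclidean_space)" "Lp \<Omega> p v"
  shows "Lp \<Omega> p (\<lambda>x. u x + v x)" "pint \<Omega> p (\<lambda>x. u x + v x) \<le> 2 ^ p * (pint \<Omega> p u + pint \<Omega> p v)"
proof -
  have m [measurable]: "u \<in> borel_measurable (lebesgue_on \<Omega>)" "v \<in> borel_measurable (lebesgue_on \<Omega>)"
    and i: "integrable (lebesgue_on \<Omega>) (\<lambda>x. 2 ^ p * (norm (u x) ^ p + norm (v x) ^ p))"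
    using assms by (auto simp: Lp_def)
  have s: "integrable (lebesgue_on \<Omega>) (\<lambda>x. norm (u x + v x) ^ p)"
  proof (rule Bochner_Integration.integrable_bound[OF i])
    show "AE x in lebesgue_on \<Omega>. norm (norm (u x + v x) ^ p) \<le> norm (2 ^ p * (norm (u x) ^ p + norm (v x) ^ p))"
      using norm_add_power_le by (intro AE_I2) auto
  qed measurable
  then show "Lp \<Omega> p (\<lambda>x. u x + v x)" by (simp add: Lp_def)
  have "pint \<Omega> p (\<lambda>x. u x + v x) \<le> (LINT x|lebesgue_on \<Omega>. 2 ^ p * (norm (u x) ^ p + norm (v x) ^ p))"
    unfolding pint_def by (intro integral_mono[OF s i] norm_add_power_le)
  also have "\<dots> = 2 ^ p * (pint \<Omega> p u + pint \<Omega> p v)"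
    using assms by (simp add: Lp_def pint_def)
  finally show "pint \<Omega> p (\<lambda>x. u x + v x) \<le> 2 ^ p * (pint \<Omega> p u + pint \<Omega> p v)" .
qed

lemma Lp_uminus: "Lp \<Omega> p u \<Longrightarrow> Lp \<Omega> p (\<lambda>x. - u x)"
  using Lp_scale[of \<Omega> p u "-1"] by simp

lemma Lp_diff:
  assumes "Lp \<Omega> p (u :: real^'n::finite \<Rightarrow> 'v::euclidean_space)" "Lp \<Omega> p v"
  shows "Lp \<Omega> p (\<lambda>x. u x - v x)" "pint \<Omega> p (\<lambda>x. u x - v x) \<le> 2 ^ p * (pint \<Omega> p u + pint \<Omega> p v)"
  using Lp_add[OF assms(1) Lp_uminus[OF assms(2)]] by (simp_all add: pint_uminus)

lemma Lp_zero: "p > 0 \<Longrightarrow> Lp \<Omega> p (\<lambda>_. 0)"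
  by (simp add: Lp_def zero_power)

section \<open>Weak derivatives\<close>

locale bounded_open =
  fixes \<Omega> :: "(real^'n::finite) set"
  assumes open_dom: "open \<Omega>" and bounded_dom: "bounded \<Omega>"
begin

lemma dom_lebesgue [measurable]: "\<Omega> \<in> sets lebesgue"
  using open_dom by simp

lemma finite_measure_dom: "finite_measure (lebesgue_on \<Omega>)"
proof
  have "emeasure lebesgue \<Omega> < \<infinity>"
    using emeasure_bounded_finite[OF bounded_dom] open_dom by simp
  then show "emeasure (lebesgue_on \<Omega>) (space (lebesgue_on \<Omega>)) \<noteq> \<infinity>"
    by (simp add: emeasure_restrict_space)
qed

lemma borel_measurable_dom: "u \<in> borel_measurable borel \<Longrightarrow> u \<in> borel_measurable (lebesgue_on \<Omega>)"
  by (intro measurable_restrict_space1 measurable_completion) simp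

text \<open>The spaces are defined over \<open>lebesgue_on \<Omega>\<close>, whereas translations
  and Fubini's theorem belong to \<open>lborel\<close> on the whole space. For Borel functions
  vanishing off \<Omega> the two integrals agree.\<close>

lemma integral_dom:
  fixes u :: "real^'n \<Rightarrow> real"
  assumes "u \<in> borel_measurable borel" "\<And>x. x \<notin> \<Omega> \<Longrightarrow> u x = 0"
  shows "integrable (lebesgue_on \<Omega>) u \<longleftrightarrow> integrable lborel u"
    and "(LINT x|lebesgue_on \<Omega>. u x) = (\<integral>x. u x \<partial>lborel)"
proof -
  have u: "(\<lambda>x. indicator \<Omega> x *\<^sub>R u x) = u" using assms(2) by (auto simp: indicator_def fun_eq_iff)
  have [simp]: "\<Omega> \<inter> space lebesgue \<in> sets lebesgue" using dom_lebesgue by simp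
  show "integrable (lebesgue_on \<Omega>) u \<longleftrightarrow> integrable lborel u"
    using integrable_restrict_space[of \<Omega> lebesgue u] integrable_completion[of u lborel] assms(1) u by simp
  show "(LINT x|lebesgue_on \<Omega>. u x) = (\<integral>x. u x \<partial>lborel)"
    using integral_restrict_space[of \<Omega> lebesgue u] integral_completion[of u lborel] assms(1) u by simp
qed

lemma integral_mult_test:
  assumes "test_fn \<Omega> f" "smooth_fun g"
  shows "(LINT x|lebesgue_on \<Omega>. f x * g x) = (\<integral>x. f x * g x \<partial>lborel)"
  using assms by (intro integral_dom test_fn_borel_measurable[OF test_fn_mult]) (auto simp: test_fn_outside)

text \<open>The zero extension of \<open>g\<close> has a Borel representative \<open>H\<close>. Its
  integral over an open set is a limit of integrals against test functions supported in the
  intersection with \<Omega>, where the hypothesis applies.\<close>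

lemma fundamental_lemma:
  fixes g :: "real^'n \<Rightarrow> real"
  assumes g: "integrable (lebesgue_on \<Omega>) g"
    and zero: "\<And>\<phi>. test_fn \<Omega> \<phi> \<Longrightarrow> (LINT x|lebesgue_on \<Omega>. g x * \<phi> x) = 0"
  shows "AE x in lebesgue_on \<Omega>. g x = 0"
proof -
  define G where "G x = indicator \<Omega> x *\<^sub>R g x" for x
  have sp: "\<Omega> \<inter> space lebesgue \<in> sets lebesgue" using dom_lebesgue by simp
  have GI: "integrable lebesgue G"
    unfolding G_def using integrable_restrict_space[OF sp, of g] g by simp
  then obtain H where H: "H \<in> borel_measurable lborel" "AE x in lborel. G x = H x"
    using completion_ex_borel_measurable_real[of G lborel] by auto
  have GH: "AE x in lebesgue. G x = H x" using AE_completion[OF H(2)] .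
  have HI: "integrable lborel H"
  proof -
    have "H \<in> borel_measurable lebesgue" using H(1) by (rule measurable_completion)
    from integrable_cong_AE_imp[OF GI this] GH have "integrable lebesgue H" by simp
    then show ?thesis using integrable_completion[OF H(1)] by blast
  qed
  have HG: "(\<integral>x. H x * u x \<partial>lborel) = (LINT x|lebesgue_on \<Omega>. g x * u x)"
    if u: "u \<in> borel_measurable borel" for u
  proof -
    have ul: "u \<in> borel_measurable lborel" using u by simp
    have "(\<integral>x. H x * u x \<partial>lborel) = (\<integral>x. H x * u x \<partial>lebesgue)"
      by (rule integral_completion[OF borel_measurable_times[OF H(1) ul], symmetric])
    also have "\<dots> = (\<integral>x. G x * u x \<partial>lebesgue)"
    proof (rule integral_cong_AE)
      show "(\<lambda>x. H x * u x) \<in> borel_measurable lebesgue"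
        by (rule measurable_completion[OF borel_measurable_times[OF H(1) ul]])
      show "(\<lambda>x. G x * u x) \<in> borel_measurable lebesgue"
        by (rule borel_measurable_times[OF borel_measurable_integrable[OF GI] measurable_completion[OF ul]])
      show "AE x in lebesgue. H x * u x = G x * u x" using GH by eventually_elim simp
    qed
    also have "\<dots> = (LINT x|lebesgue_on \<Omega>. g x * u x)"
      using integral_restrict_space[OF sp, of "\<lambda>x. g x * u x"] by (simp add: G_def mult.assoc)
    finally show ?thesis .
  qed
  have "AE x in lborel. H x = 0"
  proof (rule AE_zero_of_open_integrals[OF HI])
    fix U :: "(real^'n) set" assume "open U"
    then have W: "open (U \<inter> \<Omega>)" using open_dom by blast
    obtain \<phi> where \<phi>: "\<And>m::nat. test_fn (U \<inter> \<Omega>) (\<phi> m)" "\<And>m x. 0 \<le> \<phi> m x" "\<And>m x. \<phi> m x \<le> 1"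
      "\<And>x. (\<lambda>m. \<phi> m x) \<longlonglongrightarrow> indicator (U \<inter> \<Omega>) x"
      using open_approx_test_fn[OF W] by blast
    have [measurable]: "\<phi> m \<in> borel_measurable borel" for m
      using test_fn_borel_measurable[OF \<phi>(1)] .
    have [measurable]: "H \<in> borel_measurable borel" using H(1) by simp
    have [measurable]: "U \<inter> \<Omega> \<in> sets borel" "U \<in> sets borel" using W \<open>open U\<close> by auto
    have "(\<lambda>m. \<integral>x. H x * \<phi> m x \<partial>lborel) \<longlonglongrightarrow> (\<integral>x. H x * indicator (U \<inter> \<Omega>) x \<partial>lborel)"
    proof (rule integral_dominated_convergence[where w = "\<lambda>x. \<bar>H x\<bar>"])
      show "AE x in lborel. norm (H x * \<phi> m x) \<le> \<bar>H x\<bar>" for m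
        using \<phi>(2,3)[of m] by (auto simp: abs_mult mult_left_le)
      show "AE x in lborel. (\<lambda>m. H x * \<phi> m x) \<longlonglongrightarrow> H x * indicator (U \<inter> \<Omega>) x"
        by (intro AE_I2 tendsto_mult tendsto_const \<phi>(4))
    qed (use HI in auto)
    moreover have "(\<integral>x. H x * \<phi> m x \<partial>lborel) = 0" for m
      using HG[of "\<phi> m"] zero[OF test_fn_mono[OF \<phi>(1)], of m] by simp
    ultimately have "(\<integral>x. H x * indicator (U \<inter> \<Omega>) x \<partial>lborel) = 0"
      by (simp add: LIMSEQ_const_iff)
    moreover have "AE x in lborel. indicator U x * H x = H x * indicator (U \<inter> \<Omega>) x"
      using H(2) by eventually_elim (auto simp: G_def indicator_def split: if_splits)
    then have "(\<integral>x. indicator U x * H x \<partial>lborel) = (\<integral>x. H x * indicator (U \<inter> \<Omega>) x \<partial>lborel)"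
      by (intro integral_cong_AE) auto
    ultimately show "(\<integral>x. indicator U x * H x \<partial>lborel) = 0" by simp
  qed
  then have "AE x in lebesgue. G x = 0" using GH AE_completion by fastforce
  then show ?thesis
    using AE_restrict_space_iff[OF sp, of "\<lambda>x. g x = 0"]
    by (auto simp: G_def indicator_def elim!: eventually_mono)
qed

lemma Lp_bounded:
  assumes "u \<in> borel_measurable (lebesgue_on \<Omega>)" "\<And>x. norm (u x) \<le> C"
  shows "Lp \<Omega> p u"
  unfolding Lp_def
proof (intro conjI finite_measure.integrable_const_bound[OF finite_measure_dom, of _ "C ^ p"])
  show "AE x in lebesgue_on \<Omega>. norm (norm (u x) ^ p) \<le> C ^ p"
    using power_mono[OF assms(2) norm_ge_zero] by auto
qed (use assms(1) in auto)

lemma Lp_test_fn: "test_fn \<Omega> f \<Longrightarrow> Lp \<Omega> p f"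
proof -
  assume f: "test_fn \<Omega> f"
  obtain C where "C > 0" "\<And>x. \<bar>f x\<bar> \<le> C" using test_fn_bounded[OF f] by blast
  then show ?thesis using borel_measurable_dom[OF test_fn_borel_measurable[OF f]]
    by (intro Lp_bounded[of _ C]) auto
qed

lemma Lp_4_2: "Lp \<Omega> 4 u \<Longrightarrow> Lp \<Omega> 2 u"
proof -
  assume u: "Lp \<Omega> 4 u"
  interpret finite_measure "lebesgue_on \<Omega>" by (rule finite_measure_dom)
  have m: "u \<in> borel_measurable (lebesgue_on \<Omega>)" and i: "integrable (lebesgue_on \<Omega>) (\<lambda>x. norm (u x) ^ 4)"
    using u by (auto simp: Lp_def)
  have i1: "integrable (lebesgue_on \<Omega>) (\<lambda>x. 1 + norm (u x) ^ 4)"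
    by (rule Bochner_Integration.integrable_add[OF _ i]) simp
  have le: "norm (norm (u x) ^ 2) \<le> norm (1 + norm (u x) ^ 4)" for x
  proof -
    have "t \<le> 1 + t\<^sup>2" for t :: real
      using zero_le_power2[of "t - 1 / 2"] by (simp add: power2_eq_square algebra_simps)
    from this[of "norm (u x) ^ 2"] have "norm (u x) ^ 2 \<le> 1 + norm (u x) ^ 4"
      unfolding power_mult[symmetric] by simp
    then show ?thesis unfolding real_norm_def by (simp only: abs_of_nonneg[OF zero_le_power2] abs_of_nonneg[OF add_nonneg_nonneg[OF zero_le_one zero_le_power[OF norm_ge_zero]]])
  qed
  have "integrable (lebesgue_on \<Omega>) (\<lambda>x. norm (u x) ^ 2)"
    by (rule Bochner_Integration.integrable_bound[OF i1 _ AE_I2[OF le]]) (use m in measurable)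
  then show ?thesis using m by (simp add: Lp_def)
qed

text \<open>Cauchy-Schwarz against the constant 1, which is square integrable because \<Omega> is
  bounded.\<close>

lemma pint_2_le_pint_4:
  assumes "Lp \<Omega> 4 u"
  shows "(pint \<Omega> 2 u)\<^sup>2 \<le> measure lebesgue \<Omega> * pint \<Omega> 4 u"
proof -
  interpret finite_measure "lebesgue_on \<Omega>" by (rule finite_measure_dom)
  have m: "u \<in> borel_measurable (lebesgue_on \<Omega>)" and i: "integrable (lebesgue_on \<Omega>) (\<lambda>x. norm (u x) ^ 4)"
    using assms by (auto simp: Lp_def)
  have 4: "((norm (u x))\<^sup>2)\<^sup>2 = norm (u x) ^ 4" for x unfolding power_mult[symmetric] by simp
  have "(LINT x|lebesgue_on \<Omega>. \<bar>1 * (norm (u x))\<^sup>2\<bar>)\<^sup>2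
      \<le> (LINT x|lebesgue_on \<Omega>. 1\<^sup>2) * (LINT x|lebesgue_on \<Omega>. ((norm (u x))\<^sup>2)\<^sup>2)"
    by (rule integral_Cauchy_Schwarz(2)) (use m in measurable, simp, simp add: 4 i)
  then show ?thesis unfolding 4 by (simp add: pint_def measure_restrict_space)
qed

lemma Lp_mult_integrable:
  fixes u v :: "real^'n \<Rightarrow> real"
  assumes "Lp \<Omega> 2 u" "Lp \<Omega> 2 v"
  shows "integrable (lebesgue_on \<Omega>) (\<lambda>x. u x * v x)"
  using assms by (intro integral_Cauchy_Schwarz(1)) (auto simp: Lp_def)

lemma Lp_integrable:
  fixes u :: "real^'n \<Rightarrow> real"
  assumes "Lp \<Omega> 2 u" shows "integrable (lebesgue_on \<Omega>) u"
  using Lp_mult_integrable[OF assms Lp_bounded[of "\<lambda>_. 1" 1]] by simp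

lemma weak_deriv_unique:
  assumes "weak_deriv \<Omega> is u g" "weak_deriv \<Omega> is u g'" "Lp \<Omega> 2 g" "Lp \<Omega> 2 g'"
  shows "AE x in lebesgue_on \<Omega>. g x = g' x"
proof -
  have "AE x in lebesgue_on \<Omega>. g x - g' x = 0"
  proof (rule fundamental_lemma)
    show "integrable (lebesgue_on \<Omega>) (\<lambda>x. g x - g' x)" using assms Lp_integrable by auto
    fix \<phi> assume \<phi>: "test_fn \<Omega> \<phi>"
    have "(LINT x|lebesgue_on \<Omega>. g x * \<phi> x) = (LINT x|lebesgue_on \<Omega>. g' x * \<phi> x)"
      using assms(1,2) \<phi> unfolding weak_deriv_def by fastforce
    then show "(LINT x|lebesgue_on \<Omega>. (g x - g' x) * \<phi> x) = 0"
      using Lp_mult_integrable[OF _ Lp_test_fn[OF \<phi>]] assms(3,4) by (simp add: left_diff_distrib)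
  qed
  then show ?thesis by simp
qed

section \<open>The chosen weak derivatives and the Sobolev norms\<close>

lemma wd_props:
  assumes "\<exists>g. Lp \<Omega> 2 g \<and> weak_deriv \<Omega> is u g"
  shows "Lp \<Omega> 2 (wd \<Omega> is u)" "weak_deriv \<Omega> is u (wd \<Omega> is u)"
  using someI_ex[OF assms] unfolding wd_def by auto

text \<open>Since \<open>wd\<close> is a choice, every identity for it has to come from uniqueness
  of weak derivatives and holds almost everywhere only.\<close>

lemma wd_AE:
  assumes "Lp \<Omega> 2 g" "weak_deriv \<Omega> is u g"
  shows "AE x in lebesgue_on \<Omega>. wd \<Omega> is u x = g x"
  using weak_deriv_unique[of "is" u "wd \<Omega> is u" g] wd_props[of "is" u] assms by blast

lemma weak_deriv_combo:
  assumes "weak_deriv \<Omega> is u g" "weak_deriv \<Omega> is v g'" "Lp \<Omega> 2 u" "Lp \<Omega> 2 v" "Lp \<Omega> 2 g" "Lp \<Omega> 2 g'"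
  shows "weak_deriv \<Omega> is (\<lambda>x. a * u x + b * v x) (\<lambda>x. a * g x + b * g' x)"
  unfolding weak_deriv_def
proof (intro allI impI)
  fix \<phi> assume \<phi>: "test_fn \<Omega> \<phi>"
  note int = Lp_mult_integrable[OF _ Lp_test_fn[OF test_fn_Dl[OF \<phi>]]] Lp_mult_integrable[OF _ Lp_test_fn[OF \<phi>]]
  show "(LINT x|lebesgue_on \<Omega>. (a * u x + b * v x) * Dl is \<phi> x)
      = (-1) ^ length is * (LINT x|lebesgue_on \<Omega>. (a * g x + b * g' x) * \<phi> x)"
    using assms int \<phi> unfolding weak_deriv_def by (simp add: distrib_right mult.assoc) (simp add: algebra_simps)
qed

text \<open>Integration by parts peels the outermost derivative off the test function first and
  applies it to \<open>f\<close> first, so the order of the list is reversed.\<close>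

lemma weak_deriv_test_fn:
  assumes f: "test_fn \<Omega> f" shows "weak_deriv \<Omega> is f (Dl (rev is) f)"
proof -
  have "(\<integral>x. f x * Dl is \<phi> x \<partial>lborel) = (-1) ^ length is * (\<integral>x. Dl (rev is) f x * \<phi> x \<partial>lborel)"
    if "test_fn UNIV f" "test_fn UNIV \<phi>" for f \<phi> :: "real^'n \<Rightarrow> real"
    using that
  proof (induction "is" arbitrary: f)
    case (Cons i "is")
    have "(\<integral>x. f x * pd i (Dl is \<phi>) x \<partial>lborel) = - (\<integral>x. pd i f x * Dl is \<phi> x \<partial>lborel)"
      using integral_by_parts[OF Cons.prems(1) test_fn_Dl[OF Cons.prems(2), of "is"], of i] by simp
    also have "\<dots> = - ((-1) ^ length is * (\<integral>x. Dl (rev is) (pd i f) x * \<phi> x \<partial>lborel))"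
      by (simp only: Cons.IH[OF test_fn_pd[OF Cons.prems(1)] Cons.prems(2)])
    finally show ?case by (simp add: Dl_append)
  qed simp
  from this[OF test_fn_mono[OF f] test_fn_mono] show ?thesis
    unfolding weak_deriv_def
    by (auto simp: integral_mult_test[OF f smooth_fun_Dl[OF test_fn_smooth]] integral_mult_test[OF test_fn_Dl[OF f] test_fn_smooth])
qed

lemma wd_test_fn: "test_fn \<Omega> f \<Longrightarrow> AE x in lebesgue_on \<Omega>. wd \<Omega> is f x = Dl (rev is) f x"
  by (intro wd_AE Lp_test_fn test_fn_Dl weak_deriv_test_fn)

lemma Hm_test_fn: "test_fn \<Omega> f \<Longrightarrow> Hm \<Omega> m f"
  unfolding Hm_def using Lp_test_fn weak_deriv_test_fn test_fn_Dl by blast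

lemma Hm_combo:
  assumes "Hm \<Omega> m u" "Hm \<Omega> m v" shows "Hm \<Omega> m (\<lambda>x. a * u x + b * v x)"
  unfolding Hm_def
proof (intro conjI allI impI)
  have L: "Lp \<Omega> 2 (\<lambda>x. a * u x + b * v x)" if "Lp \<Omega> 2 u" "Lp \<Omega> 2 v" for u v :: "real^'n \<Rightarrow> real"
    using Lp_add(1)[OF Lp_scale[OF that(1), of a] Lp_scale[OF that(2), of b]] by simp
  show "Lp \<Omega> 2 (\<lambda>x. a * u x + b * v x)" using assms L unfolding Hm_def by blast
  fix "is" :: "'n list" assume len: "length is \<le> m"
  obtain g g' where "Lp \<Omega> 2 g" "weak_deriv \<Omega> is u g" "Lp \<Omega> 2 g'" "weak_deriv \<Omega> is v g'"
    using assms len unfolding Hm_def by blast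
  with assms show "\<exists>g. Lp \<Omega> 2 g \<and> weak_deriv \<Omega> is (\<lambda>x. a * u x + b * v x) g"
    unfolding Hm_def by (intro exI[of _ "\<lambda>x. a * g x + b * g' x"] conjI L weak_deriv_combo) auto
qed

lemma Hm_wd:
  assumes "Hm \<Omega> m u" "length is \<le> m"
  shows "Lp \<Omega> 2 (wd \<Omega> is u)" "weak_deriv \<Omega> is u (wd \<Omega> is u)"
  using assms wd_props[of "is" u] unfolding Hm_def by auto

lemma wd_combo:
  assumes "Hm \<Omega> m u" "Hm \<Omega> m v" "length is \<le> m"
  shows "AE x in lebesgue_on \<Omega>. wd \<Omega> is (\<lambda>x. a * u x + b * v x) x = a * wd \<Omega> is u x + b * wd \<Omega> is v x"
proof (rule wd_AE)
  show "Lp \<Omega> 2 (\<lambda>x. a * wd \<Omega> is u x + b * wd \<Omega> is v x)"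
    using Lp_add(1)[OF Lp_scale[OF Hm_wd(1)[OF assms(1,3)], of a] Lp_scale[OF Hm_wd(1)[OF assms(2,3)], of b]] by simp
  show "weak_deriv \<Omega> is (\<lambda>x. a * u x + b * v x) (\<lambda>x. a * wd \<Omega> is u x + b * wd \<Omega> is v x)"
    using assms Hm_wd unfolding Hm_def by (intro weak_deriv_combo) blast+
qed

lemma finite_multisets: "finite {M :: 'n multiset. size M \<le> m}"
proof -
  have "{M :: 'n multiset. size M \<le> m} \<subseteq> (\<Union>k\<le>m. multisets_of_size UNIV k)"
    by (auto simp: multisets_of_size_def)
  then show ?thesis by (rule finite_subset) auto
qed

lemma weak_deriv_commute: "weak_deriv \<Omega> [i, j] u g \<Longrightarrow> Lp \<Omega> 2 u \<Longrightarrow> weak_deriv \<Omega> [j, i] u g"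
  unfolding weak_deriv_def
proof (intro allI impI)
  fix \<phi> assume w: "\<forall>\<phi>. test_fn \<Omega> \<phi> \<longrightarrow> (LINT x|lebesgue_on \<Omega>. u x * Dl [i, j] \<phi> x)
      = (- 1) ^ length [i, j] * (LINT x|lebesgue_on \<Omega>. g x * \<phi> x)"
    and u: "Lp \<Omega> 2 u" and \<phi>: "test_fn \<Omega> \<phi>"
  have t: "test_fn \<Omega> (pd i (pd j \<phi>))" "test_fn \<Omega> (pd j (pd i \<phi>))" by (intro test_fn_pd \<phi>)+
  \<comment> \<open>With the empty index list a weak derivative is the function itself, so
    uniqueness turns the integrated symmetry of \<open>integral_pd_commute\<close> into an almost
    everywhere identity.\<close>
  have "AE x in lebesgue_on \<Omega>. pd i (pd j \<phi>) x = pd j (pd i \<phi>) x"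
  proof (rule weak_deriv_unique[of "[]" "pd i (pd j \<phi>)"])
    show "weak_deriv \<Omega> [] (pd i (pd j \<phi>)) (pd j (pd i \<phi>))"
      unfolding weak_deriv_def
    proof (intro allI impI)
      fix \<psi> assume \<psi>: "test_fn \<Omega> \<psi>"
      show "(LINT x|lebesgue_on \<Omega>. pd i (pd j \<phi>) x * Dl [] \<psi> x)
          = (- 1) ^ length [] * (LINT x|lebesgue_on \<Omega>. pd j (pd i \<phi>) x * \<psi> x)"
        using integral_pd_commute[OF test_fn_mono[OF \<phi>] test_fn_mono[OF \<psi>], of i j]
        by (simp add: integral_mult_test[OF t(1) test_fn_smooth[OF \<psi>]] integral_mult_test[OF t(2) test_fn_smooth[OF \<psi>]])
    qed
  qed (use t Lp_test_fn in \<open>auto simp: weak_deriv_def\<close>)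
  then have "(LINT x|lebesgue_on \<Omega>. u x * pd i (pd j \<phi>) x) = (LINT x|lebesgue_on \<Omega>. u x * pd j (pd i \<phi>) x)"
    using Lp_measurable[OF u] Lp_measurable[OF Lp_test_fn[OF t(1)]] Lp_measurable[OF Lp_test_fn[OF t(2)]]
    by (intro integral_cong_AE) auto
  with w \<phi> show "(LINT x|lebesgue_on \<Omega>. u x * Dl [j, i] \<phi> x)
      = (- 1) ^ length [j, i] * (LINT x|lebesgue_on \<Omega>. g x * \<phi> x)" by simp
qed

text \<open>\<open>hnorm\<close> evaluates only one chosen ordering per multiset of directions, so
  an arbitrary list must be compared with the chosen one. Up to length 2 the only other ordering is
  a swap, which \<open>weak_deriv_commute\<close> covers.\<close>

lemma pint_wd_le_hnorm:
  assumes u: "Hm \<Omega> m u" and len: "length is \<le> m" "length is \<le> 2"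
  shows "pint \<Omega> 2 (wd \<Omega> is u) \<le> (hnorm \<Omega> m u)\<^sup>2"
proof -
  let ?f = "\<lambda>M :: 'n multiset. (lpnorm \<Omega> 2 (wd \<Omega> (SOME is. mset is = M) u)) ^ 2"
  define js where "js = (SOME js. mset js = mset is)"
  have js: "mset js = mset is" unfolding js_def by (rule someI) simp
  have le: "?f (mset is) \<le> (\<Sum>M\<in>{M. size M \<le> m}. ?f M)"
    using len by (intro member_le_sum finite_multisets) auto
  have "(\<Sum>M\<in>{M. size M \<le> m}. ?f M) = (hnorm \<Omega> m u)\<^sup>2"
    unfolding hnorm_def by (rule real_sqrt_pow2[symmetric]) (auto intro: sum_nonneg)
  then have "pint \<Omega> 2 (wd \<Omega> js u) \<le> (hnorm \<Omega> m u)\<^sup>2"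
    using le by (simp add: js_def lpnorm_pow)
  moreover have "pint \<Omega> 2 (wd \<Omega> is u) = pint \<Omega> 2 (wd \<Omega> js u)"
  proof (cases "js = is")
    case False
    then obtain i j where ij: "is = [i, j]" "js = [j, i]"
    proof -
      have short: "ks = [] \<or> (\<exists>a. ks = [a]) \<or> (\<exists>a b. ks = [a, b])" if "length ks \<le> 2" for ks :: "'n list"
        using that by (cases ks; cases "tl ks") auto
      have len': "length js = length is" using js mset_eq_length by blast
      have "is = [] \<or> (\<exists>a. is = [a]) \<or> (\<exists>a b. is = [a, b])" by (rule short[OF len(2)])
      moreover have "js = [] \<or> (\<exists>a. js = [a]) \<or> (\<exists>a b. js = [a, b])" by (rule short) (simp add: len' len(2))
      ultimately have "\<exists>i j. is = [i, j] \<and> js = [j, i]"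
        using len' mset_eq_setD[OF js] False by (elim disjE exE) (auto simp: doubleton_eq_iff)
      then show ?thesis using that by blast
    qed
    have L: "length [i, j] \<le> m" "length [j, i] \<le> m" using len ij by auto
    have "AE x in lebesgue_on \<Omega>. wd \<Omega> [i, j] u x = wd \<Omega> [j, i] u x"
      using u by (intro wd_AE Hm_wd[OF u L(2)] weak_deriv_commute[OF Hm_wd(2)[OF u L(2)]]) (simp add: Hm_def)
    then show ?thesis unfolding ij using Hm_wd(1)[OF u L(1)] Hm_wd(1)[OF u L(2)]
      by (intro pint_cong_AE Lp_measurable)
  qed simp
  ultimately show ?thesis by simp
qed

text \<open>Needed because \<open>alphaD\<close> and \<open>gammaD\<close> leave out functions of
  zero norm. The set where \<open>f\<close> is nonzero is open and negligible, hence empty.\<close>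

lemma test_fn_eq_0_of_hnorm:
  assumes f: "test_fn \<Omega> f" and z: "hnorm \<Omega> m f = 0"
  shows "f = (\<lambda>_. 0)"
proof -
  have "pint \<Omega> 2 (wd \<Omega> [] f) \<le> 0" using pint_wd_le_hnorm[OF Hm_test_fn[OF f], of "[]" m] z by simp
  moreover have "pint \<Omega> 2 (wd \<Omega> [] f) = pint \<Omega> 2 f"
    using Lp_measurable[OF Hm_wd(1)[OF Hm_test_fn[OF f], of "[]" 0]] Lp_measurable[OF Lp_test_fn[OF f]] wd_test_fn[OF f, of "[]"]
    by (intro pint_cong_AE) auto
  ultimately have "pint \<Omega> 2 f = 0" using pint_nonneg[of \<Omega> 2 f] by linarith
  have f2: "test_fn \<Omega> (\<lambda>x. f x * f x)" by (intro test_fn_mult f test_fn_smooth[OF f])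
  have "(\<integral>x. f x * f x \<partial>lborel) = 0"
    using \<open>pint \<Omega> 2 f = 0\<close> integral_mult_test[OF f test_fn_smooth[OF f]]
    by (simp add: pint_def power2_eq_square)
  then have "AE x in lborel. f x * f x = 0"
    using test_fn_lborel_integrable[OF f2] by (subst (asm) integral_nonneg_eq_0_iff_AE) auto
  then have ae: "AE x in lborel. x \<notin> {x. f x \<noteq> 0}" by simp
  have op: "open {x. f x \<noteq> 0}"
    using smooth_fun_continuous_on[OF test_fn_smooth[OF f], of UNIV]
    by (intro open_Collect_neq continuous_intros) auto
  have "{x. f x \<noteq> 0} \<in> null_sets lborel"
    using ae op AE_iff_null_sets[of "{x. f x \<noteq> 0}" lborel] by simp
  then have "negligible {x. f x \<noteq> 0}"
    unfolding negligible_iff_null_sets by (rule null_sets_completionI)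
  then have "{x. f x \<noteq> 0} = {}"
    using open_not_negligible[OF op] by blast
  then show ?thesis by auto
qed

end

section \<open>Linear algebra and a compactness principle\<close>

text \<open>Gaussian elimination. Any column contains a pivot, since otherwise its unit vector would
  lie in the kernel, and triviality of the kernel passes to the reduced system.\<close>

lemma square_system_solvable:
  fixes A :: "'i \<Rightarrow> 'j \<Rightarrow> real"
  assumes "finite I" "finite J" "card I = card J"
    and "\<And>x. (\<forall>i\<in>I. (\<Sum>j\<in>J. A i j * x j) = 0) \<Longrightarrow> \<forall>j\<in>J. x j = 0"
  shows "\<exists>x. \<forall>i\<in>I. (\<Sum>j\<in>J. A i j * x j) = b i"
  using assms
proof (induction "card J" arbitrary: I J A b)
  case 0
  then show ?case by auto
next
  case (Suc n)
  note inj = Suc.prems(4)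
  obtain p where p: "p \<in> J" using Suc.hyps(2) by (metis card.empty nat.distinct(1) equals0I)
  have "\<exists>q\<in>I. A q p \<noteq> 0"
  proof (rule ccontr)
    assume "\<not> (\<exists>q\<in>I. A q p \<noteq> 0)"
    then have "\<forall>i\<in>I. (\<Sum>j\<in>J. A i j * (if j = p then 1 else 0)) = 0"
      using p Suc.prems(2) by (simp add: if_distrib[of "\<lambda>t. _ * t"] sum.delta cong: if_cong)
    from inj[OF this] p show False by auto
  qed
  then obtain q where q: "q \<in> I" "A q p \<noteq> 0" by blast
  define I' J' where "I' = I - {q}" "J' = J - {p}"
  \<comment> \<open>The Schur complement of the pivot \<open>A q p\<close>.\<close>
  define A' where "A' i j = A i j - A i p * A q j / A q p" for i j
  have upd: "(\<Sum>j\<in>J. A i j * (x(p := c)) j) = A i p * c + (\<Sum>j\<in>J'. A i j * x j)" for i x c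
  proof -
    have "(\<Sum>j\<in>J. A i j * (x(p := c)) j) = A i p * (x(p := c)) p + (\<Sum>j\<in>J'. A i j * (x(p := c)) j)"
      unfolding I'_J'_def using p Suc.prems(2) by (intro sum.remove) auto
    also have "(\<Sum>j\<in>J'. A i j * (x(p := c)) j) = (\<Sum>j\<in>J'. A i j * x j)"
      unfolding I'_J'_def by (intro sum.cong) auto
    finally show ?thesis by simp
  qed
  have red: "(\<Sum>j\<in>J'. A' i j * x j) = (\<Sum>j\<in>J'. A i j * x j) - A i p / A q p * (\<Sum>j\<in>J'. A q j * x j)" for i x
  proof -
    have "A' i j * x j = A i j * x j - A i p / A q p * (A q j * x j)" for j
      by (simp add: A'_def left_diff_distrib)
    then show ?thesis by (simp add: sum_subtractf sum_distrib_left)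
  qed
  have "\<exists>x. \<forall>i\<in>I'. (\<Sum>j\<in>J'. A' i j * x j) = b i - A i p * b q / A q p"
  proof (rule Suc.hyps(1))
    show "n = card J'" "card I' = card J'" "finite I'" "finite J'"
      unfolding I'_J'_def using Suc.hyps(2) Suc.prems p q by auto
    fix x assume x: "\<forall>i\<in>I'. (\<Sum>j\<in>J'. A' i j * x j) = 0"
    \<comment> \<open>The value that row \<open>q\<close> forces at position \<open>p\<close>; the
      remaining rows then reduce to the Schur complement.\<close>
    define c where "c = - (\<Sum>j\<in>J'. A q j * x j) / A q p"
    have "(\<Sum>j\<in>J. A i j * (x(p := c)) j) = 0" if "i \<in> I" for i
    proof (cases "i = q")
      case False
      then have "(\<Sum>j\<in>J'. A' i j * x j) = 0" using x that by (simp add: I'_J'_def)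
      then show ?thesis unfolding upd red c_def by simp
    qed (use q in \<open>simp only: upd c_def, simp\<close>)
    then have "\<forall>j\<in>J. (x(p := c)) j = 0" by (intro inj) blast
    then show "\<forall>j\<in>J'. x j = 0" by (auto simp: I'_J'_def split: if_splits)
  qed
  then obtain x where x: "\<forall>i\<in>I'. (\<Sum>j\<in>J'. A' i j * x j) = b i - A i p * b q / A q p" by blast
  define c where "c = (b q - (\<Sum>j\<in>J'. A q j * x j)) / A q p"
  have "(\<Sum>j\<in>J. A i j * (x(p := c)) j) = b i" if "i \<in> I" for i
  proof (cases "i = q")
    case False
    then have "(\<Sum>j\<in>J'. A' i j * x j) = b i - A i p * b q / A q p" using x that by (simp add: I'_J'_def)
    then show ?thesis unfolding upd red c_def using q by (simp add: field_simps)
  qed (use q in \<open>simp only: upd c_def, simp\<close>)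
  then show ?case by blast
qed

text \<open>Turns families of functions and families of coefficient vectors into real vector spaces,
  so that \<open>subspace\<close>, \<open>convex hull\<close> and finite linear combinations are
  available for them.\<close>

instantiation "fun" :: (type, real_vector) real_vector
begin

definition scaleR_fun :: "real \<Rightarrow> ('a \<Rightarrow> 'b) \<Rightarrow> 'a \<Rightarrow> 'b" where
  "scaleR_fun c f = (\<lambda>x. c *\<^sub>R f x)"

instance
  by standard (auto simp: scaleR_fun_def plus_fun_def scaleR_add_right scaleR_add_left)

end

text \<open>Weak sequential compactness is replaced by Mazur's device: near-minimisers of the energy on the
  convex hulls of the tails form a Cauchy sequence, by the parallelogram law.  The inf-sup
  condition forces them to tend to \<open>0\<close> in energy, although all of them have a functional
  \<open>l\<close> bounded away from \<open>0\<close> if the conclusion fails along a subsequence.\<close>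

lemma weakly_null:
  fixes x :: "nat \<Rightarrow> 'v::real_vector" and I T :: "'v \<Rightarrow> 'v \<Rightarrow> real" and l :: "'v \<Rightarrow> real"
  assumes V: "subspace V"
    and I_add: "\<And>u v w. u \<in> V \<Longrightarrow> v \<in> V \<Longrightarrow> w \<in> V \<Longrightarrow> I (u + v) w = I u w + I v w"
    and I_scale: "\<And>c u w. u \<in> V \<Longrightarrow> w \<in> V \<Longrightarrow> I (c *\<^sub>R u) w = c * I u w"
    and I_sym: "\<And>u w. u \<in> V \<Longrightarrow> w \<in> V \<Longrightarrow> I u w = I w u"
    and I_pos: "\<And>u. u \<in> V \<Longrightarrow> I u u \<ge> 0"
    and T_add: "\<And>u v w. u \<in> V \<Longrightarrow> v \<in> V \<Longrightarrow> w \<in> V \<Longrightarrow> T (u + v) w = T u w + T v w"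
    and T_scale: "\<And>c u w. u \<in> V \<Longrightarrow> w \<in> V \<Longrightarrow> T (c *\<^sub>R u) w = c * T u w"
    and T_bound: "\<And>u w. u \<in> V \<Longrightarrow> w \<in> V \<Longrightarrow> (T u w)\<^sup>2 \<le> C * I u u * I w w" "C \<ge> 0"
    and infsup: "\<beta> > 0" "\<And>u e. u \<in> V \<Longrightarrow> e \<ge> 0 \<Longrightarrow> (\<And>w. w \<in> V \<Longrightarrow> (T u w)\<^sup>2 \<le> e * I w w) \<Longrightarrow> \<beta> * I u u \<le> e"
    and l_add: "\<And>u v. u \<in> V \<Longrightarrow> v \<in> V \<Longrightarrow> l (u + v) = l u + l v"
    and l_scale: "\<And>c u. u \<in> V \<Longrightarrow> l (c *\<^sub>R u) = c * l u"
    and l_bound: "\<And>u. u \<in> V \<Longrightarrow> (l u)\<^sup>2 \<le> K * I u u" "K \<ge> 0"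
    and x: "\<And>n. x n \<in> V" "\<And>n. I (x n) (x n) \<le> M"
    and T_lim: "\<And>w. w \<in> V \<Longrightarrow> (\<lambda>n. T (x n) w) \<longlonglongrightarrow> 0"
  shows "(\<lambda>n. l (x n)) \<longlonglongrightarrow> 0"
proof (rule ccontr)
  assume "\<not> ?thesis"
  then obtain e where e: "e > 0" and freq: "\<exists>\<^sub>F n in sequentially. \<not> \<bar>l (x n)\<bar> < e"
    unfolding tendsto_iff not_all not_imp frequently_def[symmetric] by (auto simp: dist_real_def not_eventually)
  \<comment> \<open>With a fixed sign, being bounded away from 0 becomes a convex condition, which
    is inherited by convex hulls.\<close>
  have "\<exists>s. (s = 1 \<or> s = -1) \<and> (\<exists>\<^sub>F n in sequentially. s * l (x n) \<ge> e)"
  proof (rule ccontr)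
    assume "\<not> ?thesis"
    then have "eventually (\<lambda>n. \<not> 1 * l (x n) \<ge> e) sequentially" "eventually (\<lambda>n. \<not> (-1) * l (x n) \<ge> e) sequentially"
      unfolding frequently_def by auto
    then have "eventually (\<lambda>n. \<bar>l (x n)\<bar> < e) sequentially"
      by eventually_elim auto
    with freq show False unfolding frequently_def by simp
  qed
  then obtain s where s: "s = 1 \<or> s = -1" "\<exists>\<^sub>F n in sequentially. s * l (x n) \<ge> e" by blast
  define r where "r = enumerate {n. s * l (x n) \<ge> e}"
  have inf: "infinite {n. s * l (x n) \<ge> e}"
    using s(2) by (simp add: frequently_cofinite cofinite_eq_sequentially[symmetric])
  have r: "strict_mono r" unfolding r_def using strict_mono_enumerate[OF inf] .
  define z where "z n = x (r n)" for n
  have z: "z n \<in> V" "I (z n) (z n) \<le> M" "s * l (z n) \<ge> e" for n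
    using x enumerate_in_set[OF inf, of n] by (auto simp: z_def r_def)
  have T_z: "(\<lambda>n. T (z n) w) \<longlonglongrightarrow> 0" if "w \<in> V" for w
    using LIMSEQ_subseq_LIMSEQ[OF T_lim[OF that] r] by (simp add: z_def o_def)
  define H where "H n = convex hull (z ` {n..})" for n
  have H_min: "H n \<subseteq> S" if "convex S" "\<And>m. m \<ge> n \<Longrightarrow> z m \<in> S" for n S
    unfolding H_def using that by (intro hull_minimal) auto
  have HV: "H n \<subseteq> V" for n using H_min[of V n] z(1) subspace_imp_convex[OF V] by blast
  have H_anti: "H m \<subseteq> H n" if "n \<le> m" for n m
    unfolding H_def using that by (intro hull_mono) auto
  have zH: "z n \<in> H n" for n unfolding H_def by (intro hull_inc) auto
  have comb: "a *\<^sub>R u + b *\<^sub>R v \<in> V" if "u \<in> V" "v \<in> V" for a b u v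
    using V that by (simp add: subspace_add subspace_scale)
  define d where "d n = Inf ((\<lambda>u. I u u) ` H n)" for n
  have bdd: "bdd_below ((\<lambda>u. I u u) ` H n)" for n
    using I_pos HV by (intro bdd_belowI[of _ 0]) blast
  have d_le: "d n \<le> I u u" if "u \<in> H n" for n u
    unfolding d_def using bdd that by (intro cInf_lower) auto
  have d_inc: "incseq d"
    unfolding incseq_def d_def
  proof (intro allI impI cInf_superset_mono image_mono)
    show "(\<lambda>u. I u u) ` H n \<noteq> {}" for n using zH[of n] by blast
  qed (use bdd H_anti in auto)
  have "d n \<le> M" for n using d_le[OF zH] z(2) order_trans by blast
  then obtain D where D: "d \<longlonglongrightarrow> D" "\<And>n. d n \<le> D"
    using incseq_convergent[OF d_inc, of M] by auto
  have "\<exists>u\<in>H n. I u u < d n + 1 / real (Suc n)" for n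
    using cInf_lessD[of "(\<lambda>u. I u u) ` H n" "d n + 1 / real (Suc n)"] zH[of n] by (auto simp: d_def)
  then obtain y where y: "\<And>n. y n \<in> H n" "\<And>n. I (y n) (y n) < d n + 1 / real (Suc n)" by metis
  have yV: "y n \<in> V" for n using y(1) HV by blast
  \<comment> \<open>The parallelogram law bounds the energy of \<open>y n - y m\<close>, for
    \<open>n \<le> m\<close>, by this number: midpoints stay in \<open>H n\<close> and cost at least
    \<open>d n\<close>, and both near-minimisers overshoot by at most
    \<open>1 / (n + 1)\<close>.\<close>
  define \<eta> where "\<eta> n = 2 * (D - d n) + 4 * (1 / real (Suc n))" for n
  have \<eta>: "\<eta> \<longlonglongrightarrow> 0"
  proof -
    have "(\<lambda>n. 2 * (D - d n) + 4 * inverse (real (Suc n))) \<longlonglongrightarrow> 2 * (D - D) + 4 * 0"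
      by (intro tendsto_intros D(1) LIMSEQ_inverse_real_of_nat)
    then show ?thesis by (simp add: \<eta>_def[abs_def] divide_inverse)
  qed
  have \<eta>0: "\<eta> n \<ge> 0" for n unfolding \<eta>_def using D(2)[of n] by simp
  have I_diff: "I (u - v) (u - v) = 2 * I u u + 2 * I v v - 4 * I ((1/2) *\<^sub>R u + (1/2) *\<^sub>R v) ((1/2) *\<^sub>R u + (1/2) *\<^sub>R v)"
    if uv: "u \<in> V" "v \<in> V" for u v
  proof -
    have exp: "I (a *\<^sub>R u + b *\<^sub>R v) (a *\<^sub>R u + b *\<^sub>R v) = a * a * I u u + 2 * a * b * I u v + b * b * I v v" for a b
    proof -
      have au: "a *\<^sub>R u \<in> V" "b *\<^sub>R v \<in> V" using V uv by (auto simp: subspace_scale)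
      have r: "I w (a *\<^sub>R u + b *\<^sub>R v) = a * I u w + b * I v w" if "w \<in> V" for w
        using I_sym[OF that comb[OF uv, of a b]] I_add[OF au that] I_scale[OF uv(1) that] I_scale[OF uv(2) that] by simp
      have "I (a *\<^sub>R u + b *\<^sub>R v) (a *\<^sub>R u + b *\<^sub>R v) = a * I u (a *\<^sub>R u + b *\<^sub>R v) + b * I v (a *\<^sub>R u + b *\<^sub>R v)"
        using I_add[OF au comb[OF uv, of a b]] I_scale[OF uv(1) comb[OF uv, of a b]] I_scale[OF uv(2) comb[OF uv, of a b]] by simp
      then show ?thesis using r[OF uv(1)] r[OF uv(2)] I_sym[OF uv] by (simp add: algebra_simps)
    qed
    show ?thesis using exp[of 1 "-1"] exp[of "1/2" "1/2"] by simp
  qed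
  have close: "I (y n - y m) (y n - y m) \<le> \<eta> n" if "n \<le> m" for n m
  proof -
    have "convex (H n)" unfolding H_def by simp
    then have "(1/2) *\<^sub>R y n + (1/2) *\<^sub>R y m \<in> H n"
      using y(1) H_anti[OF that] by (intro convexD) auto
    then have "d n \<le> I ((1/2) *\<^sub>R y n + (1/2) *\<^sub>R y m) ((1/2) *\<^sub>R y n + (1/2) *\<^sub>R y m)" by (rule d_le)
    moreover have "1 / real (Suc m) \<le> 1 / real (Suc n)" using that by (intro divide_left_mono) auto
    moreover have "2 * a + 2 * b - 4 * c \<le> 2 * (D - dn) + 4 * en"
      if "dn \<le> c" "em \<le> en" "a < dn + en" "b < dm + em" "dm \<le> D" for a b c dn dm en em :: real
      using that by argo
    ultimately show ?thesis
      unfolding I_diff[OF yV yV] \<eta>_def using y(2)[of n] y(2)[of m] D(2)[of m] by blast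
  qed
  \<comment> \<open>Smallness of \<open>T\<close> against a fixed \<open>w\<close> is a convex
    condition too, so it passes from a tail to its hull.\<close>
  have T_y: "(\<lambda>m. T (y m) w) \<longlonglongrightarrow> 0" if w: "w \<in> V" for w
  proof (rule LIMSEQ_I)
    fix a :: real assume a: "a > 0"
    obtain N where N: "\<And>m. m \<ge> N \<Longrightarrow> norm (T (z m) w - 0) < a / 2"
      using LIMSEQ_D[OF T_z[OF w], of "a / 2"] a by auto
    have conv: "convex {u \<in> V. \<bar>T u w\<bar> \<le> a / 2}"
    proof (rule convexI)
      fix u v and p q :: real
      assume u: "u \<in> {u \<in> V. \<bar>T u w\<bar> \<le> a / 2}" and v: "v \<in> {u \<in> V. \<bar>T u w\<bar> \<le> a / 2}" and pq: "p \<ge> 0" "q \<ge> 0" "p + q = 1"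
      have "T (p *\<^sub>R u + q *\<^sub>R v) w = p * T u w + q * T v w"
        using u v w V by (simp add: T_add T_scale subspace_scale)
      also have "\<bar>\<dots>\<bar> \<le> p * \<bar>T u w\<bar> + q * \<bar>T v w\<bar>"
        using pq by (intro order_trans[OF abs_triangle_ineq]) (simp add: abs_mult)
      also have "\<dots> \<le> p * (a / 2) + q * (a / 2)" using u v pq by (intro add_mono mult_left_mono) auto
      also have "\<dots> = a / 2" using pq by (simp flip: distrib_right)
      finally show "p *\<^sub>R u + q *\<^sub>R v \<in> {u \<in> V. \<bar>T u w\<bar> \<le> a / 2}" using u v comb by simp
    qed
    have "norm (T (y m) w - 0) < a" if "m \<ge> N" for m
    proof -
      have "H m \<subseteq> {u \<in> V. \<bar>T u w\<bar> \<le> a / 2}"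
        using N that z(1) by (intro H_min[OF conv]) (fastforce intro: less_imp_le)
      then show ?thesis using y(1)[of m] a by auto
    qed
    then show "\<exists>N. \<forall>m\<ge>N. norm (T (y m) w - 0) < a" by blast
  qed
  \<comment> \<open>As \<open>T (y m) w\<close> tends to 0, \<open>T (y n) w\<close> is the limit of
    \<open>T (y n - y m) w\<close>, which the Cauchy property bounds uniformly in \<open>w\<close>.
    This is the form in which the inf-sup condition applies.\<close>
  have small: "\<beta> * I (y n) (y n) \<le> C * \<eta> n" for n
  proof (rule infsup(2)[OF yV])
    show "C * \<eta> n \<ge> 0" using T_bound(2) \<eta>0 by simp
    fix w assume w: "w \<in> V"
    have "(\<lambda>m. (T (y n) w - T (y m) w)\<^sup>2) \<longlonglongrightarrow> (T (y n) w - 0)\<^sup>2"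
      by (intro tendsto_intros T_y w)
    moreover have "(T (y n) w - T (y m) w)\<^sup>2 \<le> C * \<eta> n * I w w" if "m \<ge> n" for m
    proof -
      have "T (y n - y m) w = T (y n) w - T (y m) w"
        using T_add[OF yV[of n], of "(-1) *\<^sub>R y m" w] T_scale[OF yV[of m] w, of "-1"] V yV[of m] w
        by (simp add: subspace_neg)
      then have "(T (y n) w - T (y m) w)\<^sup>2 \<le> C * I (y n - y m) (y n - y m) * I w w"
        using T_bound(1)[OF subspace_diff[OF V yV yV] w, of n m] by simp
      also have "\<dots> \<le> C * \<eta> n * I w w"
        using close[OF that] T_bound(2) I_pos[OF w] by (intro mult_right_mono mult_left_mono)
      finally show ?thesis .
    qed
    ultimately show "(T (y n) w)\<^sup>2 \<le> C * \<eta> n * I w w"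
      by (intro LIMSEQ_le_const2[of _ "(T (y n) w)\<^sup>2"]) auto
  qed
  have "e\<^sup>2 \<le> K * (C * \<eta> n) / \<beta>" for n
  proof -
    have conv: "convex {u \<in> V. s * l u \<ge> e}"
    proof (rule convexI)
      fix u v and p q :: real
      assume u: "u \<in> {u \<in> V. s * l u \<ge> e}" and v: "v \<in> {u \<in> V. s * l u \<ge> e}" and pq: "p \<ge> 0" "q \<ge> 0" "p + q = 1"
      have "e = p * e + q * e" using pq by (simp flip: distrib_right)
      also have "\<dots> \<le> p * (s * l u) + q * (s * l v)" using u v pq by (intro add_mono mult_left_mono) auto
      also have "\<dots> = s * l (p *\<^sub>R u + q *\<^sub>R v)"
        using u v V by (simp add: l_add l_scale subspace_scale algebra_simps)
      finally show "p *\<^sub>R u + q *\<^sub>R v \<in> {u \<in> V. s * l u \<ge> e}" using u v comb by simp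
    qed
    have "H n \<subseteq> {u \<in> V. s * l u \<ge> e}" using z by (intro H_min[OF conv]) auto
    then have "s * l (y n) \<ge> e" using y(1) by blast
    then have "e\<^sup>2 \<le> (s * l (y n))\<^sup>2" using e by (intro power_mono) auto
    also have "\<dots> = (l (y n))\<^sup>2" using s(1) by auto
    also have "\<dots> \<le> K * I (y n) (y n)" by (rule l_bound(1)[OF yV])
    also have "\<dots> \<le> K * (C * \<eta> n / \<beta>)"
      using small[of n] infsup(1) l_bound(2) by (intro mult_left_mono) (simp_all add: field_simps)
    finally show ?thesis by simp
  qed
  moreover have "(\<lambda>n. K * (C * \<eta> n) / \<beta>) \<longlonglongrightarrow> K * (C * 0) / \<beta>"
    using infsup(1) by (intro tendsto_intros \<eta>) auto
  ultimately have "e\<^sup>2 \<le> K * (C * 0) / \<beta>" by (intro LIMSEQ_le_const[of _ _ "e\<^sup>2"]) auto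
  then show False using e by simp
qed

section \<open>Rellich compactness\<close>

context bounded_open
begin

lemma test_fn_square_lborel: "test_fn \<Omega>' f \<Longrightarrow> integrable lborel (\<lambda>x. (f x)\<^sup>2)"
  using test_fn_lborel_integrable[OF test_fn_mult[OF _ test_fn_smooth]]
  by (simp add: power2_eq_square)

text \<open>Averaging \<open>2 u(x) u(x + z) = u(x)\<^sup>2 + u(x + z)\<^sup>2 - (u(x + z) - u(x))\<^sup>2\<close> over \<open>x\<close> and over small \<open>z\<close>.\<close>

lemma local_average_bound:
  fixes u :: "real^'n \<Rightarrow> real"
  assumes u: "test_fn UNIV u" and \<delta>: "\<delta> \<ge> 0"
  shows "measure lborel (cball (0::real^'n) \<delta>) * (\<integral>x. (u x)\<^sup>2 \<partial>lborel)
    \<le> (\<integral>x. u x * (\<integral>z. indicator (cball 0 \<delta>) z * u (x + z) \<partial>lborel) \<partial>lborel)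
      + measure lborel (cball (0::real^'n) \<delta>) * (\<delta>\<^sup>2 / 2 * (\<integral>x. (norm (gr u x))\<^sup>2 \<partial>lborel))"
proof -
  define B where "B = cball (0::real^'n) \<delta>"
  define S where "S = (\<integral>x. (u x)\<^sup>2 \<partial>lborel)"
  define E where "E = (\<integral>x. (norm (gr u x))\<^sup>2 \<partial>lborel)"
  define p where "p z = (\<integral>x. u x * u (x + z) \<partial>lborel)" for z
  have um [measurable]: "u \<in> borel_measurable borel" by (rule test_fn_borel_measurable[OF u])
  note sh = test_fn_shift[OF u]
  have E0: "E \<ge> 0" by (simp add: E_def)
  have pz: "S \<le> p z + \<delta>\<^sup>2 / 2 * E" if "z \<in> B" for z
  proof -
    have i: "integrable lborel (\<lambda>x. (u x)\<^sup>2)" "integrable lborel (\<lambda>x. (u (x + z))\<^sup>2)" "integrable lborel (\<lambda>x. u x * u (x + z))"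
      using test_fn_square_lborel[OF u] test_fn_square_lborel[OF sh]
        test_fn_lborel_integrable[OF test_fn_mult[OF u test_fn_smooth[OF sh]]] by auto
    have "(\<integral>x. (u (x + z) - u x)\<^sup>2 \<partial>lborel) = (\<integral>x. (u (x + z))\<^sup>2 + (u x)\<^sup>2 - 2 * (u x * u (x + z)) \<partial>lborel)"
      by (intro Bochner_Integration.integral_cong) (auto simp: power2_diff)
    also have "\<dots> = (\<integral>x. (u (x + z))\<^sup>2 \<partial>lborel) + S - 2 * p z"
      using i by (simp add: S_def p_def)
    also have "(\<integral>x. (u (x + z))\<^sup>2 \<partial>lborel) = S"
      unfolding S_def using lborel_integral_shift[of "\<lambda>x. (u x)\<^sup>2" z] by simp
    finally have "2 * S - 2 * p z \<le> (norm z)\<^sup>2 * E"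
      using translation_estimate[OF u, of z] by (simp add: E_def)
    also have "\<dots> \<le> \<delta>\<^sup>2 * E"
      using that E0 \<delta> by (intro mult_right_mono power_mono) (auto simp: B_def)
    finally show ?thesis by simp
  qed
  obtain K where K: "smooth_fun u" "compact K" "\<And>x. x \<notin> K \<Longrightarrow> u x = 0"
    using u by (rule test_fnE) blast
  have cu: "continuous_on A u" for A by (rule smooth_fun_continuous_on[OF K(1)])
  \<comment> \<open>Fubini's theorem needs joint integrability. Since \<open>u\<close> vanishes off
    \<open>K\<close>, the indicator of a compact product may be inserted, and continuity
    suffices.\<close>
  have "integrable lborel (\<lambda>q. indicator (K \<times> B) q *\<^sub>R (u (fst q) * u (fst q + snd q)))"
    by (rule borel_integrable_compact)
       (auto intro!: compact_Times K(2) continuous_intros continuous_on_compose2[OF cu[of UNIV]] simp: B_def)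
  moreover have "(\<lambda>q. indicator (K \<times> B) q *\<^sub>R (u (fst q) * u (fst q + snd q)))
      = (\<lambda>(x, z). indicator B z * (u x * u (x + z)))"
    using K(3) by (auto simp: fun_eq_iff indicator_def)
  ultimately have int: "integrable (lborel \<Otimes>\<^sub>M lborel) (\<lambda>(x, z). indicator B z * (u x * u (x + z)))"
    by (simp add: lborel_prod)
  have int_p: "integrable lborel (\<lambda>z. indicator B z * p z)"
    using lborel_pair.integrable_snd[OF int] by (simp add: p_def)
  have Bi: "integrable lborel (indicat_real B)"
    unfolding B_def by (rule integrable_indicator_cball)
  have mB: "(\<integral>z. indicat_real B z \<partial>lborel) = measure lborel B" by simp
  have "measure lborel B * S = (\<integral>z. indicator B z * S \<partial>lborel)"
    using mB by simp
  also have "\<dots> \<le> (\<integral>z. indicator B z * p z + indicator B z * (\<delta>\<^sup>2 / 2 * E) \<partial>lborel)"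
    by (intro integral_mono Bochner_Integration.integrable_add integrable_mult_left Bi int_p)
       (use pz in \<open>auto simp: indicator_def\<close>)
  also have "\<dots> = (\<integral>z. indicator B z * p z \<partial>lborel) + measure lborel B * (\<delta>\<^sup>2 / 2 * E)"
    using int_p Bi mB by (subst Bochner_Integration.integral_add) (auto intro!: integrable_mult_left)
  also have "(\<integral>z. indicator B z * p z \<partial>lborel) = (\<integral>z. (\<integral>x. indicator B z * (u x * u (x + z)) \<partial>lborel) \<partial>lborel)"
    by (simp add: p_def)
  also have "\<dots> = (\<integral>x. (\<integral>z. indicator B z * (u x * u (x + z)) \<partial>lborel) \<partial>lborel)"
    by (rule lborel_pair.Fubini_integral[OF int])
  also have "\<dots> = (\<integral>x. u x * (\<integral>z. indicator B z * u (x + z) \<partial>lborel) \<partial>lborel)"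
    by (simp add: mult.left_commute)
  finally show ?thesis by (simp add: B_def S_def E_def)
qed

text \<open>Averages over balls of a fixed radius converge to 0 pointwise by \<open>weak\<close> and
  are uniformly bounded, hence tend to 0 in L^2 on \<Omega>. By \<open>local_average_bound\<close>
  they control the squared norm up to a term of the order of the squared radius.\<close>

lemma rellich:
  fixes u :: "nat \<Rightarrow> real^'n \<Rightarrow> real"
  assumes u: "\<And>n. test_fn \<Omega> (u n)"
    and M: "\<And>n. (\<integral>x. (u n x)\<^sup>2 \<partial>lborel) \<le> M" "\<And>n. (\<integral>x. (norm (gr (u n) x))\<^sup>2 \<partial>lborel) \<le> M"
    and weak: "\<And>y \<delta>. (\<lambda>n. \<integral>x. indicator (cball y \<delta>) x * u n x \<partial>lborel) \<longlonglongrightarrow> 0"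
  shows "(\<lambda>n. \<integral>x. (u n x)\<^sup>2 \<partial>lborel) \<longlonglongrightarrow> 0"
proof (rule LIMSEQ_I)
  fix e :: real assume e: "e > 0"
  have M0: "M \<ge> 0" using M(1)[of 0] by (rule order_trans[rotated]) simp
  have uU: "test_fn UNIV (u n)" for n by (rule test_fn_mono[OF u]) simp
  have um [measurable]: "u n \<in> borel_measurable borel" for n by (rule test_fn_borel_measurable[OF u])
  have Om [measurable]: "\<Omega> \<in> sets borel" using open_dom by simp
  \<comment> \<open>Makes the gradient term \<open>\<delta>\<^sup>2 / 2 * M\<close> at most
    \<open>e / 2\<close>; the added 1 avoids division by zero.\<close>
  define \<delta> where "\<delta> = sqrt (e / (M + 1))"
  have \<delta>: "\<delta> > 0" "\<delta>\<^sup>2 = e / (M + 1)" using e M0 by (auto simp: \<delta>_def)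
  define B where "B = cball (0::real^'n) \<delta>"
  define v where "v = measure lborel B"
  have v: "v > 0" unfolding v_def B_def
    using content_cball_pos[OF \<delta>(1)] by simp
  define F where "F n x = (\<integral>z. indicator B z * u n (x + z) \<partial>lborel)" for n x
  have Fm [measurable]: "F n \<in> borel_measurable borel" for n
  proof -
    have [measurable]: "B \<in> sets borel" by (simp add: B_def)
    have "(\<lambda>p. indicator B (snd p) * u n (fst p + snd p)) \<in> borel_measurable (borel \<Otimes>\<^sub>M borel)"
      by measurable
    then have "(\<lambda>(x, z). indicator B z * u n (x + z)) \<in> borel_measurable (borel \<Otimes>\<^sub>M lborel)"
      by (simp add: measurable_cong_sets[OF sets_pair_measure_cong[OF refl sets_lborel] refl] case_prod_beta')
    from lborel.borel_measurable_lebesgue_integral[OF this] show ?thesis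
      unfolding F_def by simp
  qed
  have F_lim: "(\<lambda>n. F n x) \<longlonglongrightarrow> 0" for x
  proof -
    have "F n x = (\<integral>y. indicator (cball x \<delta>) y * u n y \<partial>lborel)" for n
    proof -
      have "(\<lambda>y. indicator (cball x \<delta>) y * u n y) \<in> borel_measurable borel"
        by (intro borel_measurable_times borel_measurable_indicator um) simp
      from lborel_integral_shift[OF this, of x]
      have "(\<integral>y. indicator (cball x \<delta>) y * u n y \<partial>lborel) = (\<integral>z. indicator (cball x \<delta>) (z + x) * u n (z + x) \<partial>lborel)"
        by simp
      also have "\<dots> = F n x" unfolding F_def B_def
        by (intro Bochner_Integration.integral_cong) (auto simp: indicator_def dist_norm add.commute)
      finally show ?thesis by simp
    qed
    then show ?thesis using weak[of x \<delta>] by simp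
  qed
  have F_bd: "(F n x)\<^sup>2 \<le> v * M" for n x
  proof -
    have i: "integrable lborel (\<lambda>z. (indicat_real B z)\<^sup>2)" "integrable lborel (\<lambda>z. (u n (x + z))\<^sup>2)"
      using integrable_indicator_cball[of \<delta>] test_fn_square_lborel[OF test_fn_shift[OF uU[of n], of x]]
      by (auto simp: B_def power2_eq_square add.commute simp flip: indicator_inter_arith)
    have "\<bar>F n x\<bar> \<le> (\<integral>z. \<bar>indicator B z * u n (x + z)\<bar> \<partial>lborel)"
      unfolding F_def by (rule integral_abs_bound)
    then have "(F n x)\<^sup>2 \<le> (\<integral>z. \<bar>indicator B z * u n (x + z)\<bar> \<partial>lborel)\<^sup>2"
      by (metis abs_ge_zero power2_abs power_mono)
    also have "\<dots> \<le> (\<integral>z. (indicat_real B z)\<^sup>2 \<partial>lborel) * (\<integral>z. (u n (x + z))\<^sup>2 \<partial>lborel)"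
      by (rule integral_Cauchy_Schwarz(2)) (use i in \<open>auto simp: B_def intro!: borel_measurable_indicator\<close>)
    also have "(\<integral>z. (indicat_real B z)\<^sup>2 \<partial>lborel) = v"
      by (simp add: v_def power2_eq_square flip: indicator_inter_arith)
    also have "(\<integral>z. (u n (x + z))\<^sup>2 \<partial>lborel) = (\<integral>z. (u n z)\<^sup>2 \<partial>lborel)"
      using lborel_integral_shift[of "\<lambda>z. (u n z)\<^sup>2" x] by (simp add: add.commute)
    also have "v * \<dots> \<le> v * M" using v M by (intro mult_left_mono) auto
    finally show ?thesis .
  qed
  have fin: "integrable lborel (indicat_real \<Omega>)"
    using emeasure_bounded_finite[OF bounded_dom] by (intro integrable_real_indicator) auto
  have G_int: "integrable lborel (\<lambda>x. (indicator \<Omega> x * F n x)\<^sup>2)" for n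
    by (rule Bochner_Integration.integrable_bound[OF integrable_mult_right[OF fin, of "v * M"]])
       (use order_trans[OF F_bd abs_ge_self] in \<open>auto simp: indicator_def\<close>)
  have "(\<lambda>n. \<integral>x. (indicator \<Omega> x * F n x)\<^sup>2 \<partial>lborel) \<longlonglongrightarrow> (\<integral>x. 0 \<partial>(lborel :: (real^'n) measure))"
  proof (rule integral_dominated_convergence[where w = "\<lambda>x. v * M * indicat_real \<Omega> x"])
    show "AE x in lborel. (\<lambda>n. (indicator \<Omega> x * F n x)\<^sup>2) \<longlonglongrightarrow> 0"
    proof (rule AE_I2)
      fix x
      have "(\<lambda>n. (indicator \<Omega> x * F n x)\<^sup>2) \<longlonglongrightarrow> (indicator \<Omega> x * 0)\<^sup>2"
        by (intro tendsto_intros F_lim)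
      then show "(\<lambda>n. (indicator \<Omega> x * F n x)\<^sup>2) \<longlonglongrightarrow> 0" by simp
    qed
    show "AE x in lborel. norm ((indicator \<Omega> x * F n x)\<^sup>2) \<le> v * M * indicat_real \<Omega> x" for n
      using F_bd by (auto simp: indicator_def)
    show "integrable lborel (\<lambda>x. v * M * indicat_real \<Omega> x)" by (rule integrable_mult_right[OF fin])
  qed auto
  then have lim: "(\<lambda>n. M * (\<integral>x. (indicator \<Omega> x * F n x)\<^sup>2 \<partial>lborel)) \<longlonglongrightarrow> 0"
    using tendsto_mult_right_zero by fastforce
  define c where "c = v * e / 2"
  have c: "c > 0" using v e by (simp add: c_def)
  obtain N where N: "\<And>n. n \<ge> N \<Longrightarrow> norm (M * (\<integral>x. (indicator \<Omega> x * F n x)\<^sup>2 \<partial>lborel) - 0) < c\<^sup>2"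
    using LIMSEQ_D[OF lim, of "c\<^sup>2"] c by auto
  have "norm ((\<integral>x. (u n x)\<^sup>2 \<partial>lborel) - 0) < e" if n: "n \<ge> N" for n
  proof -
    define X where "X = (\<integral>x. u n x * F n x \<partial>lborel)"
    \<comment> \<open>\<open>F n\<close> spreads beyond \<Omega>, but \<open>u n\<close> does not.
      Inserting the indicator gives access to the L^2 limit on \<Omega>.\<close>
    have eq: "u n x * F n x = u n x * (indicator \<Omega> x * F n x)" for x
      using test_fn_outside[OF u, of x n] by (auto simp: indicator_def)
    have "\<bar>X\<bar> \<le> (\<integral>x. \<bar>u n x * (indicator \<Omega> x * F n x)\<bar> \<partial>lborel)"
      unfolding X_def eq by (rule integral_abs_bound)
    then have "X\<^sup>2 \<le> (\<integral>x. \<bar>u n x * (indicator \<Omega> x * F n x)\<bar> \<partial>lborel)\<^sup>2"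
      by (metis abs_ge_zero power2_abs power_mono)
    also have "\<dots> \<le> (\<integral>x. (u n x)\<^sup>2 \<partial>lborel) * (\<integral>x. (indicator \<Omega> x * F n x)\<^sup>2 \<partial>lborel)"
      by (rule integral_Cauchy_Schwarz(2)) (use G_int test_fn_square_lborel[OF u] in auto)
    also have "\<dots> \<le> M * (\<integral>x. (indicator \<Omega> x * F n x)\<^sup>2 \<partial>lborel)"
      using M(1) by (intro mult_right_mono) auto
    also have "\<dots> < c\<^sup>2" using N[OF n] by simp
    finally have X: "X < c" using c by (meson abs_le_square_iff abs_of_pos le_less_trans not_le abs_ge_self power2_less_imp_less less_imp_le)
    have "v * (\<integral>x. (u n x)\<^sup>2 \<partial>lborel) \<le> X + v * (\<delta>\<^sup>2 / 2 * (\<integral>x. (norm (gr (u n) x))\<^sup>2 \<partial>lborel))"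
      using local_average_bound[OF uU[of n], of \<delta>] \<delta> by (simp add: X_def F_def v_def B_def)
    also have "\<dots> \<le> X + v * (\<delta>\<^sup>2 / 2 * M)"
      using v M(2)[of n] by (intro add_left_mono mult_left_mono) auto
    also have "\<dots> < v * e / 2 + v * (\<delta>\<^sup>2 / 2 * M)" using X by (simp add: c_def)
    also have "\<delta>\<^sup>2 / 2 * M \<le> e / 2" unfolding \<delta>(2) using e M0 by (simp add: field_simps)
    finally have "v * (\<integral>x. (u n x)\<^sup>2 \<partial>lborel) < v * e"
      using v by simp
    then have "(\<integral>x. (u n x)\<^sup>2 \<partial>lborel) < e" using v by simp
    then show ?thesis by simp
  qed
  then show "\<exists>N. \<forall>n\<ge>N. norm ((\<integral>x. (u n x)\<^sup>2 \<partial>lborel) - 0) < e" by blast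
qed

end

section \<open>The forms on vector-valued functions\<close>

lemma square_square: "(a\<^sup>2)\<^sup>2 = (a::real) ^ 4"
  unfolding power_mult[symmetric] by simp

lemma measurable_vecI:
  fixes f :: "'a \<Rightarrow> ('v::euclidean_space)^'m::finite"
  assumes "\<And>i. (\<lambda>x. f x $ i) \<in> borel_measurable M"
  shows "f \<in> borel_measurable M"
proof (subst borel_measurable_euclidean_space, intro ballI)
  fix b :: "'v^'m" assume "b \<in> Basis"
  then obtain i u where b: "b = axis i u" "u \<in> Basis" by (auto simp: Basis_vec_def)
  have "(\<lambda>x. f x $ i \<bullet> u) \<in> borel_measurable M" using assms by (intro borel_measurable_inner) auto
  then show "(\<lambda>x. f x \<bullet> b) \<in> borel_measurable M" by (simp add: b inner_axis)
qed

lemma measurable_vec_nth: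
  fixes f :: "'a \<Rightarrow> ('v::euclidean_space)^'m::finite"
  assumes "f \<in> borel_measurable M" shows "(\<lambda>x. f x $ i) \<in> borel_measurable M"
proof -
  have "(\<lambda>v :: 'v^'m. v $ i) \<in> borel_measurable borel"
    by (intro borel_measurable_continuous_onI continuous_intros)
  from measurable_compose[OF assms this] show ?thesis .
qed

lemma Lp_nth:
  fixes f :: "real^'n \<Rightarrow> ('v::euclidean_space)^'m::finite"
  assumes "Lp \<Omega> p f" shows "Lp \<Omega> p (\<lambda>x. f x $ i)" "pint \<Omega> p (\<lambda>x. f x $ i) \<le> pint \<Omega> p f"
  by (rule Lp_bound[OF assms measurable_vec_nth[OF Lp_measurable[OF assms]]],
      simp add: Finite_Cartesian_Product.norm_nth_le)+

lemma Lp_sum: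
  fixes f :: "'i \<Rightarrow> real^'n::finite \<Rightarrow> 'v::euclidean_space"
  assumes "finite A" "p > 0" "\<And>i. i \<in> A \<Longrightarrow> Lp \<Omega> p (f i)"
  shows "Lp \<Omega> p (\<lambda>x. \<Sum>i\<in>A. f i x)"
  using assms by (induction A rule: finite_induct) (auto simp: Lp_zero intro: Lp_add)

lemma Lp_norm: "Lp \<Omega> p u \<Longrightarrow> Lp \<Omega> p (\<lambda>x. norm (u x))"
  by (auto simp: Lp_def)

lemma Lp_vecI:
  fixes f :: "real^'n::finite \<Rightarrow> ('v::euclidean_space)^'m::finite"
  assumes "p > 0" "\<And>i. Lp \<Omega> p (\<lambda>x. f x $ i)"
  shows "Lp \<Omega> p f"
proof (rule Lp_bound)
  show "Lp \<Omega> p (\<lambda>x. \<Sum>i\<in>UNIV. norm (f x $ i))"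
    using assms by (intro Lp_sum Lp_norm) auto
  show "f \<in> borel_measurable (lebesgue_on \<Omega>)" using assms by (intro measurable_vecI Lp_measurable)
  have "norm (f x) \<le> norm (\<Sum>i\<in>UNIV. norm (f x $ i))" for x
  proof -
    have "norm (f x) \<le> (\<Sum>i\<in>UNIV. norm (f x $ i))"
      unfolding norm_vec_def by (rule L2_set_le_sum) auto
    then show ?thesis by simp
  qed
  then show "AE x in lebesgue_on \<Omega>. norm (f x) \<le> norm (\<Sum>i\<in>UNIV. norm (f x $ i))" by simp
qed

lemma pint_2_vec:
  fixes f :: "real^'n::finite \<Rightarrow> ('v::euclidean_space)^'m::finite"
  assumes "\<And>i. Lp \<Omega> 2 (\<lambda>x. f x $ i)"
  shows "pint \<Omega> 2 f = (\<Sum>i\<in>UNIV. pint \<Omega> 2 (\<lambda>x. f x $ i))"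
proof -
  have "(norm (f x))\<^sup>2 = (\<Sum>i\<in>UNIV. (norm (f x $ i))\<^sup>2)" for x
    unfolding norm_vec_def L2_set_def by (rule real_sqrt_pow2) (auto intro: sum_nonneg)
  then show ?thesis
    using assms unfolding pint_def by (simp add: Lp_def Bochner_Integration.integral_sum)
qed

locale hform = bounded_open \<Omega> for \<Omega> :: "(real^'n::finite) set" +
  fixes h :: "real^'n^'k \<Rightarrow> real^'n^'k \<Rightarrow> real^'n^'n^'k::finite"
  assumes bil: "bilinear h" and B_cont: "B_continuous \<Omega> h" and B_anti: "B_antisym \<Omega> h"
begin

text \<open>\<open>AF\<close> and \<open>BF\<close> are working copies of \<open>Aform\<close> and
  \<open>Bform\<close> in which the components are packed into a single vector-valued
  function.\<close>

definition AF :: "(real^'n \<Rightarrow> 'v::euclidean_space) \<Rightarrow> (real^'n \<Rightarrow> 'v) \<Rightarrow> real" where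
  "AF P Q = (LINT x|lebesgue_on \<Omega>. P x \<bullet> Q x)"

definition BF :: "(real^'n \<Rightarrow> real^'n^'n^'k) \<Rightarrow> (real^'n \<Rightarrow> real^'n^'k) \<Rightarrow> (real^'n \<Rightarrow> real^'n^'k) \<Rightarrow> real" where
  "BF P T X = (LINT x|lebesgue_on \<Omega>. P x \<bullet> h (T x) (X x))"

text \<open>Non-integrable functions have integral 0, so \<open>BF\<close> is linear only where the
  pieces are integrable. This predicate carries that side condition.\<close>

definition BI :: "(real^'n \<Rightarrow> real^'n^'n^'k) \<Rightarrow> (real^'n \<Rightarrow> real^'n^'k) \<Rightarrow> (real^'n \<Rightarrow> real^'n^'k) \<Rightarrow> bool" where
  "BI P T X \<longleftrightarrow> integrable (lebesgue_on \<Omega>) (\<lambda>x. P x \<bullet> h (T x) (X x))"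

lemma inner_integral_bound:
  fixes P :: "real^'n \<Rightarrow> 'v::euclidean_space" and Q :: "real^'n \<Rightarrow> 'w::euclidean_space"
  assumes "Lp \<Omega> 2 P" "Lp \<Omega> 2 Q"
  shows "integrable (lebesgue_on \<Omega>) (\<lambda>x. norm (P x) * norm (Q x))"
    and "(LINT x|lebesgue_on \<Omega>. norm (P x) * norm (Q x))\<^sup>2 \<le> pint \<Omega> 2 P * pint \<Omega> 2 Q"
  using integral_Cauchy_Schwarz[of "\<lambda>x. norm (P x)" "lebesgue_on \<Omega>" "\<lambda>x. norm (Q x)"] assms
  by (auto simp: Lp_def pint_def)

lemma AF_integrable:
  fixes P Q :: "real^'n \<Rightarrow> 'v::euclidean_space"
  assumes "Lp \<Omega> 2 P" "Lp \<Omega> 2 Q"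
  shows "integrable (lebesgue_on \<Omega>) (\<lambda>x. P x \<bullet> Q x)"
  by (rule Bochner_Integration.integrable_bound[OF inner_integral_bound(1)[OF assms]])
     (use assms Cauchy_Schwarz_ineq2 in \<open>auto simp: Lp_def\<close>)

lemma AF_bound:
  assumes "Lp \<Omega> 2 P" "Lp \<Omega> 2 Q"
  shows "(AF P Q)\<^sup>2 \<le> pint \<Omega> 2 P * pint \<Omega> 2 Q"
proof -
  have "\<bar>AF P Q\<bar> \<le> (LINT x|lebesgue_on \<Omega>. \<bar>P x \<bullet> Q x\<bar>)" unfolding AF_def by (rule integral_abs_bound)
  also have "\<dots> \<le> (LINT x|lebesgue_on \<Omega>. norm (P x) * norm (Q x))"
    using AF_integrable[OF assms] inner_integral_bound(1)[OF assms] Cauchy_Schwarz_ineq2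
    by (intro integral_mono) auto
  finally have "\<bar>AF P Q\<bar> \<le> (LINT x|lebesgue_on \<Omega>. norm (P x) * norm (Q x))" .
  from power_mono[OF this abs_ge_zero, of 2]
  have "(AF P Q)\<^sup>2 \<le> (LINT x|lebesgue_on \<Omega>. norm (P x) * norm (Q x))\<^sup>2" by (simp only: power2_abs)
  also note inner_integral_bound(2)[OF assms]
  finally show ?thesis .
qed

lemma AF_commute: "AF P Q = AF Q P"
  by (simp add: AF_def inner_commute)

lemma AF_self: "AF P P = pint \<Omega> 2 P"
  by (simp add: AF_def pint_def power2_norm_eq_inner)

lemma AF_combo:
  assumes "Lp \<Omega> 2 P" "Lp \<Omega> 2 P'" "Lp \<Omega> 2 Q"
  shows "AF (\<lambda>x. a *\<^sub>R P x + b *\<^sub>R P' x) Q = a * AF P Q + b * AF P' Q"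
  unfolding AF_def using AF_integrable[OF assms(1,3)] AF_integrable[OF assms(2,3)] by (simp add: inner_add_left)

lemma h_bounded: "\<exists>K>0. \<forall>t x. norm (h t x) \<le> K * norm t * norm x"
  using bilinear_bounded_pos[OF bil] by blast

lemma h_bounded_bilinear: "bounded_bilinear h"
  using bil bilinear_conv_bounded_bilinear by blast

lemma h_measurable:
  assumes "T \<in> borel_measurable M" "X \<in> borel_measurable M"
  shows "(\<lambda>x. h (T x) (X x)) \<in> borel_measurable M"
proof (rule borel_measurable_continuous_Pair[OF assms])
  show "continuous_on UNIV (\<lambda>x. h (fst x) (snd x))"
    by (intro bounded_bilinear.continuous_on[OF h_bounded_bilinear] continuous_intros)
qed

lemma h_bound_integrand:
  assumes "\<And>t x. norm (h t x) \<le> K * norm t * norm x"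
  shows "\<bar>p \<bullet> h t x\<bar> \<le> norm p * (K * norm t * norm x)"
  using Cauchy_Schwarz_ineq2[of p "h t x"] mult_left_mono[OF assms[of t x] norm_ge_zero[of p]] by linarith

lemma BI_of_bound:
  assumes "P \<in> borel_measurable (lebesgue_on \<Omega>)" "T \<in> borel_measurable (lebesgue_on \<Omega>)" "X \<in> borel_measurable (lebesgue_on \<Omega>)"
    and "integrable (lebesgue_on \<Omega>) g" "\<And>x. norm (P x) * norm (T x) * norm (X x) \<le> g x"
  shows "BI P T X"
proof -
  obtain K where K: "K > 0" "\<And>t x. norm (h t x) \<le> K * norm t * norm x" using h_bounded by blast
  show ?thesis unfolding BI_def
  proof (rule Bochner_Integration.integrable_bound)
    show "integrable (lebesgue_on \<Omega>) (\<lambda>x. K * g x)" using assms(4) by simp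
    show "(\<lambda>x. P x \<bullet> h (T x) (X x)) \<in> borel_measurable (lebesgue_on \<Omega>)"
      by (intro borel_measurable_inner h_measurable assms)
    have "norm (P x \<bullet> h (T x) (X x)) \<le> norm (K * g x)" for x
    proof -
      have "\<bar>P x \<bullet> h (T x) (X x)\<bar> \<le> K * (norm (P x) * norm (T x) * norm (X x))"
        using h_bound_integrand[OF K(2), of "P x" "T x" "X x"] by (simp add: mult_ac)
      also have "\<dots> \<le> K * g x" using K assms(5) by (intro mult_left_mono) auto
      finally show ?thesis by simp
    qed
    then show "AE x in lebesgue_on \<Omega>. norm (P x \<bullet> h (T x) (X x)) \<le> norm (K * g x)" by simp
  qed
qed

text \<open>Two applications of \<open>a * b \<le> a\<^sup>2 + b\<^sup>2\<close> dominate the triple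
  product by integrable powers.\<close>

lemma BI_244:
  assumes "Lp \<Omega> 2 P" "Lp \<Omega> 4 T" "Lp \<Omega> 4 X" shows "BI P T X"
proof (rule BI_of_bound)
  show "integrable (lebesgue_on \<Omega>) (\<lambda>x. norm (P x) ^ 2 + (norm (T x) ^ 4 + norm (X x) ^ 4))"
    using assms by (auto simp: Lp_def)
  have amgm: "a * b \<le> a\<^sup>2 + b\<^sup>2" for a b :: real
  proof -
    have "(a - b)\<^sup>2 = a\<^sup>2 + b\<^sup>2 - 2 * (a * b)" by (simp add: power2_eq_square algebra_simps)
    then show ?thesis using zero_le_power2[of "a - b"] zero_le_power2[of a] zero_le_power2[of b] by linarith
  qed
  fix x
  have "norm (P x) * norm (T x) * norm (X x) \<le> norm (P x) ^ 2 + (norm (T x) * norm (X x))\<^sup>2"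
    using amgm[of "norm (P x)" "norm (T x) * norm (X x)"] by (simp add: mult_ac)
  also have "(norm (T x) * norm (X x))\<^sup>2 \<le> norm (T x) ^ 4 + norm (X x) ^ 4"
    using amgm[of "(norm (T x))\<^sup>2" "(norm (X x))\<^sup>2"] by (simp only: power_mult_distrib square_square)
  finally show "norm (P x) * norm (T x) * norm (X x) \<le> norm (P x) ^ 2 + (norm (T x) ^ 4 + norm (X x) ^ 4)" by simp
qed (use assms in \<open>auto intro: Lp_measurable\<close>)

text \<open>\<open>B_continuous\<close> asks for L^4 norms of both gradient arguments. If one of
  them is bounded, the pointwise bound on \<open>h\<close> lets the L^2 norm of the other suffice;
  this is what makes L^2 convergence of gradients usable.\<close>

lemma BI_22b:
  assumes "Lp \<Omega> 2 P" "Lp \<Omega> 2 T" "X \<in> borel_measurable (lebesgue_on \<Omega>)" "\<And>x. norm (X x) \<le> B"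
  shows "BI P T X" "BI P X T"
    and "\<exists>C\<ge>0. \<forall>P T. Lp \<Omega> 2 P \<longrightarrow> Lp \<Omega> 2 T \<longrightarrow>
      (BF P T X)\<^sup>2 \<le> C * (pint \<Omega> 2 P * pint \<Omega> 2 T) \<and> (BF P X T)\<^sup>2 \<le> C * (pint \<Omega> 2 P * pint \<Omega> 2 T)"
proof -
  have I: "BI P T X" "BI P X T" if PT: "Lp \<Omega> 2 P" "Lp \<Omega> 2 T" for P T
  proof -
    have i: "integrable (lebesgue_on \<Omega>) (\<lambda>x. B * (norm (P x) * norm (T x)))"
      using inner_integral_bound(1)[OF PT] by simp
    have le: "norm (P x) * norm (T x) * norm (X x) \<le> B * (norm (P x) * norm (T x))" for x
      using mult_left_mono[OF assms(4)[of x], of "norm (P x) * norm (T x)"] by (simp add: mult.commute[of B])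
    show "BI P T X"
      by (rule BI_of_bound[OF Lp_measurable[OF PT(1)] Lp_measurable[OF PT(2)] assms(3) i le])
    have le': "norm (P x) * norm (X x) * norm (T x) \<le> B * (norm (P x) * norm (T x))" for x
      using le[of x] by (simp only: mult_ac)
    show "BI P X T"
      by (rule BI_of_bound[OF Lp_measurable[OF PT(1)] assms(3) Lp_measurable[OF PT(2)] i le'])
  qed
  show "BI P T X" "BI P X T" by (rule I[OF assms(1,2)])+
  obtain K where K: "K > 0" "\<And>t x. norm (h t x) \<le> K * norm t * norm x" using h_bounded by blast
  have gen: "(LINT x|lebesgue_on \<Omega>. f x)\<^sup>2 \<le> (K * B)\<^sup>2 * (pint \<Omega> 2 P * pint \<Omega> 2 T)"
    if PT: "Lp \<Omega> 2 P" "Lp \<Omega> 2 T" and f: "integrable (lebesgue_on \<Omega>) f" "\<And>x. \<bar>f x\<bar> \<le> K * B * (norm (P x) * norm (T x))"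
    for f and P :: "real^'n \<Rightarrow> real^'n^'n^'k" and T :: "real^'n \<Rightarrow> real^'n^'k"
  proof -
    have "\<bar>LINT x|lebesgue_on \<Omega>. f x\<bar> \<le> (LINT x|lebesgue_on \<Omega>. \<bar>f x\<bar>)" by (rule integral_abs_bound)
    also have "\<dots> \<le> (LINT x|lebesgue_on \<Omega>. K * B * (norm (P x) * norm (T x)))"
      using f inner_integral_bound(1)[OF PT] by (intro integral_mono) auto
    also have "\<dots> = K * B * (LINT x|lebesgue_on \<Omega>. norm (P x) * norm (T x))" by simp
    finally have "\<bar>LINT x|lebesgue_on \<Omega>. f x\<bar> \<le> K * B * (LINT x|lebesgue_on \<Omega>. norm (P x) * norm (T x))" .
    from power_mono[OF this abs_ge_zero, of 2]
    have "(LINT x|lebesgue_on \<Omega>. f x)\<^sup>2 \<le> (K * B * (LINT x|lebesgue_on \<Omega>. norm (P x) * norm (T x)))\<^sup>2"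
      by (simp only: power2_abs)
    also have "\<dots> \<le> (K * B)\<^sup>2 * (pint \<Omega> 2 P * pint \<Omega> 2 T)"
      unfolding power_mult_distrib[of "K * B"] by (intro mult_left_mono inner_integral_bound(2) PT) auto
    finally show ?thesis .
  qed
  have ptw: "\<bar>p \<bullet> h t (X x)\<bar> \<le> K * B * (norm p * norm t)" "\<bar>p \<bullet> h (X x) t\<bar> \<le> K * B * (norm p * norm t)" for p t x
  proof -
    have le: "(K * norm p * norm t) * norm (X x) \<le> (K * norm p * norm t) * B"
      using assms(4)[of x] K by (intro mult_left_mono) auto
    show "\<bar>p \<bullet> h t (X x)\<bar> \<le> K * B * (norm p * norm t)"
      using h_bound_integrand[OF K(2), of p t "X x"] le by (simp only: mult_ac)
    show "\<bar>p \<bullet> h (X x) t\<bar> \<le> K * B * (norm p * norm t)"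
      using h_bound_integrand[OF K(2), of p "X x" t] le by (simp only: mult_ac)
  qed
  show "\<exists>C\<ge>0. \<forall>P T. Lp \<Omega> 2 P \<longrightarrow> Lp \<Omega> 2 T \<longrightarrow>
      (BF P T X)\<^sup>2 \<le> C * (pint \<Omega> 2 P * pint \<Omega> 2 T) \<and> (BF P X T)\<^sup>2 \<le> C * (pint \<Omega> 2 P * pint \<Omega> 2 T)"
  proof (intro exI[of _ "(K * B)\<^sup>2"] conjI allI impI)
    fix P :: "real^'n \<Rightarrow> real^'n^'n^'k" and T :: "real^'n \<Rightarrow> real^'n^'k"
    assume PT: "Lp \<Omega> 2 P" "Lp \<Omega> 2 T"
    show "(BF P T X)\<^sup>2 \<le> (K * B)\<^sup>2 * (pint \<Omega> 2 P * pint \<Omega> 2 T)"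
      unfolding BF_def by (rule gen[OF PT I(1)[OF PT, unfolded BI_def] ptw(1)])
    show "(BF P X T)\<^sup>2 \<le> (K * B)\<^sup>2 * (pint \<Omega> 2 P * pint \<Omega> 2 T)"
      unfolding BF_def by (rule gen[OF PT I(2)[OF PT, unfolded BI_def] ptw(2)])
  qed simp
qed

lemma BF_combo1:
  assumes "BI P T X" "BI P' T X"
  shows "BF (\<lambda>x. a *\<^sub>R P x + b *\<^sub>R P' x) T X = a * BF P T X + b * BF P' T X"
  using assms unfolding BF_def BI_def by (simp add: inner_add_left)

lemma BF_combo2:
  assumes "BI P T X" "BI P T' X"
  shows "BF P (\<lambda>x. a *\<^sub>R T x + b *\<^sub>R T' x) X = a * BF P T X + b * BF P T' X"
  using assms unfolding BF_def BI_def
  by (simp add: inner_add_right bilinear_ladd[OF bil] bilinear_lmul[OF bil])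

lemma BF_combo3:
  assumes "BI P T X" "BI P T X'"
  shows "BF P T (\<lambda>x. a *\<^sub>R X x + b *\<^sub>R X' x) = a * BF P T X + b * BF P T X'"
  using assms unfolding BF_def BI_def
  by (simp add: inner_add_right bilinear_radd[OF bil] bilinear_rmul[OF bil])

lemma Bform_eq_BF: "Bform \<Omega> h P T X = BF (\<lambda>x. \<chi> c. P c x) (\<lambda>x. \<chi> c. T c x) (\<lambda>x. \<chi> c. X c x)"
  by (simp add: Bform_def BF_def inner_vec_def)

lemma Aform_eq_AF: "Aform \<Omega> P Q = AF (\<lambda>x. \<chi> c. P c x) (\<lambda>x. \<chi> c. Q c x)"
  by (simp add: Aform_def AF_def inner_vec_def)

lemma lpnormk_pow: "p > 0 \<Longrightarrow> lpnormk \<Omega> p U ^ p = (\<Sum>c\<in>UNIV. pint \<Omega> p (U c))"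
  for U :: "'k \<Rightarrow> real^'n \<Rightarrow> 'v::real_normed_vector"
proof -
  assume p: "p > 0"
  have nn: "(\<Sum>c\<in>UNIV. pint \<Omega> p (U c)) \<ge> 0" by (intro sum_nonneg) simp
  show ?thesis unfolding lpnormk_def lpnorm_pow[OF p]
    using p nn by (cases "(\<Sum>c\<in>UNIV. pint \<Omega> p (U c)) = 0") (auto simp: powr_powr simp flip: powr_realpow)
qed

text \<open>Raised to the fourth power so that integrals replace all norms. Each component is
  bounded by the whole, which costs a factor \<open>k\<close> twice in the squared Hessian term and
  once in each gradient term, hence \<open>k ^ 4\<close>.\<close>

lemma BF_bound_244:
  "\<exists>C\<ge>0. \<forall>P T X. Lp \<Omega> 2 P \<longrightarrow> Lp \<Omega> 4 T \<longrightarrow> Lp \<Omega> 4 X \<longrightarrow>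
     BF P T X ^ 4 \<le> C * ((pint \<Omega> 2 P)\<^sup>2 * pint \<Omega> 4 T * pint \<Omega> 4 X)"
proof -
  obtain C where C: "\<And>P T X. (\<forall>c. Lp \<Omega> 2 (P c)) \<and> (\<forall>c. Lp \<Omega> 4 (T c)) \<and> (\<forall>c. Lp \<Omega> 4 (X c)) \<Longrightarrow>
      \<bar>Bform \<Omega> h P T X\<bar> \<le> C * lpnormk \<Omega> 2 P * lpnormk \<Omega> 4 T * lpnormk \<Omega> 4 X"
    using B_cont unfolding B_continuous_def by blast
  define k where "k = real CARD('k)"
  show ?thesis
  proof (intro exI[of _ "C ^ 4 * k ^ 4"] conjI allI impI)
    fix P :: "real^'n \<Rightarrow> real^'n^'n^'k" and T X :: "real^'n \<Rightarrow> real^'n^'k"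
    assume L: "Lp \<Omega> 2 P" "Lp \<Omega> 4 T" "Lp \<Omega> 4 X"
    have lk: "lpnormk \<Omega> p (\<lambda>c x. U x $ c) ^ p \<le> k * pint \<Omega> p U"
      if "p > 0" "Lp \<Omega> p U" for p and U :: "real^'n \<Rightarrow> 'v::euclidean_space^'k"
      unfolding lpnormk_pow[OF that(1)] k_def using sum_bounded_above[of UNIV "\<lambda>c. pint \<Omega> p (\<lambda>x. U x $ c)" "pint \<Omega> p U"] Lp_nth(2)[OF that(2)]
      by simp
    have lk0: "lpnormk \<Omega> p U \<ge> 0" for p and U :: "'k \<Rightarrow> real^'n \<Rightarrow> 'v::euclidean_space"
      by (simp add: lpnormk_def)
    let ?p = "lpnormk \<Omega> 2 (\<lambda>c x. P x $ c)" and ?t = "lpnormk \<Omega> 4 (\<lambda>c x. T x $ c)" and ?x = "lpnormk \<Omega> 4 (\<lambda>c x. X x $ c)"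
    have "BF P T X = Bform \<Omega> h (\<lambda>c x. P x $ c) (\<lambda>c x. T x $ c) (\<lambda>c x. X x $ c)"
      by (simp add: Bform_eq_BF)
    moreover have "(\<forall>c. Lp \<Omega> 2 (\<lambda>x. P x $ c)) \<and> (\<forall>c. Lp \<Omega> 4 (\<lambda>x. T x $ c)) \<and> (\<forall>c. Lp \<Omega> 4 (\<lambda>x. X x $ c))"
      by (intro conjI allI Lp_nth(1) L)
    ultimately have "\<bar>BF P T X\<bar> \<le> C * ?p * ?t * ?x" using C by (simp only:)
    then have "\<bar>BF P T X\<bar> ^ 4 \<le> (C * ?p * ?t * ?x) ^ 4" by (intro power_mono) auto
    then have "BF P T X ^ 4 \<le> C ^ 4 * ((?p ^ 2) ^ 2 * ?t ^ 4 * ?x ^ 4)"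
      by (simp only: power_mult_distrib square_square power_even_abs_numeral even_numeral mult.assoc)
    also have "\<dots> \<le> C ^ 4 * ((k * pint \<Omega> 2 P) ^ 2 * (k * pint \<Omega> 4 T) * (k * pint \<Omega> 4 X))"
      using lk[OF _ L(1)] lk[OF _ L(2)] lk[OF _ L(3)]
      by (intro mult_left_mono mult_mono power_mono mult_nonneg_nonneg) (auto simp: k_def lk0)
    also have "\<dots> = C ^ 4 * k ^ 4 * ((pint \<Omega> 2 P)\<^sup>2 * pint \<Omega> 4 T * pint \<Omega> 4 X)"
      by (simp add: power_mult_distrib power4_eq_xxxx power2_eq_square mult_ac)
    finally show "BF P T X ^ 4 \<le> C ^ 4 * k ^ 4 * ((pint \<Omega> 2 P)\<^sup>2 * pint \<Omega> 4 T * pint \<Omega> 4 X)" .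
  qed (simp add: k_def)
qed

lemma BF_diagonal:
  assumes "Lp \<Omega> 2 P" "Lp \<Omega> 4 T" shows "BF P T T = 0"
proof -
  have "BF P T T = Bform \<Omega> h (\<lambda>c x. P x $ c) (\<lambda>c x. T x $ c) (\<lambda>c x. T x $ c)" by (simp add: Bform_eq_BF)
  moreover have "(\<forall>c. Lp \<Omega> 2 (\<lambda>x. P x $ c)) \<and> (\<forall>c. Lp \<Omega> 4 (\<lambda>x. T x $ c))"
    by (intro conjI allI Lp_nth(1) assms)
  ultimately show ?thesis using B_anti unfolding B_antisym_def by simp
qed

end

section \<open>Approximation by test functions\<close>

text \<open>The index order is that of \<open>Dl (rev [i, j]) f\<close>, the form in which the weak
  derivative of a test function comes out, so that no symmetry of second derivatives has to be
  invoked.\<close>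

definition hs :: "(real^'n::finite \<Rightarrow> real) \<Rightarrow> real^'n \<Rightarrow> real^'n^'n" where
  "hs f x = (\<chi> i j. pd j (pd i f) x)"

text \<open>Fatou's lemma with bounds \<open>b m\<close> that may vary; only their limit enters. In
  this way an L^4 bound reaches weak gradients, which are at first known to lie in L^2 only.\<close>

lemma Lp_fatou:
  fixes f :: "nat \<Rightarrow> real^'n::finite \<Rightarrow> 'v::euclidean_space"
  assumes f: "\<And>m. Lp \<Omega> p (f m)" "\<And>m. pint \<Omega> p (f m) \<le> b m" and b: "b \<longlonglongrightarrow> B"
    and g: "g \<in> borel_measurable (lebesgue_on \<Omega>)" "AE x in lebesgue_on \<Omega>. (\<lambda>m. f m x) \<longlonglongrightarrow> g x"
  shows "Lp \<Omega> p g" "pint \<Omega> p g \<le> B"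
proof -
  have fm: "f m \<in> borel_measurable (lebesgue_on \<Omega>)" for m using f(1) by (rule Lp_measurable)
  have fi: "integrable (lebesgue_on \<Omega>) (\<lambda>x. norm (f m x) ^ p)" for m using f(1) by (simp add: Lp_def)
  have eq: "AE x in lebesgue_on \<Omega>. ennreal (norm (g x) ^ p) = liminf (\<lambda>m. ennreal (norm (f m x) ^ p))"
    using g(2)
  proof eventually_elim
    case (elim x)
    have "(\<lambda>m. ennreal (norm (f m x) ^ p)) \<longlonglongrightarrow> ennreal (norm (g x) ^ p)"
      by (intro tendsto_ennrealI tendsto_power tendsto_norm elim)
    from lim_imp_Liminf[OF sequentially_bot this] show ?case by (rule sym)
  qed
  have "(\<integral>\<^sup>+x. ennreal (norm (g x) ^ p) \<partial>lebesgue_on \<Omega>) = (\<integral>\<^sup>+x. liminf (\<lambda>m. ennreal (norm (f m x) ^ p)) \<partial>lebesgue_on \<Omega>)"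
    by (rule nn_integral_cong_AE[OF eq])
  also have "\<dots> \<le> liminf (\<lambda>m. \<integral>\<^sup>+x. ennreal (norm (f m x) ^ p) \<partial>lebesgue_on \<Omega>)"
    by (rule nn_integral_liminf) (use fm in measurable)
  also have "\<dots> \<le> liminf (\<lambda>m. ennreal (b m))"
  proof (rule Liminf_mono, rule always_eventually, rule allI)
    fix m
    have "(\<integral>\<^sup>+x. ennreal (norm (f m x) ^ p) \<partial>lebesgue_on \<Omega>) = ennreal (pint \<Omega> p (f m))"
      unfolding pint_def by (rule nn_integral_eq_integral[OF fi]) simp
    then show "(\<integral>\<^sup>+x. ennreal (norm (f m x) ^ p) \<partial>lebesgue_on \<Omega>) \<le> ennreal (b m)"
      using f(2) by (simp add: ennreal_leI)
  qed
  also have "\<dots> = ennreal B" using b by (intro lim_imp_Liminf tendsto_ennrealI) auto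
  finally have le: "(\<integral>\<^sup>+x. ennreal (norm (g x) ^ p) \<partial>lebesgue_on \<Omega>) \<le> ennreal B" .
  have gi: "integrable (lebesgue_on \<Omega>) (\<lambda>x. norm (g x) ^ p)"
  proof (rule integrableI_bounded)
    show "(\<lambda>x. norm (g x) ^ p) \<in> borel_measurable (lebesgue_on \<Omega>)" using g(1) by measurable
    show "(\<integral>\<^sup>+x. ennreal (norm (norm (g x) ^ p)) \<partial>lebesgue_on \<Omega>) < \<infinity>"
      using order.strict_trans1[OF le ennreal_less_top] by simp
  qed
  then show "Lp \<Omega> p g" using g(1) by (simp add: Lp_def)
  have B0: "B \<ge> 0"
    by (rule LIMSEQ_le_const[OF b]) (use f(2) pint_nonneg order_trans in blast)
  have "(\<integral>\<^sup>+x. ennreal (norm (g x) ^ p) \<partial>lebesgue_on \<Omega>) = ennreal (pint \<Omega> p g)"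
    unfolding pint_def by (rule nn_integral_eq_integral[OF gi]) simp
  then show "pint \<Omega> p g \<le> B" using le B0 by simp
qed

context bounded_open
begin

lemma Lp_gr: "test_fn \<Omega> f \<Longrightarrow> p > 0 \<Longrightarrow> Lp \<Omega> p (gr f)"
  by (intro Lp_vecI) (auto intro: Lp_test_fn test_fn_pd)

lemma Lp_hs: "test_fn \<Omega> f \<Longrightarrow> p > 0 \<Longrightarrow> Lp \<Omega> p (hs f)"
  by (intro Lp_vecI) (auto simp: hs_def intro: Lp_test_fn test_fn_pd)

lemma Lp_wgrad: "Hm \<Omega> 2 u \<Longrightarrow> Lp \<Omega> 2 (wgrad \<Omega> u)"
  by (intro Lp_vecI) (auto simp: wgrad_def intro: Hm_wd)

lemma Lp_whess: "Hm \<Omega> 2 u \<Longrightarrow> Lp \<Omega> 2 (whess \<Omega> u)"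
  by (intro Lp_vecI) (auto simp: whess_def intro: Hm_wd)

lemma wd_diff_test_fn:
  assumes u: "Hm \<Omega> m u" and f: "test_fn \<Omega> f" and len: "length is \<le> m" "length is \<le> 2"
  shows "Lp \<Omega> 2 (\<lambda>x. wd \<Omega> is u x - Dl (rev is) f x)"
    and "pint \<Omega> 2 (\<lambda>x. wd \<Omega> is u x - Dl (rev is) f x) \<le> (hnorm \<Omega> m (\<lambda>x. u x - f x))\<^sup>2"
proof -
  note Hf = Hm_test_fn[OF f, of m]
  have L: "Lp \<Omega> 2 (wd \<Omega> is u)" "Lp \<Omega> 2 (Dl (rev is) f)"
    using Hm_wd(1)[OF u len(1)] Lp_test_fn[OF test_fn_Dl[OF f]] by auto
  show 1: "Lp \<Omega> 2 (\<lambda>x. wd \<Omega> is u x - Dl (rev is) f x)" by (rule Lp_diff(1)[OF L])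
  have H: "Hm \<Omega> m (\<lambda>x. u x - f x)" using Hm_combo[OF u Hf, of 1 "-1"] by simp
  have "AE x in lebesgue_on \<Omega>. wd \<Omega> is (\<lambda>x. u x - f x) x = wd \<Omega> is u x - Dl (rev is) f x"
    using wd_combo[OF u Hf len(1), of 1 "-1"] wd_test_fn[OF f, of "is"] by eventually_elim simp
  then have "pint \<Omega> 2 (wd \<Omega> is (\<lambda>x. u x - f x)) = pint \<Omega> 2 (\<lambda>x. wd \<Omega> is u x - Dl (rev is) f x)"
    by (intro pint_cong_AE Lp_measurable[OF 1] Lp_measurable[OF Hm_wd(1)[OF H len(1)]])
  then show "pint \<Omega> 2 (\<lambda>x. wd \<Omega> is u x - Dl (rev is) f x) \<le> (hnorm \<Omega> m (\<lambda>x. u x - f x))\<^sup>2"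
    using pint_wd_le_hnorm[OF H len] by simp
qed

lemma pint_diff_test_fn:
  assumes u: "Hm \<Omega> 2 u" and f: "test_fn \<Omega> f"
  shows "pint \<Omega> 2 (\<lambda>x. wgrad \<Omega> u x - gr f x) \<le> real CARD('n) * (hnorm \<Omega> 2 (\<lambda>x. u x - f x))\<^sup>2"
    and "pint \<Omega> 2 (\<lambda>x. whess \<Omega> u x - hs f x) \<le> (real CARD('n))\<^sup>2 * (hnorm \<Omega> 2 (\<lambda>x. u x - f x))\<^sup>2"
proof -
  let ?e = "(hnorm \<Omega> 2 (\<lambda>x. u x - f x))\<^sup>2"
  have g: "(wgrad \<Omega> u x - gr f x) $ i = wd \<Omega> [i] u x - Dl (rev [i]) f x" for x i
    by (simp add: wgrad_def)
  have "pint \<Omega> 2 (\<lambda>x. wgrad \<Omega> u x - gr f x) = (\<Sum>i\<in>UNIV. pint \<Omega> 2 (\<lambda>x. wd \<Omega> [i] u x - Dl (rev [i]) f x))"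
    unfolding g[symmetric]
  proof (rule pint_2_vec)
    show "Lp \<Omega> 2 (\<lambda>x. (wgrad \<Omega> u x - gr f x) $ i)" for i
      unfolding g by (rule wd_diff_test_fn(1)[OF u f]) auto
  qed
  also have "\<dots> \<le> (\<Sum>i\<in>(UNIV::'n set). ?e)"
    by (intro sum_mono wd_diff_test_fn(2)[OF u f]) auto
  finally show "pint \<Omega> 2 (\<lambda>x. wgrad \<Omega> u x - gr f x) \<le> real CARD('n) * ?e" by simp
  have h: "(whess \<Omega> u x - hs f x) $ i $ j = wd \<Omega> [i, j] u x - Dl (rev [i, j]) f x" for x i j
    by (simp add: whess_def hs_def)
  have L: "Lp \<Omega> 2 (\<lambda>x. (whess \<Omega> u x - hs f x) $ i $ j)" for i j
    unfolding h using wd_diff_test_fn(1)[OF u f, of "[i, j]"] by simp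
  have L': "Lp \<Omega> 2 (\<lambda>x. (whess \<Omega> u x - hs f x) $ i)" for i
    by (rule Lp_vecI) (use L in auto)
  have "pint \<Omega> 2 (\<lambda>x. whess \<Omega> u x - hs f x) = (\<Sum>i\<in>UNIV. \<Sum>j\<in>UNIV. pint \<Omega> 2 (\<lambda>x. (whess \<Omega> u x - hs f x) $ i $ j))"
    by (simp only: pint_2_vec[of \<Omega> "\<lambda>x. whess \<Omega> u x - hs f x", OF L'] pint_2_vec[OF L])
  also have "\<dots> \<le> (\<Sum>i\<in>(UNIV::'n set). \<Sum>j\<in>(UNIV::'n set). ?e)"
    unfolding h by (intro sum_mono wd_diff_test_fn(2)[OF u f]) auto
  finally show "pint \<Omega> 2 (\<lambda>x. whess \<Omega> u x - hs f x) \<le> (real CARD('n))\<^sup>2 * ?e"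
    by (simp add: power2_eq_square)
qed

lemma AE_wgrad_test_fn: "test_fn \<Omega> f \<Longrightarrow> AE x in lebesgue_on \<Omega>. wgrad \<Omega> f x = gr f x"
proof -
  assume f: "test_fn \<Omega> f"
  have "AE x in lebesgue_on \<Omega>. \<forall>i\<in>UNIV. wd \<Omega> [i] f x = pd i f x"
  proof (intro AE_finite_allI)
    show "AE x in lebesgue_on \<Omega>. wd \<Omega> [i] f x = pd i f x" for i
      using wd_test_fn[OF f, of "[i]"] by simp
  qed auto
  then show ?thesis by eventually_elim (simp add: wgrad_def vec_eq_iff)
qed

lemma AE_whess_test_fn: "test_fn \<Omega> f \<Longrightarrow> AE x in lebesgue_on \<Omega>. whess \<Omega> f x = hs f x"
proof -
  assume f: "test_fn \<Omega> f"
  have "AE x in lebesgue_on \<Omega>. \<forall>ij\<in>UNIV. wd \<Omega> [fst ij, snd ij] f x = pd (snd ij) (pd (fst ij) f) x"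
  proof (intro AE_finite_allI)
    show "AE x in lebesgue_on \<Omega>. wd \<Omega> [fst ij, snd ij] f x = pd (snd ij) (pd (fst ij) f) x" for ij
      using wd_test_fn[OF f, of "[fst ij, snd ij]"] by simp
  qed auto
  then show ?thesis by eventually_elim (auto simp: whess_def hs_def vec_eq_iff)
qed

end

section \<open>Classical and weak derivatives of families, and density\<close>

context hform
begin

text \<open>Two parallel sets of derivatives: \<open>GR\<close> and \<open>HS\<close> are classical
  and exactly linear on test families, while \<open>WG\<close> and \<open>WH\<close> rest on the
  choice in \<open>wd\<close> and agree with them almost everywhere only.\<close>

definition GR :: "('k \<Rightarrow> real^'n \<Rightarrow> real) \<Rightarrow> real^'n \<Rightarrow> real^'n^'k" where
  "GR U x = (\<chi> c. gr (U c) x)"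

definition HS :: "('k \<Rightarrow> real^'n \<Rightarrow> real) \<Rightarrow> real^'n \<Rightarrow> real^'n^'n^'k" where
  "HS U x = (\<chi> c. hs (U c) x)"

definition WG :: "('k \<Rightarrow> real^'n \<Rightarrow> real) \<Rightarrow> real^'n \<Rightarrow> real^'n^'k" where
  "WG U x = (\<chi> c. wgrad \<Omega> (U c) x)"

definition WH :: "('k \<Rightarrow> real^'n \<Rightarrow> real) \<Rightarrow> real^'n \<Rightarrow> real^'n^'n^'k" where
  "WH U x = (\<chi> c. whess \<Omega> (U c) x)"

definition TF :: "('k \<Rightarrow> real^'n \<Rightarrow> real) set" where
  "TF = {U. \<forall>c. test_fn \<Omega> (U c)}"

lemma TF_D: "U \<in> TF \<Longrightarrow> test_fn \<Omega> (U c)"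
  by (simp add: TF_def)

lemma subspace_TF: "subspace TF"
  unfolding subspace_def TF_def
  by (auto simp: plus_fun_def zero_fun_def scaleR_fun_def test_fn_zero test_fn_add test_fn_scale)

lemma GR_add: "U \<in> TF \<Longrightarrow> V \<in> TF \<Longrightarrow> GR (U + V) x = GR U x + GR V x"
  and GR_scale: "U \<in> TF \<Longrightarrow> GR (a *\<^sub>R U) x = a *\<^sub>R GR U x"
  using test_fn_smooth[OF TF_D] test_fn_Dl_add[of "U _" "V _" "[_]"] test_fn_Dl_scale[of "U _" "[_]" a]
  by (auto simp: GR_def vec_eq_iff plus_fun_def scaleR_fun_def)

lemma HS_add: "U \<in> TF \<Longrightarrow> V \<in> TF \<Longrightarrow> HS (U + V) x = HS U x + HS V x"
  and HS_scale: "U \<in> TF \<Longrightarrow> HS (a *\<^sub>R U) x = a *\<^sub>R HS U x"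
  using test_fn_smooth[OF TF_D] test_fn_Dl_add[of "U _" "V _" "[_, _]"] test_fn_Dl_scale[of "U _" "[_, _]" a]
  by (auto simp: HS_def hs_def vec_eq_iff plus_fun_def scaleR_fun_def)

lemma TF_diff: "U \<in> TF \<Longrightarrow> V \<in> TF \<Longrightarrow> U - V \<in> TF"
  using subspace_TF by (rule subspace_diff)

lemma GR_diff: "U \<in> TF \<Longrightarrow> V \<in> TF \<Longrightarrow> GR (U - V) x = GR U x - GR V x"
  using GR_add[of U "(-1) *\<^sub>R V"] GR_scale[of V "-1"] subspace_scale[OF subspace_TF, of V "-1"] by simp

lemma HS_diff: "U \<in> TF \<Longrightarrow> V \<in> TF \<Longrightarrow> HS (U - V) x = HS U x - HS V x"
  using HS_add[of U "(-1) *\<^sub>R V"] HS_scale[of V "-1"] subspace_scale[OF subspace_TF, of V "-1"] by simp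

lemma Lp_GR: "U \<in> TF \<Longrightarrow> p > 0 \<Longrightarrow> Lp \<Omega> p (GR U)"
  by (rule Lp_vecI) (auto simp: GR_def intro: Lp_gr TF_D)

lemma Lp_HS: "U \<in> TF \<Longrightarrow> p > 0 \<Longrightarrow> Lp \<Omega> p (HS U)"
  by (rule Lp_vecI) (auto simp: HS_def intro: Lp_hs TF_D)

lemma Lp_WG: "(\<And>c. Hm \<Omega> 2 (U c)) \<Longrightarrow> Lp \<Omega> 2 (WG U)"
  by (rule Lp_vecI) (auto simp: WG_def intro: Lp_wgrad)

lemma Lp_WH: "(\<And>c. Hm \<Omega> 2 (U c)) \<Longrightarrow> Lp \<Omega> 2 (WH U)"
  by (rule Lp_vecI) (auto simp: WH_def intro: Lp_whess)

lemma GR_bounded: "U \<in> TF \<Longrightarrow> \<exists>B. \<forall>x. norm (GR U x) \<le> B"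
proof -
  assume U: "U \<in> TF"
  have "\<forall>c i. \<exists>C. \<forall>x. \<bar>pd i (U c) x\<bar> \<le> C"
    using test_fn_bounded[OF test_fn_pd[OF TF_D[OF U]]] by meson
  then obtain C where C: "\<And>c i x. \<bar>pd i (U c) x\<bar> \<le> C c i" by metis
  have "norm (GR U x) \<le> (\<Sum>c\<in>UNIV. \<Sum>i\<in>UNIV. C c i)" for x
  proof -
    have "norm (GR U x) \<le> (\<Sum>c\<in>UNIV. norm (GR U x $ c))"
      unfolding norm_vec_def[of "GR U x"] by (rule L2_set_le_sum) auto
    also have "\<dots> \<le> (\<Sum>c\<in>UNIV. \<Sum>i\<in>UNIV. C c i)"
    proof (rule sum_mono)
      fix c
      have "norm (GR U x $ c) \<le> (\<Sum>i\<in>UNIV. \<bar>GR U x $ c $ i\<bar>)" by (rule norm_le_l1_cart)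
      also have "\<dots> \<le> (\<Sum>i\<in>UNIV. C c i)" using C by (intro sum_mono) (simp add: GR_def)
      finally show "norm (GR U x $ c) \<le> (\<Sum>i\<in>UNIV. C c i)" .
    qed
    finally show ?thesis .
  qed
  then show ?thesis by blast
qed

lemma AE_WG_test: "U \<in> TF \<Longrightarrow> AE x in lebesgue_on \<Omega>. WG U x = GR U x"
proof -
  assume U: "U \<in> TF"
  have "AE x in lebesgue_on \<Omega>. \<forall>c\<in>UNIV. wgrad \<Omega> (U c) x = gr (U c) x"
    by (intro AE_finite_allI AE_wgrad_test_fn TF_D U) auto
  then show ?thesis by eventually_elim (simp add: WG_def GR_def)
qed

lemma AE_WH_test: "U \<in> TF \<Longrightarrow> AE x in lebesgue_on \<Omega>. WH U x = HS U x"
proof -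
  assume U: "U \<in> TF"
  have "AE x in lebesgue_on \<Omega>. \<forall>c\<in>UNIV. whess \<Omega> (U c) x = hs (U c) x"
    by (intro AE_finite_allI AE_whess_test_fn TF_D U) auto
  then show ?thesis by eventually_elim (simp add: WH_def HS_def)
qed

lemma H20_approx:
  assumes \<Phi>: "\<And>c. H20 \<Omega> (\<Phi> c)"
  obtains \<psi> where "\<And>m::nat. \<psi> m \<in> TF" "(\<lambda>m. pint \<Omega> 2 (\<lambda>x. WG \<Phi> x - GR (\<psi> m) x)) \<longlonglongrightarrow> 0"
    "(\<lambda>m. pint \<Omega> 2 (\<lambda>x. WH \<Phi> x - HS (\<psi> m) x)) \<longlonglongrightarrow> 0"
proof -
  have Hm: "Hm \<Omega> 2 (\<Phi> c)" for c using \<Phi> by (simp add: H0m_def)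
  have "\<forall>m c. \<exists>\<phi>. test_fn \<Omega> \<phi> \<and> hnorm \<Omega> 2 (\<lambda>x. \<Phi> c x - \<phi> x) < 1 / real (Suc m)"
    using \<Phi> by (simp add: H0m_def)
  then obtain \<psi> where \<psi>: "\<And>m c. test_fn \<Omega> (\<psi> m c)" "\<And>m c. hnorm \<Omega> 2 (\<lambda>x. \<Phi> c x - \<psi> m c x) < 1 / real (Suc m)"
    by metis
  have TF: "\<psi> m \<in> TF" for m using \<psi>(1) by (simp add: TF_def)
  have hn0: "hnorm \<Omega> 2 u \<ge> 0" for u unfolding hnorm_def by (intro real_sqrt_ge_zero sum_nonneg) simp
  have small: "(hnorm \<Omega> 2 (\<lambda>x. \<Phi> c x - \<psi> m c x))\<^sup>2 \<le> (inverse (real (Suc m)))\<^sup>2" for m c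
    unfolding inverse_eq_divide by (rule power_mono[OF less_imp_le[OF \<psi>(2)] hn0])
  have bG: "pint \<Omega> 2 (\<lambda>x. WG \<Phi> x - GR (\<psi> m) x) \<le> real CARD('k) * (real CARD('n) * (inverse (real (Suc m)))\<^sup>2)" for m
  proof -
    have nth: "(WG \<Phi> x - GR (\<psi> m) x) $ c = wgrad \<Omega> (\<Phi> c) x - gr (\<psi> m c) x" for x c
      by (simp add: WG_def GR_def)
    have "pint \<Omega> 2 (\<lambda>x. WG \<Phi> x - GR (\<psi> m) x) = (\<Sum>c\<in>UNIV. pint \<Omega> 2 (\<lambda>x. (WG \<Phi> x - GR (\<psi> m) x) $ c))"
      by (rule pint_2_vec, unfold nth, rule Lp_diff(1)[OF Lp_wgrad[OF Hm] Lp_gr[OF \<psi>(1)]]) simp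
    also have "\<dots> \<le> (\<Sum>c\<in>(UNIV::'k set). real CARD('n) * (inverse (real (Suc m)))\<^sup>2)"
      unfolding nth
      by (intro sum_mono order_trans[OF pint_diff_test_fn(1)[OF Hm \<psi>(1)]] mult_left_mono small) auto
    finally show ?thesis by simp
  qed
  have bH: "pint \<Omega> 2 (\<lambda>x. WH \<Phi> x - HS (\<psi> m) x) \<le> real CARD('k) * ((real CARD('n))\<^sup>2 * (inverse (real (Suc m)))\<^sup>2)" for m
  proof -
    have nth: "(WH \<Phi> x - HS (\<psi> m) x) $ c = whess \<Omega> (\<Phi> c) x - hs (\<psi> m c) x" for x c
      by (simp add: WH_def HS_def)
    have "pint \<Omega> 2 (\<lambda>x. WH \<Phi> x - HS (\<psi> m) x) = (\<Sum>c\<in>UNIV. pint \<Omega> 2 (\<lambda>x. (WH \<Phi> x - HS (\<psi> m) x) $ c))"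
      by (rule pint_2_vec, unfold nth, rule Lp_diff(1)[OF Lp_whess[OF Hm] Lp_hs[OF \<psi>(1)]]) simp
    also have "\<dots> \<le> (\<Sum>c\<in>(UNIV::'k set). (real CARD('n))\<^sup>2 * (inverse (real (Suc m)))\<^sup>2)"
      unfolding nth
      by (intro sum_mono order_trans[OF pint_diff_test_fn(2)[OF Hm \<psi>(1)]] mult_left_mono small) auto
    finally show ?thesis by simp
  qed
  have e: "(\<lambda>m. (inverse (real (Suc m)))\<^sup>2) \<longlonglongrightarrow> 0"
    using tendsto_power[OF LIMSEQ_inverse_real_of_nat, of 2] by simp
  have lG: "(\<lambda>m. pint \<Omega> 2 (\<lambda>x. WG \<Phi> x - GR (\<psi> m) x)) \<longlonglongrightarrow> 0"
    by (rule tendsto_sandwich[OF always_eventually[OF allI[OF pint_nonneg]] always_eventually[OF allI[OF bG]] tendsto_const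
          tendsto_mult_right_zero[OF tendsto_mult_right_zero[OF e]]])
  have lH: "(\<lambda>m. pint \<Omega> 2 (\<lambda>x. WH \<Phi> x - HS (\<psi> m) x)) \<longlonglongrightarrow> 0"
    by (rule tendsto_sandwich[OF always_eventually[OF allI[OF pint_nonneg]] always_eventually[OF allI[OF bH]] tendsto_const
          tendsto_mult_right_zero[OF tendsto_mult_right_zero[OF e]]])
  show ?thesis using that[OF TF lG lH] .
qed

end

section \<open>The linearised form on test functions\<close>

lemma tendsto_0_of_power_le:
  fixes x :: "nat \<Rightarrow> real"
  assumes "n > 0" "even n" "\<And>m. x m ^ n \<le> b m" "b \<longlonglongrightarrow> 0"
  shows "x \<longlonglongrightarrow> 0"
proof -
  have "(\<lambda>m. x m ^ n) \<longlonglongrightarrow> 0"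
    by (rule tendsto_sandwich[OF always_eventually always_eventually tendsto_const assms(4)])
       (use assms in \<open>auto simp: zero_le_even_power\<close>)
  then show ?thesis using power_tendsto_0_iff[OF assms(1)] by blast
qed

lemma tendsto_0_squeeze:
  fixes f g :: "nat \<Rightarrow> real"
  assumes "\<And>m. 0 \<le> f m" "\<And>m. f m \<le> g m" "g \<longlonglongrightarrow> 0"
  shows "f \<longlonglongrightarrow> 0"
  using assms(1,2) by (intro tendsto_sandwich[OF _ _ tendsto_const assms(3)]) (simp_all add: always_eventually)

lemma power2_le_of_power4_le:
  fixes x c :: real
  assumes "x ^ 4 \<le> c\<^sup>2" "c \<ge> 0" shows "x\<^sup>2 \<le> c"
  using power2_le_imp_le[of "x\<^sup>2" c] assms by (simp only: square_square)

context hform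
begin

lemma BF_cong_AE:
  assumes "AE x in lebesgue_on \<Omega>. P x = P' x" "AE x in lebesgue_on \<Omega>. T x = T' x" "AE x in lebesgue_on \<Omega>. X x = X' x"
    and "P \<in> borel_measurable (lebesgue_on \<Omega>)" "T \<in> borel_measurable (lebesgue_on \<Omega>)" "X \<in> borel_measurable (lebesgue_on \<Omega>)"
    "P' \<in> borel_measurable (lebesgue_on \<Omega>)" "T' \<in> borel_measurable (lebesgue_on \<Omega>)" "X' \<in> borel_measurable (lebesgue_on \<Omega>)"
  shows "BF P T X = BF P' T' X'"
  unfolding BF_def
proof (rule integral_cong_AE)
  show "AE x in lebesgue_on \<Omega>. P x \<bullet> h (T x) (X x) = P' x \<bullet> h (T' x) (X' x)"
    using assms(1-3) by eventually_elim simp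
qed (intro borel_measurable_inner h_measurable assms)+

lemma AF_cong_AE:
  fixes P P' Q Q' :: "real^'n \<Rightarrow> 'v::euclidean_space"
  assumes "AE x in lebesgue_on \<Omega>. P x = P' x" "AE x in lebesgue_on \<Omega>. Q x = Q' x"
    and "P \<in> borel_measurable (lebesgue_on \<Omega>)" "Q \<in> borel_measurable (lebesgue_on \<Omega>)"
    "P' \<in> borel_measurable (lebesgue_on \<Omega>)" "Q' \<in> borel_measurable (lebesgue_on \<Omega>)"
  shows "AF P Q = AF P' Q'"
  unfolding AF_def
proof (rule integral_cong_AE)
  show "AE x in lebesgue_on \<Omega>. P x \<bullet> Q x = P' x \<bullet> Q' x"
    using assms(1-2) by eventually_elim simp
qed (intro borel_measurable_inner assms)+

lemma AF_combo2:
  assumes "Lp \<Omega> 2 P" "Lp \<Omega> 2 Q" "Lp \<Omega> 2 Q'"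
  shows "AF P (\<lambda>x. a *\<^sub>R Q x + b *\<^sub>R Q' x) = a * AF P Q + b * AF P Q'"
  using AF_combo[OF assms(2,3,1)] by (simp add: AF_commute[of P])

lemma pint_2_diff:
  fixes P Q :: "real^'n \<Rightarrow> 'v::euclidean_space"
  assumes "Lp \<Omega> 2 P" "Lp \<Omega> 2 Q"
  shows "pint \<Omega> 2 (\<lambda>x. P x - Q x) = pint \<Omega> 2 P - 2 * AF P Q + pint \<Omega> 2 Q"
proof -
  have L: "Lp \<Omega> 2 (\<lambda>x. 1 *\<^sub>R P x + (-1) *\<^sub>R Q x)" using Lp_diff(1)[OF assms] by simp
  have "pint \<Omega> 2 (\<lambda>x. P x - Q x) = AF (\<lambda>x. 1 *\<^sub>R P x + (-1) *\<^sub>R Q x) (\<lambda>x. 1 *\<^sub>R P x + (-1) *\<^sub>R Q x)"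
    by (simp add: AF_self)
  also have "\<dots> = AF P P - 2 * AF P Q + AF Q Q"
    unfolding AF_combo[OF assms L] AF_combo2[OF assms(1) assms] AF_combo2[OF assms(2) assms]
    by (simp add: AF_commute[of Q P])
  finally show ?thesis by (simp add: AF_self)
qed

lemma TF_H20: "U \<in> TF \<Longrightarrow> H20 \<Omega> (U c)"
proof -
  assume U: "U \<in> TF"
  have "hnorm \<Omega> 2 (\<lambda>x. U c x - U c x) = 0"
  proof -
    have "pint \<Omega> 2 (wd \<Omega> is (\<lambda>_. 0)) = 0" for "is" :: "'n list"
    proof -
      have "AE x in lebesgue_on \<Omega>. wd \<Omega> is (\<lambda>_. 0) x = Dl (rev is) (\<lambda>_. 0) x" by (rule wd_test_fn[OF test_fn_zero])
      moreover have "Dl js (\<lambda>_. 0) = (\<lambda>_. 0)" for js :: "'n list" by (induction js) (auto simp: pd_const)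
      ultimately have "AE x in lebesgue_on \<Omega>. wd \<Omega> is (\<lambda>_. 0) x = 0" by simp
      then have "pint \<Omega> 2 (wd \<Omega> is (\<lambda>_. 0)) = pint \<Omega> 2 (\<lambda>_::real^'n. 0::real)"
        by (intro pint_cong_AE Lp_measurable[OF Hm_wd(1)[OF Hm_test_fn[OF test_fn_zero] order_refl]]) auto
      then show ?thesis by (simp add: pint_def)
    qed
    then show ?thesis by (simp add: hnorm_def lpnorm_pow)
  qed
  then show ?thesis unfolding H0m_def using TF_D[OF U, of c] Hm_test_fn by auto
qed

end

text \<open>\<open>sob\<close> is a hypothesis here. For a sequence of discretisations it will be
  derived from their stability and consistency.\<close>

locale sobolev_form = hform \<Omega> h for \<Omega> :: "(real^'n::finite) set"
    and h :: "real^'n^'k \<Rightarrow> real^'n^'k \<Rightarrow> real^'n^'n^'k::finite" +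
  fixes \<Psi> :: "'k \<Rightarrow> real^'n \<Rightarrow> real" and S :: real
  assumes \<Psi>: "\<And>c. H20 \<Omega> (\<Psi> c)" and S0: "S \<ge> 0"
    and sob: "\<And>U. U \<in> TF \<Longrightarrow> pint \<Omega> 4 (GR U) \<le> S * (pint \<Omega> 2 (HS U))\<^sup>2"
begin

text \<open>By \<open>sob\<close>, H^2 convergence of the test families makes their gradients Cauchy
  in L^4. An almost everywhere convergent subsequence identifies the limit as the weak gradient, and
  Fatou's lemma transfers the bounds to it.\<close>

lemma H20_approx4:
  assumes \<Phi>: "\<And>c. H20 \<Omega> (\<Phi> c)"
  obtains \<psi> where "Lp \<Omega> 4 (WG \<Phi>)" "\<And>m::nat. \<psi> m \<in> TF" "(\<lambda>m. pint \<Omega> 4 (\<lambda>x. WG \<Phi> x - GR (\<psi> m) x)) \<longlonglongrightarrow> 0"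
    "(\<lambda>m. pint \<Omega> 2 (\<lambda>x. WH \<Phi> x - HS (\<psi> m) x)) \<longlonglongrightarrow> 0"
proof -
  obtain \<psi> where \<psi>: "\<And>m::nat. \<psi> m \<in> TF" "(\<lambda>m. pint \<Omega> 2 (\<lambda>x. WG \<Phi> x - GR (\<psi> m) x)) \<longlonglongrightarrow> 0"
    "(\<lambda>m. pint \<Omega> 2 (\<lambda>x. WH \<Phi> x - HS (\<psi> m) x)) \<longlonglongrightarrow> 0"
    by (rule H20_approx[where \<Phi> = \<Phi>, OF \<Phi>]) blast
  define a where "a m = pint \<Omega> 2 (\<lambda>x. WH \<Phi> x - HS (\<psi> m) x)" for m
  have a: "a \<longlonglongrightarrow> 0" unfolding a_def[abs_def] by (rule \<psi>(3))
  have a0: "a m \<ge> 0" for m by (simp add: a_def)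
  have Hm: "Hm \<Omega> 2 (\<Phi> c)" for c using \<Phi> by (simp add: H0m_def)
  have LW: "Lp \<Omega> 2 (WG \<Phi>)" "Lp \<Omega> 2 (WH \<Phi>)" by (rule Lp_WG Lp_WH, rule Hm)+
  have Ld: "Lp \<Omega> 2 (\<lambda>x. WG \<Phi> x - GR (\<psi> m) x)" for m
    by (rule Lp_diff(1)[OF LW(1) Lp_GR[OF \<psi>(1)]]) simp
  have "\<exists>r. strict_mono r \<and> (AE x in lebesgue_on \<Omega>. (\<lambda>m. norm (WG \<Phi> x - GR (\<psi> (r m)) x) ^ 2) \<longlonglongrightarrow> 0)"
  proof (rule tendsto_L1_AE_subseq)
    show "integrable (lebesgue_on \<Omega>) (\<lambda>x. norm (WG \<Phi> x - GR (\<psi> m) x) ^ 2)" for m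
      using Ld[of m] unfolding Lp_def by (rule conjunct2)
    show "(\<lambda>m. LINT x|lebesgue_on \<Omega>. norm (norm (WG \<Phi> x - GR (\<psi> m) x) ^ 2)) \<longlonglongrightarrow> 0"
      using \<psi>(2) unfolding pint_def by simp
  qed
  then obtain r where r: "strict_mono r" "AE x in lebesgue_on \<Omega>. (\<lambda>m. norm (WG \<Phi> x - GR (\<psi> (r m)) x) ^ 2) \<longlonglongrightarrow> 0"
    by blast
  have cv: "AE x in lebesgue_on \<Omega>. (\<lambda>m. GR (\<psi> (r m)) x) \<longlonglongrightarrow> WG \<Phi> x"
    using r(2)
  proof eventually_elim
    case (elim x)
    then have "(\<lambda>m. norm (WG \<Phi> x - GR (\<psi> (r m)) x)) \<longlonglongrightarrow> 0"
      by (simp add: power_tendsto_0_iff)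
    then have "(\<lambda>m. WG \<Phi> x - GR (\<psi> (r m)) x) \<longlonglongrightarrow> 0" by (rule tendsto_norm_zero_cancel)
    from tendsto_diff[OF tendsto_const[of "WG \<Phi> x"] this] show ?case by simp
  qed
  \<comment> \<open>For fixed \<open>l\<close> the bound is taken on
    \<open>\<psi> (r m) - \<psi> l\<close> before \<open>m\<close> tends to infinity. The
    subsequence \<open>r\<close> enters only through almost everywhere convergence, so every
    \<open>l\<close> is covered. The 4 is the constant of \<open>Lp_diff\<close>.\<close>
  have main: "Lp \<Omega> 4 (\<lambda>x. WG \<Phi> x - GR (\<psi> l) x) \<and> pint \<Omega> 4 (\<lambda>x. WG \<Phi> x - GR (\<psi> l) x) \<le> S * (4 * (0 + a l))\<^sup>2" for l
  proof -
    define f where "f m x = GR (\<psi> (r m)) x - GR (\<psi> l) x" for m x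
    have L4: "Lp \<Omega> 4 (f m)" for m
      unfolding f_def[abs_def] by (rule Lp_diff(1)[OF Lp_GR[OF \<psi>(1)] Lp_GR[OF \<psi>(1)]], simp_all)
    have le: "pint \<Omega> 4 (f m) \<le> S * (4 * (a (r m) + a l))\<^sup>2" for m
    proof -
      have LH: "Lp \<Omega> 2 (\<lambda>x. WH \<Phi> x - HS (\<psi> j) x)" for j
        by (rule Lp_diff(1)[OF LW(2) Lp_HS[OF \<psi>(1)]]) simp
      have "f m = GR (\<psi> (r m) - \<psi> l)" by (auto simp: f_def GR_diff \<psi>(1) fun_eq_iff)
      then have "pint \<Omega> 4 (f m) \<le> S * (pint \<Omega> 2 (HS (\<psi> (r m) - \<psi> l)))\<^sup>2"
        using sob[OF TF_diff[OF \<psi>(1) \<psi>(1)]] by simp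
      also have "pint \<Omega> 2 (HS (\<psi> (r m) - \<psi> l))
          = pint \<Omega> 2 (\<lambda>x. (WH \<Phi> x - HS (\<psi> l) x) - (WH \<Phi> x - HS (\<psi> (r m)) x))"
        by (rule arg_cong[of _ _ "pint \<Omega> 2"]) (auto simp: HS_diff \<psi>(1) fun_eq_iff)
      also have "S * \<dots>\<^sup>2 \<le> S * (4 * (a (r m) + a l))\<^sup>2"
      proof (intro mult_left_mono power_mono)
        show "pint \<Omega> 2 (\<lambda>x. (WH \<Phi> x - HS (\<psi> l) x) - (WH \<Phi> x - HS (\<psi> (r m)) x)) \<le> 4 * (a (r m) + a l)"
          using Lp_diff(2)[OF LH[of l] LH[of "r m"]] by (simp add: a_def algebra_simps)
      qed (simp_all add: S0)
      finally show ?thesis .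
    qed
    have b: "(\<lambda>m. S * (4 * (a (r m) + a l))\<^sup>2) \<longlonglongrightarrow> S * (4 * (0 + a l))\<^sup>2"
      by (intro tendsto_mult tendsto_const tendsto_power tendsto_add LIMSEQ_subseq_LIMSEQ[OF a r(1), unfolded o_def])
    have g: "AE x in lebesgue_on \<Omega>. (\<lambda>m. f m x) \<longlonglongrightarrow> WG \<Phi> x - GR (\<psi> l) x"
      using cv unfolding f_def by eventually_elim (rule tendsto_diff[OF _ tendsto_const])
    show ?thesis using Lp_fatou[OF L4 le b Lp_measurable[OF Ld] g] by blast
  qed
  have "Lp \<Omega> 4 (\<lambda>x. (WG \<Phi> x - GR (\<psi> 0) x) + GR (\<psi> 0) x)"
    by (rule Lp_add(1)[OF conjunct1[OF main] Lp_GR[OF \<psi>(1)]]) simp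
  then have W4: "Lp \<Omega> 4 (WG \<Phi>)" by simp
  have "(\<lambda>l. S * (4 * (0 + a l))\<^sup>2) \<longlonglongrightarrow> S * (4 * (0 + 0))\<^sup>2"
    by (intro tendsto_mult tendsto_const tendsto_power tendsto_add a)
  then have "(\<lambda>l. S * (4 * (0 + a l))\<^sup>2) \<longlonglongrightarrow> 0" by simp
  then have "(\<lambda>m. pint \<Omega> 4 (\<lambda>x. WG \<Phi> x - GR (\<psi> m) x)) \<longlonglongrightarrow> 0"
    by (rule tendsto_0_squeeze[rotated 2]) (simp, use main in blast)
  then show ?thesis by (rule that[OF W4 \<psi>(1) _ \<psi>(3)])
qed

lemma Lp_\<Psi>: "Lp \<Omega> 2 (WH \<Psi>)" "Lp \<Omega> 2 (WG \<Psi>)" "Lp \<Omega> 4 (WG \<Psi>)"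
proof -
  have Hm: "Hm \<Omega> 2 (\<Psi> c)" for c using \<Psi> by (simp add: H0m_def)
  show "Lp \<Omega> 2 (WH \<Psi>)" "Lp \<Omega> 2 (WG \<Psi>)" by (rule Lp_WH Lp_WG, rule Hm)+
  show "Lp \<Omega> 4 (WG \<Psi>)" by (rule H20_approx4[where \<Phi> = \<Psi>, OF \<Psi>])
qed

text \<open>\<open>linA\<close> on test families: classical derivatives of both arguments remove the
  almost everywhere caveat, while \<Psi> keeps its weak ones.\<close>

definition TA :: "('k \<Rightarrow> real^'n \<Rightarrow> real) \<Rightarrow> ('k \<Rightarrow> real^'n \<Rightarrow> real) \<Rightarrow> real" where
  "TA U V = AF (HS U) (HS V) + BF (WH \<Psi>) (GR U) (GR V) + BF (HS U) (WG \<Psi>) (GR V)"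

lemma BI_TA:
  assumes "U \<in> TF" "Lp \<Omega> 4 X"
  shows "BI (WH \<Psi>) (GR U) X" "BI (HS U) (WG \<Psi>) X"
  by (rule BI_244[OF Lp_\<Psi>(1) Lp_GR[OF assms(1)] assms(2)], simp, rule BI_244[OF Lp_HS[OF assms(1)] Lp_\<Psi>(3) assms(2)], simp)

lemma TA_combo:
  assumes "U \<in> TF" "V \<in> TF" "W \<in> TF"
  shows "TA (U + V) W = TA U W + TA V W" "TA (a *\<^sub>R U) W = a * TA U W"
proof -
  note L = Lp_HS[OF assms(1)] Lp_HS[OF assms(2)] Lp_HS[OF assms(3)]
  have L4: "Lp \<Omega> 4 (GR W)" using Lp_GR[OF assms(3)] by simp
  note B = BI_TA[OF assms(1) L4] BI_TA[OF assms(2) L4]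
  have e: "HS (U + V) = (\<lambda>x. 1 *\<^sub>R HS U x + 1 *\<^sub>R HS V x)" "GR (U + V) = (\<lambda>x. 1 *\<^sub>R GR U x + 1 *\<^sub>R GR V x)"
    using assms by (auto simp: HS_add GR_add)
  show "TA (U + V) W = TA U W + TA V W"
    unfolding TA_def e using L B by (simp only: AF_combo BF_combo1 BF_combo2 zero_less_numeral)
  have e: "HS (a *\<^sub>R U) = (\<lambda>x. a *\<^sub>R HS U x + 0 *\<^sub>R HS U x)" "GR (a *\<^sub>R U) = (\<lambda>x. a *\<^sub>R GR U x + 0 *\<^sub>R GR U x)"
    using assms by (auto simp: HS_scale GR_scale)
  show "TA (a *\<^sub>R U) W = a * TA U W"
    unfolding TA_def e using L B by (simp only: AF_combo BF_combo1 BF_combo2 zero_less_numeral) (simp add: algebra_simps)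
qed

lemma TA_bound:
  "\<exists>C\<ge>0. \<forall>U\<in>TF. \<forall>V\<in>TF. (TA U V)\<^sup>2 \<le> C * pint \<Omega> 2 (HS U) * pint \<Omega> 2 (HS V)"
proof -
  obtain C where C: "C \<ge> 0" "\<And>P T X. Lp \<Omega> 2 P \<Longrightarrow> Lp \<Omega> 4 T \<Longrightarrow> Lp \<Omega> 4 X \<Longrightarrow>
     BF P T X ^ 4 \<le> C * ((pint \<Omega> 2 P)\<^sup>2 * pint \<Omega> 4 T * pint \<Omega> 4 X)"
    using BF_bound_244 by blast
  define p where "p = pint \<Omega> 2 (WH \<Psi>)"
  define w where "w = pint \<Omega> 4 (WG \<Psi>)"
  have pw: "p \<ge> 0" "w \<ge> 0" by (auto simp: p_def w_def)
  \<comment> \<open>One summand for each term of \<open>TA\<close>, the fourth-power bounds having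
    been reduced to squares; the 3 comes from \<open>(a + b + c)\<^sup>2 \<le> 3 * (a\<^sup>2 +
    b\<^sup>2 + c\<^sup>2)\<close>.\<close>
  define D where "D = 3 * (1 + sqrt C * p * S + sqrt (C * w * S))"
  show ?thesis
  proof (intro exI[of _ D] conjI ballI)
    show "D \<ge> 0" unfolding D_def using C(1) pw S0 by simp
    fix U V assume UV: "U \<in> TF" "V \<in> TF"
    define u v where "u = pint \<Omega> 2 (HS U)" and "v = pint \<Omega> 2 (HS V)"
    have uv: "u \<ge> 0" "v \<ge> 0" by (auto simp: u_def v_def)
    have L4: "Lp \<Omega> 4 (GR U)" "Lp \<Omega> 4 (GR V)" and L2: "Lp \<Omega> 2 (HS U)" "Lp \<Omega> 2 (HS V)"
      using UV by (auto intro: Lp_GR Lp_HS)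
    have g: "pint \<Omega> 4 (GR U) \<le> S * u\<^sup>2" "pint \<Omega> 4 (GR V) \<le> S * v\<^sup>2"
      using sob UV by (auto simp: u_def v_def)
    have 1: "(AF (HS U) (HS V))\<^sup>2 \<le> u * v" using AF_bound[OF L2] by (simp add: u_def v_def)
    have 2: "(BF (WH \<Psi>) (GR U) (GR V))\<^sup>2 \<le> sqrt C * p * S * u * v"
    proof (rule power2_le_of_power4_le)
      have "BF (WH \<Psi>) (GR U) (GR V) ^ 4 \<le> C * (p\<^sup>2 * pint \<Omega> 4 (GR U) * pint \<Omega> 4 (GR V))"
        unfolding p_def by (rule C(2)[OF Lp_\<Psi>(1) L4])
      also have "\<dots> \<le> C * (p\<^sup>2 * (S * u\<^sup>2) * (S * v\<^sup>2))"
        using g C(1) S0 by (intro mult_left_mono mult_mono mult_nonneg_nonneg) auto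
      also have "\<dots> = (sqrt C * p * S * u * v)\<^sup>2"
        using C(1) by (simp add: power_mult_distrib power2_eq_square[of S])
      finally show "BF (WH \<Psi>) (GR U) (GR V) ^ 4 \<le> (sqrt C * p * S * u * v)\<^sup>2" .
    qed (use C(1) pw S0 uv in simp)
    have 3: "(BF (HS U) (WG \<Psi>) (GR V))\<^sup>2 \<le> sqrt (C * w * S) * u * v"
    proof (rule power2_le_of_power4_le)
      have "BF (HS U) (WG \<Psi>) (GR V) ^ 4 \<le> C * (u\<^sup>2 * w * pint \<Omega> 4 (GR V))"
        unfolding u_def w_def by (rule C(2)[OF L2(1) Lp_\<Psi>(3) L4(2)])
      also have "\<dots> \<le> C * (u\<^sup>2 * w * (S * v\<^sup>2))"
        using g C(1) S0 pw by (intro mult_left_mono mult_nonneg_nonneg) auto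
      also have "\<dots> = (sqrt (C * w * S) * u * v)\<^sup>2"
        using C(1) pw S0 by (simp add: power_mult_distrib)
      finally show "BF (HS U) (WG \<Psi>) (GR V) ^ 4 \<le> (sqrt (C * w * S) * u * v)\<^sup>2" .
    qed (use C(1) pw S0 uv in simp)
    have sq3: "(a + b + c)\<^sup>2 \<le> 3 * (a\<^sup>2 + b\<^sup>2 + c\<^sup>2)" for a b c :: real
    proof -
      have "3 * (a\<^sup>2 + b\<^sup>2 + c\<^sup>2) - (a + b + c)\<^sup>2 = (a - b)\<^sup>2 + (b - c)\<^sup>2 + (a - c)\<^sup>2"
        by (simp add: power2_eq_square algebra_simps)
      then show ?thesis using zero_le_power2[of "a - b"] zero_le_power2[of "b - c"] zero_le_power2[of "a - c"] by linarith
    qed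
    have "(TA U V)\<^sup>2 \<le> 3 * (u * v + sqrt C * p * S * u * v + sqrt (C * w * S) * u * v)"
      unfolding TA_def by (rule order_trans[OF sq3]) (intro mult_left_mono add_mono 1 2 3, simp)
    also have "\<dots> = D * u * v" by (simp add: D_def algebra_simps)
    finally show "(TA U V)\<^sup>2 \<le> D * pint \<Omega> 2 (HS U) * pint \<Omega> 2 (HS V)" by (simp add: u_def v_def)
  qed
qed

lemma linA_test:
  assumes U: "U \<in> TF" and \<Phi>: "\<And>c. H20 \<Omega> (\<Phi> c)"
  shows "linA \<Omega> h \<Psi> U \<Phi> = AF (HS U) (WH \<Phi>) + BF (WH \<Psi>) (GR U) (WG \<Phi>) + BF (HS U) (WG \<Psi>) (WG \<Phi>)"
proof -
  have Hm: "Hm \<Omega> 2 (\<Phi> c)" "Hm \<Omega> 2 (U c)" for c using \<Phi> U Hm_test_fn by (auto simp: H0m_def TF_def)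
  note m = Lp_measurable[OF Lp_WG, of U] Lp_measurable[OF Lp_WH, of U] Lp_measurable[OF Lp_WG, of \<Phi>] Lp_measurable[OF Lp_WH, of \<Phi>]
    Lp_measurable[OF Lp_HS[OF U, of 2]] Lp_measurable[OF Lp_GR[OF U, of 2]] Lp_measurable[OF Lp_\<Psi>(1)] Lp_measurable[OF Lp_\<Psi>(2)]
  have "linA \<Omega> h \<Psi> U \<Phi> = AF (WH U) (WH \<Phi>) + BF (WH \<Psi>) (WG U) (WG \<Phi>) + BF (WH U) (WG \<Psi>) (WG \<Phi>)"
    by (simp add: linA_def Aform_eq_AF Bform_eq_BF WH_def[abs_def] WG_def[abs_def])
  also have "AF (WH U) (WH \<Phi>) = AF (HS U) (WH \<Phi>)"
    by (rule AF_cong_AE[OF AE_WH_test[OF U]]) (use m Hm in auto)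
  also have "BF (WH \<Psi>) (WG U) (WG \<Phi>) = BF (WH \<Psi>) (GR U) (WG \<Phi>)"
    by (rule BF_cong_AE[OF _ AE_WG_test[OF U]]) (use m Hm in auto)
  also have "BF (WH U) (WG \<Psi>) (WG \<Phi>) = BF (HS U) (WG \<Psi>) (WG \<Phi>)"
    by (rule BF_cong_AE[OF AE_WH_test[OF U]]) (use m Hm in auto)
  finally show ?thesis .
qed

lemma TA_tendsto_linA:
  assumes U: "U \<in> TF" and \<Phi>: "\<And>c. H20 \<Omega> (\<Phi> c)"
    and \<psi>: "Lp \<Omega> 4 (WG \<Phi>)" "\<And>m::nat. \<psi> m \<in> TF" "(\<lambda>m. pint \<Omega> 4 (\<lambda>x. WG \<Phi> x - GR (\<psi> m) x)) \<longlonglongrightarrow> 0"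
    "(\<lambda>m. pint \<Omega> 2 (\<lambda>x. WH \<Phi> x - HS (\<psi> m) x)) \<longlonglongrightarrow> 0"
  shows "(\<lambda>m. TA U (\<psi> m)) \<longlonglongrightarrow> linA \<Omega> h \<Psi> U \<Phi>"
proof -
  have Hm: "Hm \<Omega> 2 (\<Phi> c)" for c using \<Phi> by (auto simp: H0m_def)
  obtain C where C: "C \<ge> 0" "\<And>P T X. Lp \<Omega> 2 P \<Longrightarrow> Lp \<Omega> 4 T \<Longrightarrow> Lp \<Omega> 4 X \<Longrightarrow>
     BF P T X ^ 4 \<le> C * ((pint \<Omega> 2 P)\<^sup>2 * pint \<Omega> 4 T * pint \<Omega> 4 X)"
    using BF_bound_244 by blast
  have LU: "Lp \<Omega> 2 (HS U)" "Lp \<Omega> 4 (GR U)" using U by (auto intro: Lp_HS Lp_GR)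
  have LP: "Lp \<Omega> 2 (WH \<Phi>)" by (rule Lp_WH[OF Hm])
  have L\<psi>: "Lp \<Omega> 2 (HS (\<psi> m))" "Lp \<Omega> 4 (GR (\<psi> m))" for m using \<psi>(2) by (auto intro: Lp_HS Lp_GR)
  have Ld: "Lp \<Omega> 2 (\<lambda>x. WH \<Phi> x - HS (\<psi> m) x)" "Lp \<Omega> 4 (\<lambda>x. WG \<Phi> x - GR (\<psi> m) x)" for m
    by (rule Lp_diff(1)[OF LP L\<psi>(1)] Lp_diff(1)[OF \<psi>(1) L\<psi>(2)])+
  have d1: "AF P (\<lambda>x. WH \<Phi> x - HS (\<psi> m) x) = AF P (WH \<Phi>) - AF P (HS (\<psi> m))" if "Lp \<Omega> 2 P" for P m
    using AF_combo2[OF that LP L\<psi>(1), of 1 "-1" m] by simp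
  have d2: "BF P T (\<lambda>x. WG \<Phi> x - GR (\<psi> m) x) = BF P T (WG \<Phi>) - BF P T (GR (\<psi> m))"
    if "Lp \<Omega> 2 P" "Lp \<Omega> 4 T" for P T m
    using BF_combo3[OF BI_244[OF that \<psi>(1)] BI_244[OF that L\<psi>(2)], of 1 "-1" m] by simp
  have l1: "(\<lambda>m. AF (HS U) (\<lambda>x. WH \<Phi> x - HS (\<psi> m) x)) \<longlonglongrightarrow> 0"
    by (rule tendsto_0_of_power_le[of 2, OF _ _ AF_bound[OF LU(1) Ld(1)] tendsto_mult_right_zero[OF \<psi>(4)]]) auto
  have l2: "(\<lambda>m. BF P T (\<lambda>x. WG \<Phi> x - GR (\<psi> m) x)) \<longlonglongrightarrow> 0" if "Lp \<Omega> 2 P" "Lp \<Omega> 4 T" for P T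
    by (rule tendsto_0_of_power_le[of 4, OF _ _ C(2)[OF that Ld(2)] tendsto_mult_right_zero[OF tendsto_mult_right_zero[OF \<psi>(3)]]]) auto
  have "(\<lambda>m. linA \<Omega> h \<Psi> U \<Phi> - (AF (HS U) (\<lambda>x. WH \<Phi> x - HS (\<psi> m) x)
      + BF (WH \<Psi>) (GR U) (\<lambda>x. WG \<Phi> x - GR (\<psi> m) x) + BF (HS U) (WG \<Psi>) (\<lambda>x. WG \<Phi> x - GR (\<psi> m) x)))
      \<longlonglongrightarrow> linA \<Omega> h \<Psi> U \<Phi> - (0 + 0 + 0)"
    by (intro tendsto_diff tendsto_add tendsto_const l1 l2 LU Lp_\<Psi>)
  moreover have "linA \<Omega> h \<Psi> U \<Phi> - (AF (HS U) (\<lambda>x. WH \<Phi> x - HS (\<psi> m) x)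
      + BF (WH \<Psi>) (GR U) (\<lambda>x. WG \<Phi> x - GR (\<psi> m) x) + BF (HS U) (WG \<Psi>) (\<lambda>x. WG \<Phi> x - GR (\<psi> m) x))
      = TA U (\<psi> m)" for m
    unfolding linA_test[where \<Phi> = \<Phi>, OF U \<Phi>] d1[OF LU(1)] d2[OF Lp_\<Psi>(1) LU(2)] d2[OF LU(1) Lp_\<Psi>(3)] TA_def by simp
  ultimately show ?thesis by simp
qed

lemma hsemi2k_sq: "(hsemi2k \<Omega> U)\<^sup>2 = pint \<Omega> 2 (WH U)" if "\<And>c. Hm \<Omega> 2 (U c)" for U
proof -
  have "pint \<Omega> 2 (WH U) = (\<Sum>c\<in>UNIV. pint \<Omega> 2 (whess \<Omega> (U c)))"
    using pint_2_vec[of \<Omega> "WH U"] Lp_whess[OF that] by (simp add: WH_def)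
  then show ?thesis unfolding hsemi2k_def by (simp add: lpnormk_pow)
qed

text \<open>Density and continuity of the linearised form allow the supremum over \<open>H20\<close>
  to be tested on \<open>TF\<close> alone. In the squared form neither a sign nor a normalisation of
  \<open>w\<close> is left, and the constant becomes the square of the inf-sup constant.\<close>

lemma infsup_TF:
  assumes reg: "regular_solution \<Omega> h L \<Psi>"
  obtains \<beta> where "\<beta> > 0" "\<And>U e. U \<in> TF \<Longrightarrow> e \<ge> 0 \<Longrightarrow> (\<And>w. w \<in> TF \<Longrightarrow> (TA U w)\<^sup>2 \<le> e * pint \<Omega> 2 (HS w)) \<Longrightarrow>
      \<beta> * pint \<Omega> 2 (HS U) \<le> e"
proof -
  obtain \<beta> where \<beta>: "\<beta> > 0" and sup: "\<And>\<Theta>. (\<forall>c. H20 \<Omega> (\<Theta> c)) \<and> hsemi2k \<Omega> \<Theta> = 1 \<Longrightarrow>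
      ereal \<beta> \<le> (SUP \<Phi>\<in>{\<Phi>. (\<forall>c. H20 \<Omega> (\<Phi> c)) \<and> hsemi2k \<Omega> \<Phi> = 1}. ereal (linA \<Omega> h \<Psi> \<Theta> \<Phi>))"
    using reg unfolding regular_solution_def by blast
  show ?thesis
  proof (rule that[of "\<beta>\<^sup>2"])
    show "\<beta>\<^sup>2 > 0" using \<beta> by simp
    fix U e assume U: "U \<in> TF" and e: "e \<ge> 0" and bd: "\<And>w. w \<in> TF \<Longrightarrow> (TA U w)\<^sup>2 \<le> e * pint \<Omega> 2 (HS w)"
    define q where "q = pint \<Omega> 2 (HS U)"
    show "\<beta>\<^sup>2 * pint \<Omega> 2 (HS U) \<le> e"
    proof (cases "q = 0")
      case False
      then have q: "q > 0" using pint_nonneg[of \<Omega> 2 "HS U"] unfolding q_def by linarith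
      define V where "V = (1 / sqrt q) *\<^sub>R U"
      have V: "V \<in> TF" unfolding V_def by (rule subspace_scale[OF subspace_TF U])
      have HmV: "Hm \<Omega> 2 (V c)" for c by (rule Hm_test_fn[OF TF_D[OF V]])
      have "(hsemi2k \<Omega> V)\<^sup>2 = pint \<Omega> 2 (HS V)"
        unfolding hsemi2k_sq[where U = V, OF HmV]
        by (rule pint_cong_AE[OF Lp_measurable[OF Lp_WH[where U = V, OF HmV]] Lp_measurable[OF Lp_HS[OF V, of 2]] AE_WH_test[OF V]]) simp
      also have "\<dots> = 1"
      proof -
        have "HS V = (\<lambda>x. (1 / sqrt q) *\<^sub>R HS U x)" unfolding V_def by (rule ext) (rule HS_scale[OF U])
        then have "pint \<Omega> 2 (HS V) = \<bar>1 / sqrt q\<bar>\<^sup>2 * q" by (simp only: pint_scale q_def)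
        then show ?thesis using q by (simp add: power_divide)
      qed
      finally have "hsemi2k \<Omega> V = 1 \<or> hsemi2k \<Omega> V = -1" by (simp add: power2_eq_1_iff)
      moreover have "hsemi2k \<Omega> V \<ge> 0" by (simp add: hsemi2k_def lpnormk_def)
      ultimately have V1: "(\<forall>c. H20 \<Omega> (V c)) \<and> hsemi2k \<Omega> V = 1" using TF_H20[OF V] by auto
      \<comment> \<open>Each unit \<Phi> is a limit of test families whose energies tend to 1, so
        the bound on \<open>TA V\<close> passes to the limit. Dividing \<open>U\<close> by
        \<open>sqrt q\<close> has turned \<open>e\<close> into \<open>e / q\<close>.\<close>
      have "ereal \<beta> \<le> ereal (sqrt (e / q))"
      proof (rule order_trans[OF sup[OF V1] SUP_least])
        fix \<Phi> :: "'k \<Rightarrow> real^'n \<Rightarrow> real" assume "\<Phi> \<in> {\<Phi>. (\<forall>c. H20 \<Omega> (\<Phi> c)) \<and> hsemi2k \<Omega> \<Phi> = 1}"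
        then have \<Phi>: "\<And>c. H20 \<Omega> (\<Phi> c)" "hsemi2k \<Omega> \<Phi> = 1" by auto
        have Hm: "Hm \<Omega> 2 (\<Phi> c)" for c using \<Phi> by (simp add: H0m_def)
        have one: "pint \<Omega> 2 (WH \<Phi>) = 1" using hsemi2k_sq[where U = \<Phi>, OF Hm] \<Phi>(2) by simp
        obtain \<psi> where \<psi>: "Lp \<Omega> 4 (WG \<Phi>)" "\<And>m::nat. \<psi> m \<in> TF" "(\<lambda>m. pint \<Omega> 4 (\<lambda>x. WG \<Phi> x - GR (\<psi> m) x)) \<longlonglongrightarrow> 0"
          "(\<lambda>m. pint \<Omega> 2 (\<lambda>x. WH \<Phi> x - HS (\<psi> m) x)) \<longlonglongrightarrow> 0"
          by (rule H20_approx4[where \<Phi> = \<Phi>, OF \<Phi>(1)]) blast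
        have LP: "Lp \<Omega> 2 (WH \<Phi>)" by (rule Lp_WH[OF Hm])
        have Ld: "Lp \<Omega> 2 (\<lambda>x. WH \<Phi> x - HS (\<psi> m) x)" for m
          by (rule Lp_diff(1)[OF LP Lp_HS[OF \<psi>(2)]]) simp
        have l1: "(\<lambda>m. AF (WH \<Phi>) (\<lambda>x. WH \<Phi> x - HS (\<psi> m) x)) \<longlonglongrightarrow> 0"
          by (rule tendsto_0_of_power_le[of 2, OF _ _ AF_bound[OF LP Ld] tendsto_mult_right_zero[OF \<psi>(4)]]) auto
        have "(\<lambda>m. pint \<Omega> 2 (WH \<Phi>) - 2 * AF (WH \<Phi>) (\<lambda>x. WH \<Phi> x - HS (\<psi> m) x) + pint \<Omega> 2 (\<lambda>x. WH \<Phi> x - HS (\<psi> m) x))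
            \<longlonglongrightarrow> pint \<Omega> 2 (WH \<Phi>) - 2 * 0 + 0"
          by (intro tendsto_intros l1 \<psi>(4))
        moreover have "pint \<Omega> 2 (WH \<Phi>) - 2 * AF (WH \<Phi>) (\<lambda>x. WH \<Phi> x - HS (\<psi> m) x) + pint \<Omega> 2 (\<lambda>x. WH \<Phi> x - HS (\<psi> m) x)
            = pint \<Omega> 2 (HS (\<psi> m))" for m
          using pint_2_diff[OF LP Ld, of m] by simp
        ultimately have nl: "(\<lambda>m. pint \<Omega> 2 (HS (\<psi> m))) \<longlonglongrightarrow> 1" by (simp add: one)
        have tl: "(\<lambda>m. (TA V (\<psi> m))\<^sup>2) \<longlonglongrightarrow> (linA \<Omega> h \<Psi> V \<Phi>)\<^sup>2"
          by (intro tendsto_power TA_tendsto_linA V \<Phi>(1) \<psi>)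
        have "(TA V (\<psi> m))\<^sup>2 \<le> e / q * pint \<Omega> 2 (HS (\<psi> m))" for m
        proof -
          have "(TA V (\<psi> m))\<^sup>2 = (TA U (\<psi> m))\<^sup>2 / q"
            unfolding V_def TA_combo(2)[OF U U \<psi>(2)] using q by (simp add: power_divide power_mult_distrib)
          also have "\<dots> \<le> e * pint \<Omega> 2 (HS (\<psi> m)) / q" using bd[OF \<psi>(2)] q by (intro divide_right_mono) auto
          finally show ?thesis by simp
        qed
        then have "(linA \<Omega> h \<Psi> V \<Phi>)\<^sup>2 \<le> e / q * 1"
          by (intro LIMSEQ_le[OF tl tendsto_mult[OF tendsto_const nl]]) auto
        then show "ereal (linA \<Omega> h \<Psi> V \<Phi>) \<le> ereal (sqrt (e / q))"
          by (simp add: real_le_rsqrt)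
      qed
      then have "\<beta>\<^sup>2 \<le> e / q" using \<beta> e q real_sqrt_le_iff by (simp add: real_le_rsqrt sqrt_ge_absD)
      then show ?thesis using q by (simp add: q_def[symmetric] field_simps)
    qed (use e in \<open>simp add: q_def\<close>)
  qed
qed

end

section \<open>Compactness\<close>

text \<open>An exchange of limits: \<open>y m\<close> approximates \<open>x\<close> uniformly in
  \<open>n\<close>. The fourth power is the form in which \<open>BF_bound_244\<close> delivers the
  error.\<close>

lemma tendsto_0_approx:
  fixes x :: "nat \<Rightarrow> real"
  assumes y: "\<And>m. y m \<longlonglongrightarrow> 0" and le: "\<And>m n. (x n - y m n) ^ 4 \<le> \<eta> m" and \<eta>: "\<eta> \<longlonglongrightarrow> 0"
  shows "x \<longlonglongrightarrow> 0"
proof (rule LIMSEQ_I)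
  fix e :: real assume e: "e > 0"
  then have "(e / 2) ^ 4 > 0" by simp
  then obtain m where "norm (\<eta> m - 0) < (e / 2) ^ 4" using LIMSEQ_D[OF \<eta>] by blast
  then have m: "\<eta> m < (e / 2) ^ 4" by simp
  obtain M where M: "\<And>n. n \<ge> M \<Longrightarrow> norm (y m n - 0) < e / 2" using LIMSEQ_D[OF y[of m], of "e / 2"] e by auto
  have "norm (x n - 0) < e" if "n \<ge> M" for n
  proof -
    have "\<bar>x n - y m n\<bar> ^ 4 < (e / 2) ^ 4" using le[of n m] m by simp
    then have "\<bar>x n - y m n\<bar> < e / 2" by (rule power_less_imp_less_base) (use e in simp)
    then show ?thesis using M[OF that] by (simp add: abs_if split: if_splits)
  qed
  then show "\<exists>M. \<forall>n\<ge>M. norm (x n - 0) < e" by blast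
qed

context bounded_open
begin

lemma lborel_square_test_fn: "test_fn \<Omega> f \<Longrightarrow> (\<integral>x. (f x)\<^sup>2 \<partial>lborel) = pint \<Omega> 2 f"
  using integral_mult_test[of f f] test_fn_smooth[of \<Omega> f] by (simp add: pint_def power2_eq_square)

lemma lborel_square_gr: "test_fn \<Omega> f \<Longrightarrow> (\<integral>x. (norm (gr f x))\<^sup>2 \<partial>lborel) = pint \<Omega> 2 (gr f)"
proof -
  assume f: "test_fn \<Omega> f"
  have m: "gr f \<in> borel_measurable borel"
    by (rule measurable_vecI) (simp add: test_fn_borel_measurable[OF test_fn_pd[OF f]])
  have "(\<lambda>x. (norm (gr f x))\<^sup>2) \<in> borel_measurable borel" using m by measurable
  moreover have "gr f x = 0" if "x \<notin> \<Omega>" for x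
    using test_fn_outside[OF test_fn_pd[OF f] that] by (simp add: vec_eq_iff)
  ultimately show ?thesis unfolding pint_def by (intro integral_dom(2)[symmetric]) auto
qed

end

context sobolev_form
begin

text \<open>A Poincare-type bound, obtained from the L^4 estimate \<open>sob\<close> and the finite
  measure of \<Omega>.\<close>

lemma pint_GR_le: "U \<in> TF \<Longrightarrow> pint \<Omega> 2 (GR U) \<le> sqrt (measure lebesgue \<Omega> * S) * pint \<Omega> 2 (HS U)"
proof -
  assume U: "U \<in> TF"
  have "(pint \<Omega> 2 (GR U))\<^sup>2 \<le> measure lebesgue \<Omega> * pint \<Omega> 4 (GR U)"
    by (rule pint_2_le_pint_4[OF Lp_GR[OF U]]) simp
  also have "\<dots> \<le> measure lebesgue \<Omega> * (S * (pint \<Omega> 2 (HS U))\<^sup>2)"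
    by (intro mult_left_mono sob U) simp
  also have "\<dots> = (sqrt (measure lebesgue \<Omega> * S) * pint \<Omega> 2 (HS U))\<^sup>2"
    using S0 by (simp add: power_mult_distrib)
  finally show ?thesis by (rule power2_le_imp_le) (simp add: S0)
qed

lemma pint_pd_le: "U \<in> TF \<Longrightarrow> pint \<Omega> 2 (pd i (U c)) \<le> pint \<Omega> 2 (GR U)"
proof -
  assume U: "U \<in> TF"
  have L: "Lp \<Omega> 2 (GR U)" by (rule Lp_GR[OF U]) simp
  have "pint \<Omega> 2 (\<lambda>x. GR U x $ c $ i) \<le> pint \<Omega> 2 (GR U)"
    by (rule order_trans[OF Lp_nth(2)[OF Lp_nth(1)[OF L]] Lp_nth(2)[OF L]])
  then show ?thesis by (simp add: GR_def)
qed

text \<open>\<open>weakly_null\<close> is applied with the Hessian inner product as energy and, for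
  \<open>l\<close>, the integral of one partial derivative over a ball. These are the quantities
  whose convergence \<open>rellich\<close> asks for.\<close>

lemma TA_compact:
  assumes reg: "regular_solution \<Omega> h L \<Psi>"
    and \<phi>: "\<And>n::nat. \<phi> n \<in> TF" "\<And>n. pint \<Omega> 2 (HS (\<phi> n)) \<le> M"
    and lim: "\<And>w. w \<in> TF \<Longrightarrow> (\<lambda>n. TA (\<phi> n) w) \<longlonglongrightarrow> 0"
  shows "(\<lambda>n. pint \<Omega> 2 (GR (\<phi> n))) \<longlonglongrightarrow> 0"
proof -
  obtain \<beta> where \<beta>: "\<beta> > 0" "\<And>U e. U \<in> TF \<Longrightarrow> e \<ge> 0 \<Longrightarrow> (\<And>w. w \<in> TF \<Longrightarrow> (TA U w)\<^sup>2 \<le> e * pint \<Omega> 2 (HS w)) \<Longrightarrow>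
      \<beta> * pint \<Omega> 2 (HS U) \<le> e"
    by (rule infsup_TF[OF reg]) blast
  obtain C where C: "C \<ge> 0" "\<And>U V. U \<in> TF \<Longrightarrow> V \<in> TF \<Longrightarrow> (TA U V)\<^sup>2 \<le> C * pint \<Omega> 2 (HS U) * pint \<Omega> 2 (HS V)"
    using TA_bound by blast
  define Q where "Q = sqrt (measure lebesgue \<Omega> * S)"
  have Q0: "Q \<ge> 0" by (simp add: Q_def S0)
  have LH: "Lp \<Omega> 2 (HS U)" if "U \<in> TF" for U by (rule Lp_HS[OF that]) simp
  have weak: "(\<lambda>n. \<integral>x. indicator (cball y \<delta>) x * pd i (\<phi> n c) x \<partial>lborel) \<longlonglongrightarrow> 0" for y \<delta> i c
  proof (rule weakly_null[where V = TF and I = "\<lambda>U V. AF (HS U) (HS V)" and T = TA and C = C and \<beta> = \<beta>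
        and l = "\<lambda>U. \<integral>x. indicator (cball y \<delta>) x * pd i (U c) x \<partial>lborel" and K = "measure lborel (cball y \<delta>) * Q" and x = \<phi> and M = M])
    have ii: "integrable lborel (\<lambda>x. indicator (cball y \<delta>) x * pd i (U c) x)" if "U \<in> TF" for U
      using integrable_mult_indicator[OF _ test_fn_lborel_integrable[OF test_fn_pd[OF TF_D[OF that]]], of "cball y \<delta>"] by simp
    have pa: "pd i ((U + V) c) x = pd i (U c) x + pd i (V c) x" if "U \<in> TF" "V \<in> TF" for U V x
      using GR_add[OF that, of x] by (simp add: GR_def vec_eq_iff)
    have ps: "pd i ((a *\<^sub>R U) c) x = a * pd i (U c) x" if "U \<in> TF" for U a x
      using GR_scale[OF that, of a x] by (simp add: GR_def vec_eq_iff)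
    show "(\<integral>x. indicator (cball y \<delta>) x * pd i ((U + V) c) x \<partial>lborel)
        = (\<integral>x. indicator (cball y \<delta>) x * pd i (U c) x \<partial>lborel) + (\<integral>x. indicator (cball y \<delta>) x * pd i (V c) x \<partial>lborel)"
      if "U \<in> TF" "V \<in> TF" for U V
      using Bochner_Integration.integral_add[OF ii[OF that(1)] ii[OF that(2)]] by (simp only: pa[OF that] distrib_left)
    show "(\<integral>x. indicator (cball y \<delta>) x * pd i ((a *\<^sub>R U) c) x \<partial>lborel)
        = a * (\<integral>x. indicator (cball y \<delta>) x * pd i (U c) x \<partial>lborel)" if "U \<in> TF" for a U
      by (simp add: ps[OF that] mult.left_commute)
    show "(\<integral>x. indicator (cball y \<delta>) x * pd i (U c) x \<partial>lborel)\<^sup>2 \<le> measure lborel (cball y \<delta>) * Q * AF (HS U) (HS U)"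
      if U: "U \<in> TF" for U
    proof -
      have t: "test_fn \<Omega> (pd i (U c))" by (rule test_fn_pd[OF TF_D[OF U]])
      have iB: "integrable lborel (indicat_real (cball y \<delta>))"
        using emeasure_compact_finite[of "cball y \<delta>"] by (auto intro!: integrable_real_indicator)
      have sqB: "(indicat_real (cball y \<delta>) x)\<^sup>2 = indicat_real (cball y \<delta>) x" for x by (simp add: indicator_def)
      have ab: "\<bar>\<integral>x. indicator (cball y \<delta>) x * pd i (U c) x \<partial>lborel\<bar> \<le> (\<integral>x. \<bar>indicator (cball y \<delta>) x * pd i (U c) x\<bar> \<partial>lborel)"
        by (rule integral_abs_bound)
      have "(\<integral>x. indicator (cball y \<delta>) x * pd i (U c) x \<partial>lborel)\<^sup>2 \<le> (\<integral>x. \<bar>indicator (cball y \<delta>) x * pd i (U c) x\<bar> \<partial>lborel)\<^sup>2"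
        using power_mono[OF ab abs_ge_zero, of 2] by (simp only: power2_abs)
      also have "\<dots> \<le> (\<integral>x. (indicat_real (cball y \<delta>) x)\<^sup>2 \<partial>lborel) * (\<integral>x. (pd i (U c) x)\<^sup>2 \<partial>lborel)"
      proof (rule integral_Cauchy_Schwarz(2))
        show "integrable lborel (\<lambda>x. (indicat_real (cball y \<delta>) x)\<^sup>2)" unfolding sqB by (rule iB)
        show "indicat_real (cball y \<delta>) \<in> borel_measurable lborel" using iB by (rule borel_measurable_integrable)
        show "pd i (U c) \<in> borel_measurable lborel" using test_fn_borel_measurable[OF t] by simp
      qed (rule test_fn_square_lborel[OF t])
      also have "(\<integral>x. (indicat_real (cball y \<delta>) x)\<^sup>2 \<partial>lborel) = measure lborel (cball y \<delta>)" unfolding sqB by simp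
      also have "measure lborel (cball y \<delta>) * (\<integral>x. (pd i (U c) x)\<^sup>2 \<partial>lborel) \<le> measure lborel (cball y \<delta>) * (Q * AF (HS U) (HS U))"
        unfolding lborel_square_test_fn[OF t] AF_self Q_def
        by (intro mult_left_mono order_trans[OF pint_pd_le[OF U] pint_GR_le[OF U]]) simp
      finally show ?thesis by simp
    qed
    show "AF (HS (U + V)) (HS W) = AF (HS U) (HS W) + AF (HS V) (HS W)" if "U \<in> TF" "V \<in> TF" "W \<in> TF" for U V W
    proof -
      have "HS (U + V) = (\<lambda>x. 1 *\<^sub>R HS U x + 1 *\<^sub>R HS V x)" using that by (intro ext) (simp add: HS_add)
      then show ?thesis by (simp only: AF_combo[OF LH[OF that(1)] LH[OF that(2)] LH[OF that(3)]] mult_1)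
    qed
    show "AF (HS (a *\<^sub>R U)) (HS W) = a * AF (HS U) (HS W)" if "U \<in> TF" "W \<in> TF" for a U W
    proof -
      have "HS (a *\<^sub>R U) = (\<lambda>x. a *\<^sub>R HS U x + 0 *\<^sub>R HS U x)" using that by (intro ext) (simp add: HS_scale)
      then show ?thesis using AF_combo[OF LH[OF that(1)] LH[OF that(1)] LH[OF that(2)], of a 0] by simp
    qed
    show "(TA U W)\<^sup>2 \<le> C * AF (HS U) (HS U) * AF (HS W) (HS W)" if "U \<in> TF" "W \<in> TF" for U W
      unfolding AF_self by (rule C(2)[OF that])
    show "\<beta> * AF (HS U) (HS U) \<le> e" if "U \<in> TF" "e \<ge> 0" "\<And>w. w \<in> TF \<Longrightarrow> (TA U w)\<^sup>2 \<le> e * AF (HS w) (HS w)" for U e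
      using \<beta>(2)[OF that(1,2)] that(3) unfolding AF_self by blast
    show "TA (U + V) W = TA U W + TA V W" if "U \<in> TF" "V \<in> TF" "W \<in> TF" for U V W by (rule TA_combo(1)[OF that])
    show "TA (a *\<^sub>R U) W = a * TA U W" if "U \<in> TF" "W \<in> TF" for a U W by (rule TA_combo(2)[OF that(1) that])
    show "AF (HS U) (HS W) = AF (HS W) (HS U)" for U W by (rule AF_commute)
    show "AF (HS U) (HS U) \<ge> 0" for U unfolding AF_self by simp
    show "AF (HS (\<phi> n)) (HS (\<phi> n)) \<le> M" for n unfolding AF_self by (rule \<phi>(2))
    show "(\<lambda>n. TA (\<phi> n) w) \<longlonglongrightarrow> 0" if "w \<in> TF" for w by (rule lim[OF that])
  qed (use subspace_TF C(1) \<beta>(1) Q0 \<phi>(1) in auto)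
  have comp: "(\<lambda>n. pint \<Omega> 2 (pd i (\<phi> n c))) \<longlonglongrightarrow> 0" for i c
  proof -
    have t: "test_fn \<Omega> (pd i (\<phi> n c))" for n by (rule test_fn_pd[OF TF_D[OF \<phi>(1)]])
    \<comment> \<open>\<open>rellich\<close> wants one bound for a function and its gradient. Here
      these are a partial derivative, bounded by \<open>Q * M\<close>, and a row of the Hessian,
      bounded by \<open>M\<close>.\<close>
    have MM: "pint \<Omega> 2 (HS (\<phi> n)) \<le> max M (Q * M)" "pint \<Omega> 2 (GR (\<phi> n)) \<le> max M (Q * M)" for n
      using \<phi>(2)[of n] order_trans[OF pint_GR_le[OF \<phi>(1)[of n], folded Q_def] mult_left_mono[OF \<phi>(2)[of n] Q0]] by auto
    have "(\<lambda>n. \<integral>x. (pd i (\<phi> n c) x)\<^sup>2 \<partial>lborel) \<longlonglongrightarrow> 0"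
    proof (rule rellich[OF t _ _ weak, of "max M (Q * M)"])
      show "(\<integral>x. (pd i (\<phi> n c) x)\<^sup>2 \<partial>lborel) \<le> max M (Q * M)" for n
        unfolding lborel_square_test_fn[OF t] by (rule order_trans[OF pint_pd_le[OF \<phi>(1)] MM(2)])
      show "(\<integral>x. (norm (gr (pd i (\<phi> n c)) x))\<^sup>2 \<partial>lborel) \<le> max M (Q * M)" for n
      proof -
        have eq: "gr (pd i (\<phi> n c)) = (\<lambda>x. HS (\<phi> n) x $ c $ i)"
          by (auto simp: HS_def hs_def gr_def fun_eq_iff)
        show ?thesis unfolding lborel_square_gr[OF t] unfolding eq
          by (rule order_trans[OF order_trans[OF Lp_nth(2)[OF Lp_nth(1)[OF LH[OF \<phi>(1)]]] Lp_nth(2)[OF LH[OF \<phi>(1)]]] MM(1)])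
      qed
    qed
    then show ?thesis unfolding lborel_square_test_fn[OF t] .
  qed
  have "pint \<Omega> 2 (GR (\<phi> n)) = (\<Sum>c\<in>UNIV. \<Sum>i\<in>UNIV. pint \<Omega> 2 (pd i (\<phi> n c)))" for n
  proof -
    have t: "test_fn \<Omega> (\<phi> n c)" for c by (rule TF_D[OF \<phi>(1)])
    have "pint \<Omega> 2 (GR (\<phi> n)) = (\<Sum>c\<in>UNIV. pint \<Omega> 2 (gr (\<phi> n c)))"
      using pint_2_vec[of \<Omega> "GR (\<phi> n)"] Lp_gr[OF t, of 2] by (simp add: GR_def)
    also have "\<dots> = (\<Sum>c\<in>UNIV. \<Sum>i\<in>UNIV. pint \<Omega> 2 (pd i (\<phi> n c)))"
    proof (rule sum.cong[OF refl])
      fix c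
      show "pint \<Omega> 2 (gr (\<phi> n c)) = (\<Sum>i\<in>UNIV. pint \<Omega> 2 (pd i (\<phi> n c)))"
        using pint_2_vec[of \<Omega> "gr (\<phi> n c)"] Lp_test_fn[OF test_fn_pd[OF t]] by simp
    qed
    finally show ?thesis .
  qed
  moreover have "(\<lambda>n. \<Sum>c\<in>UNIV. \<Sum>i\<in>UNIV. pint \<Omega> 2 (pd i (\<phi> n c))) \<longlonglongrightarrow> 0"
    by (intro tendsto_null_sum comp)
  ultimately show ?thesis by simp
qed

end

section \<open>Estimates for a single Hessian discretisation\<close>

lemma XD_zero: "(\<lambda>_. 0) \<in> XD N"
  by (simp add: XD_def)

lemma lin_on_combo: "lin_on N F \<Longrightarrow> v \<in> XD N \<Longrightarrow> w \<in> XD N \<Longrightarrow> F (\<lambda>i. a * v i + b * w i) = (\<lambda>x. a *\<^sub>R F v x + b *\<^sub>R F w x)"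
  by (simp add: lin_on_def)

lemma lin_on_zero: "lin_on N F \<Longrightarrow> F (\<lambda>_. 0) = (\<lambda>_. 0)"
  using lin_on_combo[OF _ XD_zero XD_zero, of N F 0 0] by simp

definition dv :: "(real^'n::finite \<Rightarrow> real^'n^'n) \<Rightarrow> real^'n \<Rightarrow> real^'n" where
  "dv \<xi> x = (\<chi> i. \<Sum>j\<in>UNIV. pd j (\<lambda>y. \<xi> y $ i $ j) x)"

locale disc = bounded_open \<Omega> for \<Omega> :: "(real^'n::finite) set" +
  fixes N :: nat and PiD :: "(nat \<Rightarrow> real) \<Rightarrow> real^'n \<Rightarrow> real" and GD :: "(nat \<Rightarrow> real) \<Rightarrow> real^'n \<Rightarrow> real^'n"
    and HD :: "(nat \<Rightarrow> real) \<Rightarrow> real^'n \<Rightarrow> real^'n^'n" and ED :: "(nat \<Rightarrow> real) \<Rightarrow> real^'n \<Rightarrow> real"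
  assumes hd: "hessian_disc \<Omega> N PiD GD HD" and comp: "companion \<Omega> N ED"
begin

lemma lin: "lin_on N PiD" "lin_on N GD" "lin_on N HD" "lin_on N ED"
  using hd comp by (auto simp: hessian_disc_def companion_def)

lemma Lp_D: "w \<in> XD N \<Longrightarrow> Lp \<Omega> 2 (PiD w)" "w \<in> XD N \<Longrightarrow> Lp \<Omega> 4 (GD w)" "w \<in> XD N \<Longrightarrow> Lp \<Omega> 2 (HD w)"
  using hd by (auto simp: hessian_disc_def)

lemma Hm_ED: "w \<in> XD N \<Longrightarrow> Hm \<Omega> 2 (ED w)"
  using comp by (auto simp: companion_def H0m_def)

lemma normD_sq: "(normD \<Omega> HD w)\<^sup>2 = pint \<Omega> 2 (HD w)"
  by (simp add: normD_def lpnorm_pow)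

lemma normD_pos: "w \<in> XD N \<Longrightarrow> w \<noteq> (\<lambda>_. 0) \<Longrightarrow> normD \<Omega> HD w > 0"
  using hd lpnorm_nonneg[of \<Omega> 2 "HD w"] by (auto simp: hessian_disc_def normD_def less_le)

lemma SUP_quotient_bound:
  assumes "(SUP w\<in>XD N - {\<lambda>_. 0}. ereal (f w / normD \<Omega> HD w)) \<le> ereal C" "w \<in> XD N" "w \<noteq> (\<lambda>_. 0)"
  shows "f w \<le> C * normD \<Omega> HD w"
proof -
  have "ereal (f w / normD \<Omega> HD w) \<le> ereal C"
    using assms by (meson DiffI SUP_upper order_trans singletonD)
  then show ?thesis using normD_pos[OF assms(2,3)] by (simp add: divide_le_eq)
qed

lemma pint_le_of_lpnorm: "p > 0 \<Longrightarrow> lpnorm \<Omega> p u \<le> c \<Longrightarrow> pint \<Omega> p u \<le> c ^ p"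
  using power_mono[of "lpnorm \<Omega> p u" c p] by (simp add: lpnorm_pow)

lemma pint_GD_le:
  assumes C: "CD \<Omega> N PiD GD HD \<le> ereal C" and w: "w \<in> XD N"
  shows "pint \<Omega> 4 (GD w) \<le> C ^ 4 * (pint \<Omega> 2 (HD w))\<^sup>2"
proof (cases "w = (\<lambda>_. 0)")
  case True
  then show ?thesis using lin_on_zero[OF lin(2)] by (simp add: pint_def[of \<Omega> 4])
next
  case False
  have "max (lpnorm \<Omega> 2 (PiD w)) (lpnorm \<Omega> 4 (GD w)) \<le> C * normD \<Omega> HD w"
    by (rule SUP_quotient_bound[OF C[unfolded CD_def] w False])
  then have "pint \<Omega> 4 (GD w) \<le> (C * normD \<Omega> HD w) ^ 4" by (intro pint_le_of_lpnorm) auto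
  then show ?thesis by (simp only: power_mult_distrib square_square[symmetric] normD_sq)
qed

lemma pint_whess_ED_le:
  assumes C: "GammaE \<Omega> N HD ED \<le> ereal C" and w: "w \<in> XD N"
  shows "pint \<Omega> 2 (whess \<Omega> (ED w)) \<le> C\<^sup>2 * pint \<Omega> 2 (HD w)"
proof (cases "w = (\<lambda>_. 0)")
  case True
  \<comment> \<open>The supremum leaves out \<open>w = 0\<close>. The companion is then the zero
    function, but its Hessian is still a chosen weak derivative and vanishes almost everywhere
    only.\<close>
  have e0: "ED w = (\<lambda>_. 0)" using True lin_on_zero[OF lin(4)] by simp
  have "pint \<Omega> 2 (whess \<Omega> (ED w)) = pint \<Omega> 2 (hs (\<lambda>_::real^'n. 0))"
    using Lp_measurable[OF Lp_whess[OF Hm_ED[OF w]]] Lp_measurable[OF Lp_hs[OF test_fn_zero, of 2]]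
      AE_whess_test_fn[OF test_fn_zero] unfolding e0 by (intro pint_cong_AE) auto
  also have "hs (\<lambda>_::real^'n. 0) = (\<lambda>_. 0)" by (auto simp: hs_def pd_const vec_eq_iff fun_eq_iff)
  finally show ?thesis by (simp add: pint_def[of \<Omega> 2 "\<lambda>_. 0"])
next
  case False
  have "lpnorm \<Omega> 2 (whess \<Omega> (ED w)) \<le> C * normD \<Omega> HD w"
    by (rule SUP_quotient_bound[OF C[unfolded GammaE_def] w False])
  then have "pint \<Omega> 2 (whess \<Omega> (ED w)) \<le> (C * normD \<Omega> HD w)\<^sup>2" by (intro pint_le_of_lpnorm) auto
  then show ?thesis by (simp only: power_mult_distrib normD_sq)
qed

lemma pint_omega_le:
  assumes C: "omegaE \<Omega> N GD HD ED \<le> ereal C" and w: "w \<in> XD N"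
  shows "pint \<Omega> 2 (\<lambda>x. GD w x - wgrad \<Omega> (ED w) x) \<le> C\<^sup>2 * pint \<Omega> 2 (HD w)"
proof (cases "w = (\<lambda>_. 0)")
  case True
  have e0: "ED w = (\<lambda>_. 0)" "GD w = (\<lambda>_. 0)" using True lin_on_zero[OF lin(4)] lin_on_zero[OF lin(2)] by auto
  have "pint \<Omega> 2 (wgrad \<Omega> (ED w)) = pint \<Omega> 2 (gr (\<lambda>_::real^'n. 0))"
    using Lp_measurable[OF Lp_wgrad[OF Hm_ED[OF w]]] Lp_measurable[OF Lp_gr[OF test_fn_zero, of 2]]
      AE_wgrad_test_fn[OF test_fn_zero] unfolding e0 by (intro pint_cong_AE) auto
  also have "gr (\<lambda>_::real^'n. 0) = (\<lambda>_. 0)" by (auto simp: pd_const vec_eq_iff fun_eq_iff)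
  finally show ?thesis by (simp add: e0 pint_uminus pint_def[of \<Omega> 2 "\<lambda>_. 0"])
next
  case False
  have "lpnorm \<Omega> 2 (\<lambda>x. GD w x - wgrad \<Omega> (ED w) x) \<le> C * normD \<Omega> HD w"
    by (rule SUP_quotient_bound[OF C[unfolded omegaE_def] w False])
  then have "pint \<Omega> 2 (\<lambda>x. GD w x - wgrad \<Omega> (ED w) x) \<le> (C * normD \<Omega> HD w)\<^sup>2" by (intro pint_le_of_lpnorm) auto
  then show ?thesis by (simp only: power_mult_distrib normD_sq)
qed

lemma hnorm_nonneg: "hnorm \<Omega> m u \<ge> 0"
  unfolding hnorm_def by (intro real_sqrt_ge_zero sum_nonneg) simp

text \<open>\<open>SD\<close> is an infimum, so a positive slack \<open>e\<close> replaces an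
  attained minimum. The supremum in \<open>alphaD\<close> skips functions of zero norm, but such a
  test function is 0 and \<open>w = 0\<close> interpolates it exactly.\<close>

lemma SD_le:
  assumes \<rho>: "alphaD \<Omega> N PiD GD HD \<le> ereal \<rho>" and f: "test_fn \<Omega> f" and H20: "H20 \<Omega> f" and e: "e > 0"
  obtains w where "w \<in> XD N" "pint \<Omega> 4 (\<lambda>x. GD w x - gr f x) \<le> (\<rho> * hnorm \<Omega> 3 f + e) ^ 4"
    "pint \<Omega> 2 (\<lambda>x. HD w x - hs f x) \<le> (\<rho> * hnorm \<Omega> 3 f + e)\<^sup>2"
proof (cases "hnorm \<Omega> 3 f = 0")
  case True
  then have f0: "f = (\<lambda>_. 0)" by (rule test_fn_eq_0_of_hnorm[OF f])
  have "(\<lambda>x. GD (\<lambda>_. 0) x - gr f x) = (\<lambda>_. 0)" "(\<lambda>x. HD (\<lambda>_. 0) x - hs f x) = (\<lambda>_. 0)"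
    using lin_on_zero[OF lin(2)] lin_on_zero[OF lin(3)] by (auto simp: f0 hs_def pd_const vec_eq_iff fun_eq_iff)
  then show ?thesis by (intro that[OF XD_zero]) (simp_all add: pint_def)
next
  case False
  then have hp: "hnorm \<Omega> 3 f > 0" using hnorm_nonneg[of 3 f] by simp
  define F where "F w = lpnorm \<Omega> 2 (\<lambda>x. PiD w x - f x) + lpnorm \<Omega> 4 (\<lambda>x. GD w x - wgrad \<Omega> f x)
     + lpnorm \<Omega> 2 (\<lambda>x. HD w x - whess \<Omega> f x)" for w
  have "ereal (SD \<Omega> N PiD GD HD f / hnorm \<Omega> 3 f) \<le> ereal \<rho>"
    using \<rho> unfolding alphaD_def SUP_le_iff using False Hm_test_fn[OF f] H20 by simp
  then have "SD \<Omega> N PiD GD HD f \<le> \<rho> * hnorm \<Omega> 3 f" using hp by (simp add: divide_le_eq)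
  then have "(INF w\<in>XD N. F w) < \<rho> * hnorm \<Omega> 3 f + e" using e by (simp add: SD_def F_def)
  then obtain w where w: "w \<in> XD N" "F w < \<rho> * hnorm \<Omega> 3 f + e"
    using cInf_lessD[of "F ` XD N"] XD_zero by auto
  have l: "lpnorm \<Omega> 4 (\<lambda>x. GD w x - wgrad \<Omega> f x) \<le> \<rho> * hnorm \<Omega> 3 f + e"
    "lpnorm \<Omega> 2 (\<lambda>x. HD w x - whess \<Omega> f x) \<le> \<rho> * hnorm \<Omega> 3 f + e"
    using w(2) lpnorm_nonneg[of \<Omega> 2 "\<lambda>x. PiD w x - f x"] lpnorm_nonneg[of \<Omega> 4 "\<lambda>x. GD w x - wgrad \<Omega> f x"]
      lpnorm_nonneg[of \<Omega> 2 "\<lambda>x. HD w x - whess \<Omega> f x"] unfolding F_def by linarith+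
  have g: "pint \<Omega> 4 (\<lambda>x. GD w x - gr f x) = pint \<Omega> 4 (\<lambda>x. GD w x - wgrad \<Omega> f x)"
  proof (rule pint_cong_AE)
    show "AE x in lebesgue_on \<Omega>. GD w x - gr f x = GD w x - wgrad \<Omega> f x"
      using AE_wgrad_test_fn[OF f] by eventually_elim simp
  qed (rule borel_measurable_diff[OF Lp_measurable[OF Lp_D(2)[OF w(1)]] Lp_measurable[OF Lp_gr[OF f, of 2]]], simp,
      rule borel_measurable_diff[OF Lp_measurable[OF Lp_D(2)[OF w(1)]] Lp_measurable[OF Lp_wgrad[OF Hm_test_fn[OF f]]]])
  have h: "pint \<Omega> 2 (\<lambda>x. HD w x - hs f x) = pint \<Omega> 2 (\<lambda>x. HD w x - whess \<Omega> f x)"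
  proof (rule pint_cong_AE)
    show "AE x in lebesgue_on \<Omega>. HD w x - hs f x = HD w x - whess \<Omega> f x"
      using AE_whess_test_fn[OF f] by eventually_elim simp
  qed (rule borel_measurable_diff[OF Lp_measurable[OF Lp_D(3)[OF w(1)]] Lp_measurable[OF Lp_hs[OF f, of 2]]], simp,
      rule borel_measurable_diff[OF Lp_measurable[OF Lp_D(3)[OF w(1)]] Lp_measurable[OF Lp_whess[OF Hm_test_fn[OF f]]]])
  show ?thesis
    by (rule that[OF w(1)]) (use l in \<open>auto simp: g h intro: pint_le_of_lpnorm\<close>)
qed

text \<open>Unfolds the nested suprema of \<open>gammaD\<close> and \<open>WD\<close> into one
  inequality and trades the weak divergence for the classical one, which integration by parts can
  handle.\<close>

lemma WD_le:
  assumes \<rho>: "gammaD \<Omega> N GD HD \<le> ereal \<rho>" and \<xi>: "\<And>i j. test_fn \<Omega> (\<lambda>x. \<xi> x $ i $ j)" and w: "w \<in> XD N"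
  shows "\<bar>LINT x|lebesgue_on \<Omega>. \<xi> x \<bullet> HD w x + dv \<xi> x \<bullet> GD w x\<bar> \<le> \<rho> * hnorm1mat \<Omega> \<xi> * normD \<Omega> HD w"
proof -
  have Lx: "Lp \<Omega> 2 \<xi>" by (intro Lp_vecI Lp_test_fn[OF \<xi>]) auto
  have Ld: "Lp \<Omega> 2 (dv \<xi>)"
    by (rule Lp_vecI) (auto simp: dv_def intro!: Lp_test_fn test_fn_sum test_fn_pd \<xi>)
  have ae: "AE x in lebesgue_on \<Omega>. wdiv \<Omega> \<xi> x = dv \<xi> x"
  proof -
    have "AE x in lebesgue_on \<Omega>. \<forall>ij\<in>UNIV. wd \<Omega> [snd ij] (\<lambda>y. \<xi> y $ fst ij $ snd ij) x = pd (snd ij) (\<lambda>y. \<xi> y $ fst ij $ snd ij) x"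
    proof (intro AE_finite_allI)
      show "AE x in lebesgue_on \<Omega>. wd \<Omega> [snd ij] (\<lambda>y. \<xi> y $ fst ij $ snd ij) x = pd (snd ij) (\<lambda>y. \<xi> y $ fst ij $ snd ij) x" for ij
        using wd_test_fn[OF \<xi>[of "fst ij" "snd ij"], of "[snd ij]"] by simp
    qed auto
    then show ?thesis by eventually_elim (auto simp: wdiv_def dv_def vec_eq_iff intro!: sum.cong)
  qed
  have wm: "wdiv \<Omega> \<xi> \<in> borel_measurable (lebesgue_on \<Omega>)"
  proof (rule measurable_vecI)
    have "wd \<Omega> [j] (\<lambda>y. \<xi> y $ i $ j) \<in> borel_measurable (lebesgue_on \<Omega>)" for i j
      by (rule Lp_measurable[OF Hm_wd(1)[OF Hm_test_fn[OF \<xi>], of "[j]" 1]]) simp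
    then show "(\<lambda>x. wdiv \<Omega> \<xi> x $ i) \<in> borel_measurable (lebesgue_on \<Omega>)" for i
      unfolding wdiv_def by (simp add: borel_measurable_sum)
  qed
  have eq: "(LINT x|lebesgue_on \<Omega>. \<xi> x \<bullet> HD w x + dv \<xi> x \<bullet> GD w x) = (LINT x|lebesgue_on \<Omega>. \<xi> x \<bullet> HD w x + wdiv \<Omega> \<xi> x \<bullet> GD w x)"
  proof (rule integral_cong_AE)
    show "AE x in lebesgue_on \<Omega>. \<xi> x \<bullet> HD w x + dv \<xi> x \<bullet> GD w x = \<xi> x \<bullet> HD w x + wdiv \<Omega> \<xi> x \<bullet> GD w x"
      using ae by eventually_elim simp
  qed (intro borel_measurable_add borel_measurable_inner wm Lp_measurable[OF Lx] Lp_measurable[OF Ld]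
      Lp_measurable[OF Lp_D(2)[OF w]] Lp_measurable[OF Lp_D(3)[OF w]])+
  \<comment> \<open>The suprema leave out \<open>w = 0\<close> and fields \<xi> of zero norm; in
    both cases the two sides of the inequality are 0.\<close>
  show ?thesis
  proof (cases "w = (\<lambda>_. 0) \<or> hnorm1mat \<Omega> \<xi> = 0")
    case False
    then have hp: "hnorm1mat \<Omega> \<xi> > 0" "hnorm1mat \<Omega> \<xi> \<noteq> 0"
      by (auto simp: hnorm1mat_def less_le intro!: sum_nonneg)
    have H1: "H1mat \<Omega> \<xi>" using Hm_test_fn[OF \<xi>] by (simp add: H1mat_def)
    have "WD \<Omega> N GD HD \<xi> / ereal (hnorm1mat \<Omega> \<xi>) \<le> ereal \<rho>"
      using \<rho> H1 hp(2) unfolding gammaD_def SUP_le_iff by blast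
    then have "WD \<Omega> N GD HD \<xi> \<le> ereal (\<rho> * hnorm1mat \<Omega> \<xi>)"
      using hp by (simp add: ereal_divide_le_pos mult.commute)
    from SUP_quotient_bound[OF this[unfolded WD_def] w] False show ?thesis by (simp add: eq)
  next
    case True
    then have "(\<forall>x. \<xi> x \<bullet> HD w x + dv \<xi> x \<bullet> GD w x = 0) \<and> (w = (\<lambda>_. 0) \<or> hnorm1mat \<Omega> \<xi> = 0)"
    proof
      assume "w = (\<lambda>_. 0)"
      then show ?thesis using lin_on_zero[OF lin(2)] lin_on_zero[OF lin(3)] by simp
    next
      assume z: "hnorm1mat \<Omega> \<xi> = 0"
      then have "(\<Sum>i\<in>UNIV. \<Sum>j\<in>UNIV. (hnorm \<Omega> 1 (\<lambda>x. \<xi> x $ i $ j))\<^sup>2) = 0"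
        by (simp add: hnorm1mat_def)
      then have "hnorm \<Omega> 1 (\<lambda>x. \<xi> x $ i $ j) = 0" for i j
        by (simp add: sum_nonneg_eq_0_iff sum_nonneg)
      then have "(\<lambda>x. \<xi> x $ i $ j) = (\<lambda>_. 0)" for i j
        by (intro test_fn_eq_0_of_hnorm[OF \<xi>])
      then have "\<xi> = (\<lambda>_. 0)" "dv \<xi> = (\<lambda>_. 0)"
        by (auto simp: dv_def vec_eq_iff fun_eq_iff pd_const)
      then show ?thesis using z by simp
    qed
    then show ?thesis using lin_on_zero[OF lin(3)] by (auto simp: normD_def lpnorm_def)
  qed
qed

end

section \<open>Sequences of Hessian discretisations\<close>

lemma pint_4_vec:
  fixes f :: "real^'n::finite \<Rightarrow> ('v::euclidean_space)^'m::finite"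
  assumes "\<And>i. Lp \<Omega> 4 (\<lambda>x. f x $ i)"
  shows "pint \<Omega> 4 f \<le> real CARD('m) * (\<Sum>i\<in>UNIV. pint \<Omega> 4 (\<lambda>x. f x $ i))"
proof -
  have n2: "(norm (f x))\<^sup>2 = (\<Sum>i\<in>UNIV. (norm (f x $ i))\<^sup>2)" for x
    unfolding norm_vec_def L2_set_def by (rule real_sqrt_pow2) (auto intro: sum_nonneg)
  have le: "norm (f x) ^ 4 \<le> (\<Sum>i\<in>UNIV. norm (f x $ i) ^ 4) * real CARD('m)" for x
    using sum_squared_le_sum_of_squares[of "\<lambda>i. (norm (f x $ i))\<^sup>2" UNIV]
    unfolding n2[symmetric] square_square by simp
  have Lf: "Lp \<Omega> 4 f" by (rule Lp_vecI) (simp_all add: assms)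
  have i: "integrable (lebesgue_on \<Omega>) (\<lambda>x. norm (f x $ i) ^ 4)" for i using assms by (simp add: Lp_def)
  have "pint \<Omega> 4 f \<le> (LINT x|lebesgue_on \<Omega>. (\<Sum>i\<in>UNIV. norm (f x $ i) ^ 4) * real CARD('m))"
    unfolding pint_def
    by (rule integral_mono) (use Lf i le in \<open>auto simp: Lp_def intro!: integrable_mult_left Bochner_Integration.integrable_sum\<close>)
  also have "\<dots> = real CARD('m) * (\<Sum>i\<in>UNIV. pint \<Omega> 4 (\<lambda>x. f x $ i))"
    using i by (simp add: pint_def Bochner_Integration.integral_sum)
  finally show ?thesis .
qed

text \<open>The conforming counterpart of the expression in \<open>WD\<close>: for a true gradient
  and Hessian the two pairings cancel.\<close>

lemma (in bounded_open) integral_dv_gr: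
  assumes \<xi>: "\<And>i j. test_fn \<Omega> (\<lambda>x. \<xi> x $ i $ j)" and f: "test_fn \<Omega> f"
  shows "(LINT x|lebesgue_on \<Omega>. dv \<xi> x \<bullet> gr f x) = - (LINT x|lebesgue_on \<Omega>. \<xi> x \<bullet> hs f x)"
proof -
  have e1: "dv \<xi> x \<bullet> gr f x = (\<Sum>i\<in>UNIV. \<Sum>j\<in>UNIV. pd j (\<lambda>y. \<xi> y $ i $ j) x * pd i f x)" for x
    by (simp add: dv_def inner_vec_def sum_distrib_right)
  have e2: "\<xi> x \<bullet> hs f x = (\<Sum>i\<in>UNIV. \<Sum>j\<in>UNIV. \<xi> x $ i $ j * pd j (pd i f) x)" for x
    by (simp add: hs_def inner_vec_def)
  have i1: "integrable (lebesgue_on \<Omega>) (\<lambda>x. pd j (\<lambda>y. \<xi> y $ i $ j) x * pd i f x)" for i j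
    by (intro Lp_mult_integrable Lp_test_fn test_fn_pd \<xi> f)
  have i2: "integrable (lebesgue_on \<Omega>) (\<lambda>x. \<xi> x $ i $ j * pd j (pd i f) x)" for i j
    by (intro Lp_mult_integrable Lp_test_fn test_fn_pd \<xi> f)
  have p: "(LINT x|lebesgue_on \<Omega>. pd j (\<lambda>y. \<xi> y $ i $ j) x * pd i f x) = - (LINT x|lebesgue_on \<Omega>. \<xi> x $ i $ j * pd j (pd i f) x)" for i j
  proof -
    have "(\<integral>x. pd j (\<lambda>y. \<xi> y $ i $ j) x * pd i f x \<partial>lborel) = - (\<integral>x. \<xi> x $ i $ j * pd j (pd i f) x \<partial>lborel)"
      by (rule integral_by_parts[OF test_fn_mono[OF \<xi>] test_fn_mono[OF test_fn_pd[OF f]]]) auto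
    then show ?thesis
      unfolding integral_mult_test[OF test_fn_pd[OF \<xi>] test_fn_smooth[OF test_fn_pd[OF f]]]
        integral_mult_test[OF \<xi> test_fn_smooth[OF test_fn_pd[OF test_fn_pd[OF f]]]] .
  qed
  show ?thesis
    unfolding e1 e2 using i1 i2 p by (simp add: Bochner_Integration.integral_sum sum_negf)
qed

locale disc_sequence = hform \<Omega> h for \<Omega> :: "(real^'n::finite) set"
    and h :: "real^'n^'k \<Rightarrow> real^'n^'k \<Rightarrow> real^'n^'n^'k::finite" +
  fixes C :: real and N :: "nat \<Rightarrow> nat" and PiD :: "nat \<Rightarrow> (nat \<Rightarrow> real) \<Rightarrow> real^'n \<Rightarrow> real"
    and GD :: "nat \<Rightarrow> (nat \<Rightarrow> real) \<Rightarrow> real^'n \<Rightarrow> real^'n" and HD :: "nat \<Rightarrow> (nat \<Rightarrow> real) \<Rightarrow> real^'n \<Rightarrow> real^'n^'n"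
    and ED :: "nat \<Rightarrow> (nat \<Rightarrow> real) \<Rightarrow> real^'n \<Rightarrow> real"
  assumes hdn: "\<And>n. hessian_disc \<Omega> (N n) (PiD n) (GD n) (HD n)" and compn: "\<And>n. companion \<Omega> (N n) (ED n)"
    and CDn: "\<And>n. CD \<Omega> (N n) (PiD n) (GD n) (HD n) \<le> ereal C"
    and GammaEn: "\<And>n. GammaE \<Omega> (N n) (HD n) (ED n) \<le> ereal C"
    and omegaEn: "\<And>n. omegaE \<Omega> (N n) (GD n) (HD n) (ED n) \<le> ereal (inverse (real (Suc n)))"
    and alphaDn: "\<And>n. alphaD \<Omega> (N n) (PiD n) (GD n) (HD n) \<le> ereal (inverse (real (Suc n)))"
    and gammaDn: "\<And>n. gammaD \<Omega> (N n) (GD n) (HD n) \<le> ereal (inverse (real (Suc n)))"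
begin

lemma disc_n: "disc \<Omega> (N n) (PiD n) (GD n) (HD n) (ED n)"
  by (intro disc.intro disc_axioms.intro bounded_open_axioms hdn compn)

definition XK :: "nat \<Rightarrow> ('k \<Rightarrow> nat \<Rightarrow> real) set" where
  "XK n = {W. \<forall>c. W c \<in> XD (N n)}"

definition GK :: "nat \<Rightarrow> ('k \<Rightarrow> nat \<Rightarrow> real) \<Rightarrow> real^'n \<Rightarrow> real^'n^'k" where
  "GK n W x = (\<chi> c. GD n (W c) x)"

definition HK :: "nat \<Rightarrow> ('k \<Rightarrow> nat \<Rightarrow> real) \<Rightarrow> real^'n \<Rightarrow> real^'n^'n^'k" where
  "HK n W x = (\<chi> c. HD n (W c) x)"

lemma XK_D: "W \<in> XK n \<Longrightarrow> W c \<in> XD (N n)"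
  by (simp add: XK_def)

lemma Lp_GK: "W \<in> XK n \<Longrightarrow> Lp \<Omega> 4 (GK n W)"
  by (rule Lp_vecI) (simp_all add: GK_def disc.Lp_D(2)[OF disc_n] XK_D)

lemma Lp_HK: "W \<in> XK n \<Longrightarrow> Lp \<Omega> 2 (HK n W)"
  by (rule Lp_vecI) (simp_all add: HK_def disc.Lp_D(3)[OF disc_n] XK_D)

lemma pint_HD_le: "W \<in> XK n \<Longrightarrow> pint \<Omega> 2 (HD n (W c)) \<le> pint \<Omega> 2 (HK n W)"
  using Lp_nth(2)[OF Lp_HK, of W n c] by (simp add: HK_def)

lemma pint_GK_le:
  assumes W: "W \<in> XK n"
  shows "pint \<Omega> 4 (GK n W) \<le> (real CARD('k))\<^sup>2 * C ^ 4 * (pint \<Omega> 2 (HK n W))\<^sup>2"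
proof -
  have "pint \<Omega> 4 (GK n W) \<le> real CARD('k) * (\<Sum>c\<in>UNIV. pint \<Omega> 4 (\<lambda>x. GK n W x $ c))"
    by (rule pint_4_vec[OF Lp_nth(1)[OF Lp_GK[OF W]]])
  also have "\<dots> \<le> real CARD('k) * (\<Sum>c\<in>(UNIV::'k set). C ^ 4 * (pint \<Omega> 2 (HK n W))\<^sup>2)"
  proof (intro mult_left_mono sum_mono)
    fix c
    have "pint \<Omega> 4 (GD n (W c)) \<le> C ^ 4 * (pint \<Omega> 2 (HD n (W c)))\<^sup>2"
      by (rule disc.pint_GD_le[OF disc_n CDn XK_D[OF W]])
    also have "\<dots> \<le> C ^ 4 * (pint \<Omega> 2 (HK n W))\<^sup>2"
      by (intro mult_left_mono power_mono pint_HD_le[OF W]) (simp_all add: zero_le_even_power)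
    finally show "pint \<Omega> 4 (\<lambda>x. GK n W x $ c) \<le> C ^ 4 * (pint \<Omega> 2 (HK n W))\<^sup>2" by (simp add: GK_def)
  qed simp
  also have "\<dots> = (real CARD('k))\<^sup>2 * C ^ 4 * (pint \<Omega> 2 (HK n W))\<^sup>2" by (simp add: power2_eq_square)
  finally show ?thesis .
qed

lemma discLinA_XK:
  "discLinA \<Omega> h \<Psi> (GD n) (HD n) V W = AF (HK n V) (HK n W) + BF (WH \<Psi>) (GK n V) (GK n W) + BF (HK n V) (WG \<Psi>) (GK n W)"
  by (simp add: discLinA_def Aform_eq_AF Bform_eq_BF HK_def[abs_def] GK_def[abs_def] WH_def[abs_def] WG_def[abs_def])

text \<open>The H^3 norm of a fixed test family is a constant, so the interpolation error is
  governed by \<open>alphaD\<close> and tends to 0 along the sequence.\<close>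

lemma interpolation:
  assumes U: "U \<in> TF"
  obtains W where "\<And>n. W n \<in> XK n" "(\<lambda>n. pint \<Omega> 4 (\<lambda>x. GK n (W n) x - GR U x)) \<longlonglongrightarrow> 0"
    "(\<lambda>n. pint \<Omega> 2 (\<lambda>x. HK n (W n) x - HS U x)) \<longlonglongrightarrow> 0"
proof -
  define s where "s n = inverse (real (Suc n))" for n
  have s: "s \<longlonglongrightarrow> 0" unfolding s_def by (rule LIMSEQ_inverse_real_of_nat)
  \<comment> \<open>The first summand is the consistency bound; the second is the slack of a
    near-minimiser in \<open>SD\<close>, made to vanish as well.\<close>
  define r where "r c n = s n * hnorm \<Omega> 3 (U c) + s n" for c n
  have r: "r c \<longlonglongrightarrow> 0" for c
    unfolding r_def using tendsto_add[OF tendsto_mult_left_zero[OF s] s] by simp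
  define P where "P n c w \<longleftrightarrow> w \<in> XD (N n) \<and> pint \<Omega> 4 (\<lambda>x. GD n w x - gr (U c) x) \<le> r c n ^ 4
      \<and> pint \<Omega> 2 (\<lambda>x. HD n w x - hs (U c) x) \<le> (r c n)\<^sup>2" for n c w
  have "\<exists>w. P n c w" for n c
  proof -
    have sp: "s n > 0" by (simp add: s_def)
    obtain w where "w \<in> XD (N n)" "pint \<Omega> 4 (\<lambda>x. GD n w x - gr (U c) x) \<le> (inverse (real (Suc n)) * hnorm \<Omega> 3 (U c) + s n) ^ 4"
      "pint \<Omega> 2 (\<lambda>x. HD n w x - hs (U c) x) \<le> (inverse (real (Suc n)) * hnorm \<Omega> 3 (U c) + s n)\<^sup>2"
      by (rule disc.SD_le[OF disc_n alphaDn TF_D[OF U] TF_H20[OF U] sp])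
    then have "P n c w" unfolding P_def r_def s_def by blast
    then show ?thesis by blast
  qed
  then have "\<forall>n. \<forall>c. \<exists>w. P n c w" by blast
  then obtain W where W0: "\<And>n c. P n c (W n c)" unfolding choice_iff by blast
  have W: "W n \<in> XK n" for n using W0 by (simp add: XK_def P_def)
  have L4: "Lp \<Omega> 4 (\<lambda>x. GK n (W n) x - GR U x)" for n
    by (rule Lp_diff(1)[OF Lp_GK[OF W] Lp_GR[OF U]]) simp
  have L2: "Lp \<Omega> 2 (\<lambda>x. HK n (W n) x - HS U x)" for n
    by (rule Lp_diff(1)[OF Lp_HK[OF W] Lp_HS[OF U]]) simp
  have b4: "pint \<Omega> 4 (\<lambda>x. GK n (W n) x - GR U x) \<le> real CARD('k) * (\<Sum>c\<in>UNIV. r c n ^ 4)" for n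
  proof (rule order_trans[OF pint_4_vec[OF Lp_nth(1)[OF L4]]], intro mult_left_mono sum_mono)
    show "pint \<Omega> 4 (\<lambda>x. (GK n (W n) x - GR U x) $ c) \<le> r c n ^ 4" for c
      using W0[of n c] by (simp add: GK_def GR_def P_def)
  qed simp
  have b2: "pint \<Omega> 2 (\<lambda>x. HK n (W n) x - HS U x) \<le> (\<Sum>c\<in>UNIV. (r c n)\<^sup>2)" for n
    unfolding pint_2_vec[OF Lp_nth(1)[OF L2]]
  proof (rule sum_mono)
    show "pint \<Omega> 2 (\<lambda>x. (HK n (W n) x - HS U x) $ c) \<le> (r c n)\<^sup>2" for c
      using W0[of n c] by (simp add: HK_def HS_def P_def)
  qed
  have p: "(\<lambda>n. r c n ^ q) \<longlonglongrightarrow> 0" if "q > 0" for c q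
    using r[of c] that by simp
  have "(\<lambda>n. \<Sum>c\<in>UNIV. r c n ^ 4) \<longlonglongrightarrow> 0" by (rule tendsto_null_sum) (simp add: r)
  then have l4: "(\<lambda>n. real CARD('k) * (\<Sum>c\<in>UNIV. r c n ^ 4)) \<longlonglongrightarrow> 0" by (rule tendsto_mult_right_zero)
  have l2: "(\<lambda>n. \<Sum>c\<in>UNIV. (r c n)\<^sup>2) \<longlonglongrightarrow> 0" by (rule tendsto_null_sum) (simp add: r)
  show ?thesis
    by (rule that[OF W tendsto_0_squeeze[OF pint_nonneg b4 l4] tendsto_0_squeeze[OF pint_nonneg b2 l2]])
qed

text \<open>The stability of the discrete gradients carries over to the limit, where it is a Sobolev
  inequality; no embedding theorem is needed.\<close>

lemma sobolev_inequality:
  assumes U: "U \<in> TF"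
  shows "pint \<Omega> 4 (GR U) \<le> 256 * ((real CARD('k))\<^sup>2 * C ^ 4) * (pint \<Omega> 2 (HS U))\<^sup>2"
proof -
  define K where "K = (real CARD('k))\<^sup>2 * C ^ 4"
  have K0: "K \<ge> 0" by (simp add: K_def zero_le_even_power)
  obtain W where W: "\<And>n. W n \<in> XK n" "(\<lambda>n. pint \<Omega> 4 (\<lambda>x. GK n (W n) x - GR U x)) \<longlonglongrightarrow> 0"
    "(\<lambda>n. pint \<Omega> 2 (\<lambda>x. HK n (W n) x - HS U x)) \<longlonglongrightarrow> 0"
    by (rule interpolation[OF U]) blast
  define d4 where "d4 n = pint \<Omega> 4 (\<lambda>x. GK n (W n) x - GR U x)" for n
  define d2 where "d2 n = pint \<Omega> 2 (\<lambda>x. HK n (W n) x - HS U x)" for n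
  have L4: "Lp \<Omega> 4 (\<lambda>x. GK n (W n) x - GR U x)" for n
    by (rule Lp_diff(1)[OF Lp_GK[OF W(1)] Lp_GR[OF U]]) simp
  have L2: "Lp \<Omega> 2 (\<lambda>x. HK n (W n) x - HS U x)" for n
    by (rule Lp_diff(1)[OF Lp_HK[OF W(1)] Lp_HS[OF U]]) simp
  have LS: "Lp \<Omega> 2 (HS U)" by (rule Lp_HS[OF U]) simp
  \<comment> \<open>The triangle inequality costs \<open>2 ^ 4\<close> for the gradients and
    \<open>2\<^sup>2\<close>, squared, for the Hessians; the product is the constant 256.\<close>
  have le: "pint \<Omega> 4 (GR U) \<le> 2 ^ 4 * (K * (2\<^sup>2 * (d2 n + pint \<Omega> 2 (HS U)))\<^sup>2 + d4 n)" for n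
  proof -
    have "pint \<Omega> 2 (HK n (W n)) \<le> 2\<^sup>2 * (d2 n + pint \<Omega> 2 (HS U))"
      using Lp_add(2)[OF L2[of n] LS] by (simp add: d2_def)
    then have "K * (pint \<Omega> 2 (HK n (W n)))\<^sup>2 \<le> K * (2\<^sup>2 * (d2 n + pint \<Omega> 2 (HS U)))\<^sup>2"
      using K0 by (intro mult_left_mono power_mono) auto
    then have "pint \<Omega> 4 (GK n (W n)) \<le> K * (2\<^sup>2 * (d2 n + pint \<Omega> 2 (HS U)))\<^sup>2"
      using pint_GK_le[OF W(1), of n] unfolding K_def by linarith
    moreover have "pint \<Omega> 4 (GR U) \<le> 2 ^ 4 * (pint \<Omega> 4 (GK n (W n)) + d4 n)"
      using Lp_diff(2)[OF Lp_GK[OF W(1)] L4, of n n] by (simp add: d4_def)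
    ultimately show ?thesis by simp
  qed
  have "(\<lambda>n. 2 ^ 4 * (K * (2\<^sup>2 * (d2 n + pint \<Omega> 2 (HS U)))\<^sup>2 + d4 n)) \<longlonglongrightarrow> 2 ^ 4 * (K * (2\<^sup>2 * (0 + pint \<Omega> 2 (HS U)))\<^sup>2 + 0)"
    by (intro tendsto_mult tendsto_add tendsto_power tendsto_const W(2,3)[folded d4_def d2_def])
  from LIMSEQ_le_const[OF this] le
  have "pint \<Omega> 4 (GR U) \<le> 2 ^ 4 * (K * (2\<^sup>2 * (0 + pint \<Omega> 2 (HS U)))\<^sup>2 + 0)" by blast
  then show ?thesis by (simp add: K_def power_mult_distrib)
qed

end

locale kernel_sequence = disc_sequence \<Omega> h C N PiD GD HD ED
  for \<Omega> :: "(real^'n::finite) set" and h :: "real^'n^'k \<Rightarrow> real^'n^'k \<Rightarrow> real^'n^'n^'k::finite"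
    and C N PiD GD HD ED +
  fixes \<Psi> :: "'k \<Rightarrow> real^'n \<Rightarrow> real" and L :: "('k \<Rightarrow> real^'n \<Rightarrow> real) \<Rightarrow> real" and \<Theta> :: "nat \<Rightarrow> 'k \<Rightarrow> nat \<Rightarrow> real"
  assumes \<Psi>_H20: "\<And>c. H20 \<Omega> (\<Psi> c)" and reg: "regular_solution \<Omega> h L \<Psi>"
    and \<Theta>: "\<And>n. \<Theta> n \<in> XK n" and \<Theta>1: "\<And>n. pint \<Omega> 2 (HK n (\<Theta> n)) = 1"
    and ker: "\<And>n W. W \<in> XK n \<Longrightarrow> discLinA \<Omega> h \<Psi> (GD n) (HD n) (\<Theta> n) W = 0"

sublocale kernel_sequence \<subseteq> sobolev_form \<Omega> h \<Psi> "256 * ((real CARD('k))\<^sup>2 * C ^ 4)"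
  by unfold_locales (use \<Psi>_H20 sobolev_inequality in \<open>auto simp: zero_le_even_power\<close>)

context kernel_sequence
begin

text \<open>The companions of the kernel elements lie in \<open>H20\<close> and are replaced by test
  functions within \<open>1 / (n + 1)\<close> in the H^2 norm. This error vanishes in the limit, and
  the energies stay bounded thanks to \<open>GammaE\<close>.\<close>

lemma companion_approx:
  obtains \<phi> M where "\<And>n. \<phi> n \<in> TF" "\<And>n. pint \<Omega> 2 (HS (\<phi> n)) \<le> M"
    "(\<lambda>n. pint \<Omega> 2 (\<lambda>x. GK n (\<Theta> n) x - GR (\<phi> n) x)) \<longlonglongrightarrow> 0"
proof -
  define s where "s n = inverse (real (Suc n))" for n
  have s: "s \<longlonglongrightarrow> 0" unfolding s_def by (rule LIMSEQ_inverse_real_of_nat)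
  have s01: "s n > 0" "s n \<le> 1" for n by (auto simp: s_def inverse_eq_divide)
  define d where "d = real CARD('n)"
  have d0: "d \<ge> 0" by (simp add: d_def)
  have Hm: "Hm \<Omega> 2 (ED n (\<Theta> n c))" for n c by (rule disc.Hm_ED[OF disc_n XK_D[OF \<Theta>]])
  have "\<exists>f. test_fn \<Omega> f \<and> hnorm \<Omega> 2 (\<lambda>x. ED n (\<Theta> n c) x - f x) < s n" for n c
    using compn[of n] XK_D[OF \<Theta>, of n c] s01(1)[of n] by (simp add: companion_def H0m_def)
  then obtain \<phi> where \<phi>0: "\<And>n c. test_fn \<Omega> (\<phi> n c)" "\<And>n c. hnorm \<Omega> 2 (\<lambda>x. ED n (\<Theta> n c) x - \<phi> n c x) < s n"
    by metis
  have \<phi>: "\<phi> n \<in> TF" for n using \<phi>0(1) by (simp add: TF_def)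
  have hsq: "(hnorm \<Omega> 2 (\<lambda>x. ED n (\<Theta> n c) x - \<phi> n c x))\<^sup>2 \<le> (s n)\<^sup>2" for n c
    by (rule power_mono[OF less_imp_le[OF \<phi>0(2)] disc.hnorm_nonneg[OF disc_n]])
  have hd1: "pint \<Omega> 2 (HD n (\<Theta> n c)) \<le> 1" for n c using pint_HD_le[OF \<Theta>, of n c] \<Theta>1 by simp
  \<comment> \<open>\<open>C\<^sup>2\<close> is the stability of the companion at unit energy;
    \<open>d\<^sup>2\<close> counts the Hessian entries, each of which is off by at most
    \<open>s n \<le> 1\<close>.\<close>
  have bH: "pint \<Omega> 2 (hs (\<phi> n c)) \<le> 2\<^sup>2 * (C\<^sup>2 + d\<^sup>2)" for n c
  proof -
    note L = Lp_whess[OF Hm, of n c] Lp_hs[OF \<phi>0(1), of 2 n c]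
    have "pint \<Omega> 2 (hs (\<phi> n c)) \<le> 2\<^sup>2 * (pint \<Omega> 2 (whess \<Omega> (ED n (\<Theta> n c))) + pint \<Omega> 2 (\<lambda>x. whess \<Omega> (ED n (\<Theta> n c)) x - hs (\<phi> n c) x))"
      using Lp_diff(2)[OF L(1) Lp_diff(1)[OF L]] by simp
    also have "\<dots> \<le> 2\<^sup>2 * (C\<^sup>2 + d\<^sup>2)"
    proof (intro mult_left_mono add_mono)
      show "pint \<Omega> 2 (whess \<Omega> (ED n (\<Theta> n c))) \<le> C\<^sup>2"
        using disc.pint_whess_ED_le[OF disc_n GammaEn XK_D[OF \<Theta>], of n c] mult_left_mono[OF hd1[of n c], of "C\<^sup>2"] by simp
      have "d\<^sup>2 * (hnorm \<Omega> 2 (\<lambda>x. ED n (\<Theta> n c) x - \<phi> n c x))\<^sup>2 \<le> d\<^sup>2 * 1"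
        using order_trans[OF hsq power_mono[OF s01(2), of n 2]] s01(1)[of n] by (intro mult_left_mono) (auto simp: less_imp_le)
      then show "pint \<Omega> 2 (\<lambda>x. whess \<Omega> (ED n (\<Theta> n c)) x - hs (\<phi> n c) x) \<le> d\<^sup>2"
        using pint_diff_test_fn(2)[OF Hm \<phi>0(1), of n c n c] unfolding d_def by linarith
    qed simp
    finally show ?thesis .
  qed
  have M: "pint \<Omega> 2 (HS (\<phi> n)) \<le> (\<Sum>c\<in>(UNIV::'k set). 2\<^sup>2 * (C\<^sup>2 + d\<^sup>2))" for n
  proof -
    have "pint \<Omega> 2 (HS (\<phi> n)) = (\<Sum>c\<in>UNIV. pint \<Omega> 2 (hs (\<phi> n c)))"
      using pint_2_vec[of \<Omega> "HS (\<phi> n)"] Lp_hs[OF \<phi>0(1), of 2] by (simp add: HS_def)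
    then show ?thesis by (simp only:) (intro sum_mono bH)
  qed
  have bG: "pint \<Omega> 2 (\<lambda>x. GD n (\<Theta> n c) x - gr (\<phi> n c) x) \<le> 2\<^sup>2 * ((s n)\<^sup>2 + d * (s n)\<^sup>2)" for n c
  proof -
    note L = Lp_4_2[OF disc.Lp_D(2)[OF disc_n XK_D[OF \<Theta>]], of n c] Lp_wgrad[OF Hm, of n c] Lp_gr[OF \<phi>0(1), of 2 n c]
    have L2: "Lp \<Omega> 2 (\<lambda>x. wgrad \<Omega> (ED n (\<Theta> n c)) x - gr (\<phi> n c) x)" by (rule Lp_diff(1)[OF L(2) L(3)]) simp
    have "pint \<Omega> 2 (\<lambda>x. GD n (\<Theta> n c) x - gr (\<phi> n c) x)
        \<le> 2\<^sup>2 * (pint \<Omega> 2 (\<lambda>x. GD n (\<Theta> n c) x - wgrad \<Omega> (ED n (\<Theta> n c)) x) + pint \<Omega> 2 (\<lambda>x. wgrad \<Omega> (ED n (\<Theta> n c)) x - gr (\<phi> n c) x))"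
      using Lp_add(2)[OF Lp_diff(1)[OF L(1) L(2)] L2] by simp
    also have "\<dots> \<le> 2\<^sup>2 * ((s n)\<^sup>2 + d * (s n)\<^sup>2)"
    proof (intro mult_left_mono add_mono)
      show "pint \<Omega> 2 (\<lambda>x. GD n (\<Theta> n c) x - wgrad \<Omega> (ED n (\<Theta> n c)) x) \<le> (s n)\<^sup>2"
        using order_trans[OF disc.pint_omega_le[OF disc_n omegaEn XK_D[OF \<Theta>], of n c] mult_left_mono[OF hd1[of n c] zero_le_power2]]
        by (simp add: s_def)
      show "pint \<Omega> 2 (\<lambda>x. wgrad \<Omega> (ED n (\<Theta> n c)) x - gr (\<phi> n c) x) \<le> d * (s n)\<^sup>2"
        using order_trans[OF pint_diff_test_fn(1)[OF Hm \<phi>0(1), of n c n c] mult_left_mono[OF hsq[of n c] d0[unfolded d_def]]]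
        by (simp add: d_def)
    qed simp
    finally show ?thesis .
  qed
  have G: "pint \<Omega> 2 (\<lambda>x. GK n (\<Theta> n) x - GR (\<phi> n) x) \<le> (\<Sum>c\<in>(UNIV::'k set). 2\<^sup>2 * ((s n)\<^sup>2 + d * (s n)\<^sup>2))" for n
  proof -
    have "Lp \<Omega> 2 (\<lambda>x. GK n (\<Theta> n) x - GR (\<phi> n) x)"
      by (rule Lp_diff(1)[OF Lp_4_2[OF Lp_GK[OF \<Theta>]] Lp_GR[OF \<phi>]]) simp
    from pint_2_vec[OF Lp_nth(1)[OF this]]
    have "pint \<Omega> 2 (\<lambda>x. GK n (\<Theta> n) x - GR (\<phi> n) x) = (\<Sum>c\<in>UNIV. pint \<Omega> 2 (\<lambda>x. GD n (\<Theta> n c) x - gr (\<phi> n c) x))"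
      by (simp add: GK_def GR_def)
    then show ?thesis by (simp only:) (intro sum_mono bG)
  qed
  have s2: "(\<lambda>n. (s n)\<^sup>2) \<longlonglongrightarrow> 0" using s by simp
  have "(\<lambda>n. \<Sum>c\<in>(UNIV::'k set). 2\<^sup>2 * ((s n)\<^sup>2 + d * (s n)\<^sup>2)) \<longlonglongrightarrow> 0"
    by (intro tendsto_null_sum tendsto_mult_right_zero tendsto_add_zero s2)
  from that[OF \<phi> M tendsto_0_squeeze[OF pint_nonneg G this]] show ?thesis .
qed

text \<open>For exact derivatives the pairing of \<xi> with the Hessian and that of its divergence
  with the gradient cancel; for discrete ones \<open>WD\<close> bounds what is left. Subtracting
  leaves the divergence against a gradient difference that vanishes in L^2.\<close>

lemma weak_limit:
  assumes \<phi>: "\<And>n. \<phi> n \<in> TF" and G: "(\<lambda>n. pint \<Omega> 2 (\<lambda>x. GK n (\<Theta> n) x - GR (\<phi> n) x)) \<longlonglongrightarrow> 0"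
    and \<xi>: "\<And>c i j. test_fn \<Omega> (\<lambda>x. \<xi> x $ c $ i $ j)"
  shows "(\<lambda>n. AF (\<lambda>x. HK n (\<Theta> n) x - HS (\<phi> n) x) \<xi>) \<longlonglongrightarrow> 0"
proof -
  define s where "s n = inverse (real (Suc n))" for n
  have s: "s \<longlonglongrightarrow> 0" unfolding s_def by (rule LIMSEQ_inverse_real_of_nat)
  have s0: "s n > 0" for n by (simp add: s_def)
  have Lx: "Lp \<Omega> 2 (\<lambda>x. \<xi> x $ c)" for c by (intro Lp_vecI Lp_test_fn[OF \<xi>]) auto
  have Ld: "Lp \<Omega> 2 (dv (\<lambda>x. \<xi> x $ c))" for c
    by (rule Lp_vecI) (auto simp: dv_def intro!: Lp_test_fn test_fn_sum test_fn_pd \<xi>)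
  have comp: "(\<lambda>n. AF (\<lambda>x. \<xi> x $ c) (\<lambda>x. HD n (\<Theta> n c) x - hs (\<phi> n c) x)) \<longlonglongrightarrow> 0" for c
  proof -
    have LH: "Lp \<Omega> 2 (HD n (\<Theta> n c))" "Lp \<Omega> 2 (hs (\<phi> n c))" and LG: "Lp \<Omega> 2 (GD n (\<Theta> n c))" "Lp \<Omega> 2 (gr (\<phi> n c))" for n
      using disc.Lp_D[OF disc_n XK_D[OF \<Theta>], of n c] Lp_hs[OF TF_D[OF \<phi>], of 2 n c] Lp_gr[OF TF_D[OF \<phi>], of 2 n c] Lp_4_2 by auto
    have LGd: "Lp \<Omega> 2 (\<lambda>x. GD n (\<Theta> n c) x - gr (\<phi> n c) x)" for n by (rule Lp_diff(1)[OF LG])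
    define a where "a n = AF (\<lambda>x. \<xi> x $ c) (HD n (\<Theta> n c)) + AF (dv (\<lambda>x. \<xi> x $ c)) (GD n (\<Theta> n c))" for n
    define b where "b n = AF (dv (\<lambda>x. \<xi> x $ c)) (\<lambda>x. GD n (\<Theta> n c) x - gr (\<phi> n c) x)" for n
    have eq: "AF (\<lambda>x. \<xi> x $ c) (\<lambda>x. HD n (\<Theta> n c) x - hs (\<phi> n c) x) = a n - b n" for n
    proof -
      have 1: "AF (\<lambda>x. \<xi> x $ c) (\<lambda>x. HD n (\<Theta> n c) x - hs (\<phi> n c) x) = AF (\<lambda>x. \<xi> x $ c) (HD n (\<Theta> n c)) - AF (\<lambda>x. \<xi> x $ c) (hs (\<phi> n c))"
        using AF_combo2[OF Lx[of c] LH(1)[of n] LH(2)[of n], where a = 1 and b = "-1"] by simp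
      have 2: "b n = AF (dv (\<lambda>x. \<xi> x $ c)) (GD n (\<Theta> n c)) - AF (dv (\<lambda>x. \<xi> x $ c)) (gr (\<phi> n c))"
        using AF_combo2[OF Ld[of c] LG(1)[of n] LG(2)[of n], where a = 1 and b = "-1"] by (simp add: b_def)
      have 3: "AF (dv (\<lambda>x. \<xi> x $ c)) (gr (\<phi> n c)) = - AF (\<lambda>x. \<xi> x $ c) (hs (\<phi> n c))"
        unfolding AF_def by (rule integral_dv_gr[OF \<xi> TF_D[OF \<phi>]])
      show ?thesis unfolding 1 2 3 a_def by simp
    qed
    have "\<bar>a n\<bar> \<le> s n * hnorm1mat \<Omega> (\<lambda>x. \<xi> x $ c)" for n
    proof -
      have "a n = (LINT x|lebesgue_on \<Omega>. \<xi> x $ c \<bullet> HD n (\<Theta> n c) x + dv (\<lambda>x. \<xi> x $ c) x \<bullet> GD n (\<Theta> n c) x)"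
        unfolding a_def AF_def using AF_integrable[OF Lx LH(1)] AF_integrable[OF Ld LG(1)] by simp
      then have "\<bar>a n\<bar> \<le> s n * hnorm1mat \<Omega> (\<lambda>x. \<xi> x $ c) * normD \<Omega> (HD n) (\<Theta> n c)"
        using disc.WD_le[where \<xi> = "\<lambda>x. \<xi> x $ c", OF disc_n[of n] gammaDn[of n] \<xi> XK_D[OF \<Theta>[of n], of c]] by (simp add: s_def)
      also have "\<dots> \<le> s n * hnorm1mat \<Omega> (\<lambda>x. \<xi> x $ c) * 1"
      proof (rule mult_left_mono)
        have "(normD \<Omega> (HD n) (\<Theta> n c))\<^sup>2 \<le> 1\<^sup>2"
          unfolding disc.normD_sq[OF disc_n] using pint_HD_le[OF \<Theta>, of n c] \<Theta>1 by simp
        then show "normD \<Omega> (HD n) (\<Theta> n c) \<le> 1" by (rule power2_le_imp_le) simp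
        show "0 \<le> s n * hnorm1mat \<Omega> (\<lambda>x. \<xi> x $ c)"
          using s0[of n] by (auto simp: hnorm1mat_def intro!: mult_nonneg_nonneg sum_nonneg)
      qed
      finally show ?thesis by simp
    qed
    then have a: "a \<longlonglongrightarrow> 0"
      by (intro Lim_null_comparison[OF _ tendsto_mult_left_zero[OF s, of "hnorm1mat \<Omega> (\<lambda>x. \<xi> x $ c)"]]) (auto intro: always_eventually)
    have b: "b \<longlonglongrightarrow> 0"
    proof (rule tendsto_0_of_power_le[of 2])
      show "(b n)\<^sup>2 \<le> pint \<Omega> 2 (dv (\<lambda>x. \<xi> x $ c)) * pint \<Omega> 2 (\<lambda>x. GK n (\<Theta> n) x - GR (\<phi> n) x)" for n
      proof -
        have "Lp \<Omega> 2 (\<lambda>x. GK n (\<Theta> n) x - GR (\<phi> n) x)"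
          by (rule Lp_diff(1)[OF Lp_4_2[OF Lp_GK[OF \<Theta>]] Lp_GR[OF \<phi>]]) simp
        from Lp_nth(2)[OF this, of c]
        have "pint \<Omega> 2 (\<lambda>x. GD n (\<Theta> n c) x - gr (\<phi> n c) x) \<le> pint \<Omega> 2 (\<lambda>x. GK n (\<Theta> n) x - GR (\<phi> n) x)"
          by (simp add: GK_def GR_def)
        from mult_left_mono[OF this pint_nonneg] AF_bound[OF Ld LGd] show ?thesis unfolding b_def by (rule order_trans[rotated])
      qed
    qed (use tendsto_mult_right_zero[OF G] in auto)
    show ?thesis unfolding eq using tendsto_diff[OF a b] by simp
  qed
  have "AF (\<lambda>x. HK n (\<Theta> n) x - HS (\<phi> n) x) \<xi> = (\<Sum>c\<in>UNIV. AF (\<lambda>x. \<xi> x $ c) (\<lambda>x. HD n (\<Theta> n c) x - hs (\<phi> n c) x))" for n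
  proof -
    have L: "Lp \<Omega> 2 (\<lambda>x. HD n (\<Theta> n c) x - hs (\<phi> n c) x)" for c
      by (rule Lp_diff(1)[OF disc.Lp_D(3)[OF disc_n XK_D[OF \<Theta>]] Lp_hs[OF TF_D[OF \<phi>]]]) simp
    have "AF (\<lambda>x. HK n (\<Theta> n) x - HS (\<phi> n) x) \<xi>
        = (LINT x|lebesgue_on \<Omega>. (\<Sum>c\<in>UNIV. \<xi> x $ c \<bullet> (HD n (\<Theta> n c) x - hs (\<phi> n c) x)))"
      unfolding AF_commute[of "\<lambda>x. HK n (\<Theta> n) x - HS (\<phi> n) x"] unfolding AF_def by (simp add: inner_vec_def[where 'b = 'k] HK_def HS_def)
    also have "\<dots> = (\<Sum>c\<in>UNIV. AF (\<lambda>x. \<xi> x $ c) (\<lambda>x. HD n (\<Theta> n c) x - hs (\<phi> n c) x))"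
      unfolding AF_def by (rule Bochner_Integration.integral_sum) (rule AF_integrable[OF Lx L])
    finally show ?thesis .
  qed
  then show ?thesis using tendsto_null_sum[of UNIV, OF comp] by simp
qed

end

section \<open>Passage to the limit in the discrete equation\<close>

context kernel_sequence
begin

text \<open>Expanding \<open>h\<close> in a basis shows each entry to be a finite combination of
  products of partial derivatives. This makes \<open>h (GR U x) (GR V x)\<close> an admissible field
  for \<open>weak_limit\<close>.\<close>

lemma test_fn_h:
  assumes U: "U \<in> TF" and V: "V \<in> TF"
  shows "test_fn \<Omega> (\<lambda>x. h (GR U x) (GR V x) $ c $ i $ j)"
proof -
  have b: "test_fn \<Omega> (\<lambda>x. GR U x \<bullet> b)" if UB: "U \<in> TF" "b \<in> Basis" for U b
  proof -
    obtain c i where "b = axis c (axis i 1)" using UB(2) by (auto simp: Basis_vec_def)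
    then have "(\<lambda>x. GR U x \<bullet> b) = pd i (U c)" by (auto simp: inner_axis GR_def)
    then show ?thesis using test_fn_pd[OF TF_D[OF UB(1)]] by simp
  qed
  have hab: "h (p *\<^sub>R a) (q *\<^sub>R b) = (p * q) *\<^sub>R h a b" for p q a b
    by (simp add: bilinear_lmul[OF bil, of p] bilinear_rmul[OF bil, of _ q])
  have exp: "h t v = (\<Sum>a\<in>Basis. \<Sum>b\<in>Basis. ((t \<bullet> a) * (v \<bullet> b)) *\<^sub>R h a b)" for t v
  proof -
    have "h t v = h (\<Sum>a\<in>Basis. (t \<bullet> a) *\<^sub>R a) (\<Sum>b\<in>Basis. (v \<bullet> b) *\<^sub>R b)"
      by (simp only: euclidean_representation)
    also have "\<dots> = (\<Sum>(a, b)\<in>Basis \<times> Basis. h ((t \<bullet> a) *\<^sub>R a) ((v \<bullet> b) *\<^sub>R b))"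
      by (rule bilinear_sum[OF bil])
    also have "\<dots> = (\<Sum>a\<in>Basis. \<Sum>b\<in>Basis. ((t \<bullet> a) * (v \<bullet> b)) *\<^sub>R h a b)"
      by (simp only: hab sum.cartesian_product)
    finally show ?thesis .
  qed
  have "h t v $ c $ i $ j = (\<Sum>a\<in>Basis. \<Sum>b\<in>Basis. (h a b $ c $ i $ j) * ((t \<bullet> a) * (v \<bullet> b)))" for t v
    by (subst exp) (simp add: mult.commute)
  then have "(\<lambda>x. h (GR U x) (GR V x) $ c $ i $ j)
      = (\<lambda>x. \<Sum>a\<in>Basis. \<Sum>b\<in>Basis. (h a b $ c $ i $ j) * ((GR U x \<bullet> a) * (GR V x \<bullet> b)))"
    by (rule ext)
  moreover have "test_fn \<Omega> (\<lambda>x. \<Sum>a\<in>Basis. \<Sum>b\<in>Basis. (h a b $ c $ i $ j) * ((GR U x \<bullet> a) * (GR V x \<bullet> b)))"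
    by (intro test_fn_sum test_fn_scale test_fn_mult b U V test_fn_smooth[OF b]) auto
  ultimately show ?thesis by simp
qed

lemma TA_null:
  assumes \<phi>: "\<And>n. \<phi> n \<in> TF" "\<And>n. pint \<Omega> 2 (HS (\<phi> n)) \<le> M"
    and G: "(\<lambda>n. pint \<Omega> 2 (\<lambda>x. GK n (\<Theta> n) x - GR (\<phi> n) x)) \<longlonglongrightarrow> 0" and U: "U \<in> TF"
  shows "(\<lambda>n. TA (\<phi> n) U) \<longlonglongrightarrow> 0"
proof -
  obtain W where W: "\<And>n. W n \<in> XK n" "(\<lambda>n. pint \<Omega> 4 (\<lambda>x. GK n (W n) x - GR U x)) \<longlonglongrightarrow> 0"
    "(\<lambda>n. pint \<Omega> 2 (\<lambda>x. HK n (W n) x - HS U x)) \<longlonglongrightarrow> 0"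
    by (rule interpolation[OF U]) blast
  obtain B where B: "\<And>P T X. Lp \<Omega> 2 P \<Longrightarrow> Lp \<Omega> 4 T \<Longrightarrow> Lp \<Omega> 4 X \<Longrightarrow>
     BF P T X ^ 4 \<le> B * ((pint \<Omega> 2 P)\<^sup>2 * pint \<Omega> 4 T * pint \<Omega> 4 X)" and B0: "B \<ge> 0"
    using BF_bound_244 by blast
  define K where "K = (real CARD('k))\<^sup>2 * C ^ 4"
  have bK: "pint \<Omega> 4 (GK n (\<Theta> n)) \<le> K" for n
    using pint_GK_le[OF \<Theta>, of n] \<Theta>1[of n] by (simp add: K_def)
  obtain \<psi> where \<psi>: "Lp \<Omega> 4 (WG \<Psi>)" "\<And>m::nat. \<psi> m \<in> TF" "(\<lambda>m. pint \<Omega> 4 (\<lambda>x. WG \<Psi> x - GR (\<psi> m) x)) \<longlonglongrightarrow> 0"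
    "(\<lambda>m. pint \<Omega> 2 (\<lambda>x. WH \<Psi> x - HS (\<psi> m) x)) \<longlonglongrightarrow> 0"
    by (rule H20_approx4[where \<Phi> = \<Psi>, OF \<Psi>_H20]) blast
  have La: "Lp \<Omega> 2 (HK n (\<Theta> n))" and Lb: "Lp \<Omega> 4 (GK n (\<Theta> n))" for n
    by (rule Lp_HK[OF \<Theta>], rule Lp_GK[OF \<Theta>])
  have LH: "Lp \<Omega> 2 (HS (\<phi> n))" and Lg: "Lp \<Omega> 4 (GR (\<phi> n))" for n
    by (rule Lp_HS[OF \<phi>(1)], simp, rule Lp_GR[OF \<phi>(1)], simp)
  have LW: "Lp \<Omega> 2 (HK n (W n))" "Lp \<Omega> 4 (GK n (W n))" for n
    by (rule Lp_HK[OF W(1)], rule Lp_GK[OF W(1)])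
  have LU: "Lp \<Omega> 2 (HS U)" "Lp \<Omega> 4 (GR U)" by (rule Lp_HS[OF U], simp, rule Lp_GR[OF U], simp)
  have LaH: "Lp \<Omega> 2 (\<lambda>x. HK n (\<Theta> n) x - HS (\<phi> n) x)" for n by (rule Lp_diff(1)[OF La LH])
  have Lbg: "Lp \<Omega> 4 (\<lambda>x. GK n (\<Theta> n) x - GR (\<phi> n) x)" for n by (rule Lp_diff(1)[OF Lb Lg])
  have LWU: "Lp \<Omega> 2 (\<lambda>x. HK n (W n) x - HS U x)" "Lp \<Omega> 4 (\<lambda>x. GK n (W n) x - GR U x)" for n
    by (rule Lp_diff(1)[OF LW(1) LU(1)], rule Lp_diff(1)[OF LW(2) LU(2)])
  have L\<psi>: "Lp \<Omega> 4 (GR (\<psi> m))" for m by (rule Lp_GR[OF \<psi>(2)]) simp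
  have LP\<psi>: "Lp \<Omega> 4 (\<lambda>x. WG \<Psi> x - GR (\<psi> m) x)" for m by (rule Lp_diff(1)[OF Lp_\<Psi>(3) L\<psi>])
  \<comment> \<open>Odd indices carry the interpolation error of \<open>U\<close>, even ones the
    passage from \<open>\<Theta> n\<close> to \<open>\<phi> n\<close>. Their sum telescopes from the
    kernel equation tested with \<open>W n\<close> to \<open>TA (\<phi> n) U\<close>, up to
    sign.\<close>
  define t1 where "t1 n = AF (HK n (\<Theta> n)) (\<lambda>x. HK n (W n) x - HS U x)" for n
  define t2 where "t2 n = AF (\<lambda>x. HK n (\<Theta> n) x - HS (\<phi> n) x) (HS U)" for n
  define t3 where "t3 n = BF (WH \<Psi>) (GK n (\<Theta> n)) (\<lambda>x. GK n (W n) x - GR U x)" for n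
  define t4 where "t4 n = BF (WH \<Psi>) (\<lambda>x. GK n (\<Theta> n) x - GR (\<phi> n) x) (GR U)" for n
  define t5 where "t5 n = BF (HK n (\<Theta> n)) (WG \<Psi>) (\<lambda>x. GK n (W n) x - GR U x)" for n
  define t6 where "t6 n = BF (\<lambda>x. HK n (\<Theta> n) x - HS (\<phi> n) x) (WG \<Psi>) (GR U)" for n
  have split: "TA (\<phi> n) U = - (t1 n + t2 n + (t3 n + t4 n) + (t5 n + t6 n))" for n
  proof -
    have e1: "t1 n = AF (HK n (\<Theta> n)) (HK n (W n)) - AF (HK n (\<Theta> n)) (HS U)"
      using AF_combo2[OF La[of n] LW(1)[of n] LU(1), where a = 1 and b = "-1"] by (simp add: t1_def)
    have e2: "t2 n = AF (HK n (\<Theta> n)) (HS U) - AF (HS (\<phi> n)) (HS U)"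
      using AF_combo[OF La[of n] LH[of n] LU(1), where a = 1 and b = "-1"] by (simp add: t2_def)
    have e3: "t3 n = BF (WH \<Psi>) (GK n (\<Theta> n)) (GK n (W n)) - BF (WH \<Psi>) (GK n (\<Theta> n)) (GR U)"
      using BF_combo3[OF BI_244[OF Lp_\<Psi>(1) Lb[of n] LW(2)[of n]] BI_244[OF Lp_\<Psi>(1) Lb[of n] LU(2)], where a = 1 and b = "-1"]
      by (simp add: t3_def)
    have e4: "t4 n = BF (WH \<Psi>) (GK n (\<Theta> n)) (GR U) - BF (WH \<Psi>) (GR (\<phi> n)) (GR U)"
      using BF_combo2[OF BI_244[OF Lp_\<Psi>(1) Lb[of n] LU(2)] BI_244[OF Lp_\<Psi>(1) Lg[of n] LU(2)], where a = 1 and b = "-1"]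
      by (simp add: t4_def)
    have e5: "t5 n = BF (HK n (\<Theta> n)) (WG \<Psi>) (GK n (W n)) - BF (HK n (\<Theta> n)) (WG \<Psi>) (GR U)"
      using BF_combo3[OF BI_244[OF La[of n] Lp_\<Psi>(3) LW(2)[of n]] BI_244[OF La[of n] Lp_\<Psi>(3) LU(2)], where a = 1 and b = "-1"]
      by (simp add: t5_def)
    have e6: "t6 n = BF (HK n (\<Theta> n)) (WG \<Psi>) (GR U) - BF (HS (\<phi> n)) (WG \<Psi>) (GR U)"
      using BF_combo1[OF BI_244[OF La[of n] Lp_\<Psi>(3) LU(2)] BI_244[OF LH[of n] Lp_\<Psi>(3) LU(2)], where a = 1 and b = "-1"]
      by (simp add: t6_def)
    have "AF (HK n (\<Theta> n)) (HK n (W n)) + BF (WH \<Psi>) (GK n (\<Theta> n)) (GK n (W n)) + BF (HK n (\<Theta> n)) (WG \<Psi>) (GK n (W n)) = 0"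
      using ker[OF W(1), of n] unfolding discLinA_XK .
    then show ?thesis unfolding e1 e2 e3 e4 e5 e6 TA_def by linarith
  qed
  have l1: "t1 \<longlonglongrightarrow> 0"
  proof (rule tendsto_0_of_power_le[of 2])
    show "(t1 n)\<^sup>2 \<le> pint \<Omega> 2 (\<lambda>x. HK n (W n) x - HS U x)" for n
      using AF_bound[OF La[of n] LWU(1)[of n]] \<Theta>1[of n] by (simp add: t1_def)
  qed (use W(3) in auto)
  have l2: "t2 \<longlonglongrightarrow> 0" unfolding t2_def
    by (rule weak_limit[OF \<phi>(1) G]) (auto simp: HS_def hs_def intro!: test_fn_pd TF_D[OF U])
  have l3: "t3 \<longlonglongrightarrow> 0"
  proof (rule tendsto_0_of_power_le[of 4])
    show "t3 n ^ 4 \<le> B * ((pint \<Omega> 2 (WH \<Psi>))\<^sup>2 * K) * pint \<Omega> 4 (\<lambda>x. GK n (W n) x - GR U x)" for n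
    proof -
      have "t3 n ^ 4 \<le> B * ((pint \<Omega> 2 (WH \<Psi>))\<^sup>2 * pint \<Omega> 4 (GK n (\<Theta> n)) * pint \<Omega> 4 (\<lambda>x. GK n (W n) x - GR U x))"
        unfolding t3_def by (rule B[OF Lp_\<Psi>(1) Lb LWU(2)])
      also have "\<dots> \<le> B * ((pint \<Omega> 2 (WH \<Psi>))\<^sup>2 * K * pint \<Omega> 4 (\<lambda>x. GK n (W n) x - GR U x))"
        by (intro mult_left_mono mult_right_mono bK) (auto simp: B0)
      finally show ?thesis by (simp add: mult.assoc)
    qed
  qed (use tendsto_mult_right_zero[OF W(2)] in auto)
  \<comment> \<open>The gradient difference is small in L^2 only, which is too weak for
    \<open>B_continuous\<close>; boundedness of \<open>GR U\<close> makes up for it.\<close>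
  have l4: "t4 \<longlonglongrightarrow> 0"
  proof -
    obtain b where "\<And>x. norm (GR U x) \<le> b" using GR_bounded[OF U] by blast
    from BI_22b(3)[OF Lp_\<Psi>(1) Lp_\<Psi>(2) Lp_measurable[OF LU(2)] this]
    obtain D where D: "\<And>P T. Lp \<Omega> 2 P \<Longrightarrow> Lp \<Omega> 2 T \<Longrightarrow> (BF P T (GR U))\<^sup>2 \<le> D * (pint \<Omega> 2 P * pint \<Omega> 2 T)" by blast
    show ?thesis
    proof (rule tendsto_0_of_power_le[of 2])
      show "(t4 n)\<^sup>2 \<le> D * (pint \<Omega> 2 (WH \<Psi>) * pint \<Omega> 2 (\<lambda>x. GK n (\<Theta> n) x - GR (\<phi> n) x))" for n
        unfolding t4_def by (rule D[OF Lp_\<Psi>(1) Lp_4_2[OF Lbg]])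
    qed (use tendsto_mult_right_zero[OF tendsto_mult_right_zero[OF G]] in auto)
  qed
  have l5: "t5 \<longlonglongrightarrow> 0"
  proof (rule tendsto_0_of_power_le[of 4])
    show "t5 n ^ 4 \<le> B * (pint \<Omega> 4 (WG \<Psi>) * pint \<Omega> 4 (\<lambda>x. GK n (W n) x - GR U x))" for n
      using B[OF La[of n] Lp_\<Psi>(3) LWU(2)[of n]] \<Theta>1[of n] by (simp add: t5_def)
  qed (use tendsto_mult_right_zero[OF tendsto_mult_right_zero[OF W(2)]] in auto)
  \<comment> \<open>The gradient of \<Psi> is not that of a test family. Replacing it by
    \<open>GR (\<psi> m)\<close> brings \<open>weak_limit\<close> into play, and the error is
    uniform in \<open>n\<close> because the Hessian differences are bounded by means of
    \<open>M\<close>.\<close>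
  have l6: "t6 \<longlonglongrightarrow> 0"
  proof (rule tendsto_0_approx)
    show "(\<lambda>n. BF (\<lambda>x. HK n (\<Theta> n) x - HS (\<phi> n) x) (GR (\<psi> m)) (GR U)) \<longlonglongrightarrow> 0" for m
      using weak_limit[OF \<phi>(1) G test_fn_h[OF \<psi>(2)[of m] U]] by (simp add: BF_def AF_def)
    show "(t6 n - BF (\<lambda>x. HK n (\<Theta> n) x - HS (\<phi> n) x) (GR (\<psi> m)) (GR U)) ^ 4
        \<le> B * (4 * (1 + M))\<^sup>2 * pint \<Omega> 4 (GR U) * pint \<Omega> 4 (\<lambda>x. WG \<Psi> x - GR (\<psi> m) x)" for m n
    proof -
      have e: "t6 n - BF (\<lambda>x. HK n (\<Theta> n) x - HS (\<phi> n) x) (GR (\<psi> m)) (GR U)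
          = BF (\<lambda>x. HK n (\<Theta> n) x - HS (\<phi> n) x) (\<lambda>x. WG \<Psi> x - GR (\<psi> m) x) (GR U)"
        using BF_combo2[OF BI_244[OF LaH[of n] Lp_\<Psi>(3) LU(2)] BI_244[OF LaH[of n] L\<psi>[of m] LU(2)], where a = 1 and b = "-1"]
        by (simp add: t6_def)
      have "pint \<Omega> 2 (\<lambda>x. HK n (\<Theta> n) x - HS (\<phi> n) x) \<le> 4 * (1 + M)"
        using Lp_diff(2)[OF La[of n] LH[of n]] \<Theta>1[of n] \<phi>(2)[of n] by simp
      then have sq: "(pint \<Omega> 2 (\<lambda>x. HK n (\<Theta> n) x - HS (\<phi> n) x))\<^sup>2 \<le> (4 * (1 + M))\<^sup>2" by (intro power_mono) auto
      have "BF (\<lambda>x. HK n (\<Theta> n) x - HS (\<phi> n) x) (\<lambda>x. WG \<Psi> x - GR (\<psi> m) x) (GR U) ^ 4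
          \<le> B * ((pint \<Omega> 2 (\<lambda>x. HK n (\<Theta> n) x - HS (\<phi> n) x))\<^sup>2 * pint \<Omega> 4 (\<lambda>x. WG \<Psi> x - GR (\<psi> m) x) * pint \<Omega> 4 (GR U))"
        by (rule B[OF LaH LP\<psi> LU(2)])
      also have "\<dots> \<le> B * ((4 * (1 + M))\<^sup>2 * pint \<Omega> 4 (\<lambda>x. WG \<Psi> x - GR (\<psi> m) x) * pint \<Omega> 4 (GR U))"
        by (intro mult_left_mono mult_right_mono sq) (auto simp: B0)
      finally show ?thesis unfolding e by (simp only: mult_ac)
    qed
    show "(\<lambda>m. B * (4 * (1 + M))\<^sup>2 * pint \<Omega> 4 (GR U) * pint \<Omega> 4 (\<lambda>x. WG \<Psi> x - GR (\<psi> m) x)) \<longlonglongrightarrow> 0"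
      by (rule tendsto_mult_right_zero[OF \<psi>(3)])
  qed
  have "(\<lambda>n. - (t1 n + t2 n + (t3 n + t4 n) + (t5 n + t6 n))) \<longlonglongrightarrow> - (0 + 0 + (0 + 0) + (0 + 0))"
    by (intro tendsto_minus tendsto_add l1 l2 l3 l4 l5 l6)
  then show ?thesis unfolding split by simp
qed

lemma kernel_sequence_contradiction: False
proof -
  obtain \<phi> M where \<phi>: "\<And>n. \<phi> n \<in> TF" "\<And>n. pint \<Omega> 2 (HS (\<phi> n)) \<le> M"
    and G: "(\<lambda>n. pint \<Omega> 2 (\<lambda>x. GK n (\<Theta> n) x - GR (\<phi> n) x)) \<longlonglongrightarrow> 0"
    by (rule companion_approx) blast
  have gr0: "(\<lambda>n. pint \<Omega> 2 (GR (\<phi> n))) \<longlonglongrightarrow> 0"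
    by (rule TA_compact[OF reg \<phi> TA_null[OF \<phi> G]])
  obtain B where B: "\<And>P T X. Lp \<Omega> 2 P \<Longrightarrow> Lp \<Omega> 4 T \<Longrightarrow> Lp \<Omega> 4 X \<Longrightarrow>
     BF P T X ^ 4 \<le> B * ((pint \<Omega> 2 P)\<^sup>2 * pint \<Omega> 4 T * pint \<Omega> 4 X)" and B0: "B \<ge> 0"
    using BF_bound_244 by blast
  define K where "K = (real CARD('k))\<^sup>2 * C ^ 4"
  have bK: "pint \<Omega> 4 (GK n (\<Theta> n)) \<le> K" for n
    using pint_GK_le[OF \<Theta>, of n] \<Theta>1[of n] by (simp add: K_def)
  obtain \<psi> where \<psi>: "Lp \<Omega> 4 (WG \<Psi>)" "\<And>m::nat. \<psi> m \<in> TF" "(\<lambda>m. pint \<Omega> 4 (\<lambda>x. WG \<Psi> x - GR (\<psi> m) x)) \<longlonglongrightarrow> 0"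
    "(\<lambda>m. pint \<Omega> 2 (\<lambda>x. WH \<Psi> x - HS (\<psi> m) x)) \<longlonglongrightarrow> 0"
    by (rule H20_approx4[where \<Phi> = \<Psi>, OF \<Psi>_H20]) blast
  have La: "Lp \<Omega> 2 (HK n (\<Theta> n))" and Lb: "Lp \<Omega> 4 (GK n (\<Theta> n))" for n
    by (rule Lp_HK[OF \<Theta>], rule Lp_GK[OF \<Theta>])
  have Lg: "Lp \<Omega> 2 (GR (\<phi> n))" for n by (rule Lp_GR[OF \<phi>(1)]) simp
  have L\<psi>: "Lp \<Omega> 4 (GR (\<psi> m))" for m by (rule Lp_GR[OF \<psi>(2)]) simp
  have LP\<psi>: "Lp \<Omega> 4 (\<lambda>x. WG \<Psi> x - GR (\<psi> m) x)" for m by (rule Lp_diff(1)[OF Lp_\<Psi>(3) L\<psi>])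
  have b0: "(\<lambda>n. pint \<Omega> 2 (GK n (\<Theta> n))) \<longlonglongrightarrow> 0"
  proof (rule tendsto_0_squeeze[OF pint_nonneg])
    show "pint \<Omega> 2 (GK n (\<Theta> n)) \<le> 2\<^sup>2 * (pint \<Omega> 2 (\<lambda>x. GK n (\<Theta> n) x - GR (\<phi> n) x) + pint \<Omega> 2 (GR (\<phi> n)))" for n
      using Lp_add(2)[OF Lp_diff(1)[OF Lp_4_2[OF Lb[of n]] Lg[of n]] Lg[of n]] by simp
  qed (intro tendsto_mult_right_zero tendsto_add_zero G gr0)
  define t where "t n = BF (HK n (\<Theta> n)) (WG \<Psi>) (GK n (\<Theta> n))" for n
  \<comment> \<open>The discrete gradients vanish in L^2 but are merely bounded in L^4. With the
    bounded field \<open>GR (\<psi> m)\<close> in place of the gradient of \<Psi> the L^2 limit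
    suffices, and the replacement error is uniform in \<open>n\<close>.\<close>
  have "t \<longlonglongrightarrow> 0"
  proof (rule tendsto_0_approx)
    show "(\<lambda>n. BF (HK n (\<Theta> n)) (GR (\<psi> m)) (GK n (\<Theta> n))) \<longlonglongrightarrow> 0" for m
    proof -
      obtain b where "\<And>x. norm (GR (\<psi> m) x) \<le> b" using GR_bounded[OF \<psi>(2)] by blast
      from BI_22b(3)[OF Lp_\<Psi>(1) Lp_\<Psi>(2) Lp_measurable[OF L\<psi>] this]
      obtain D where D: "\<And>P T. Lp \<Omega> 2 P \<Longrightarrow> Lp \<Omega> 2 T \<Longrightarrow> (BF P (GR (\<psi> m)) T)\<^sup>2 \<le> D * (pint \<Omega> 2 P * pint \<Omega> 2 T)" by blast
      show ?thesis
      proof (rule tendsto_0_of_power_le[of 2])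
        show "(BF (HK n (\<Theta> n)) (GR (\<psi> m)) (GK n (\<Theta> n)))\<^sup>2 \<le> D * pint \<Omega> 2 (GK n (\<Theta> n))" for n
          using D[OF La[of n] Lp_4_2[OF Lb[of n]]] \<Theta>1[of n] by simp
      qed (use tendsto_mult_right_zero[OF b0] in auto)
    qed
    show "(t n - BF (HK n (\<Theta> n)) (GR (\<psi> m)) (GK n (\<Theta> n))) ^ 4 \<le> B * K * pint \<Omega> 4 (\<lambda>x. WG \<Psi> x - GR (\<psi> m) x)" for m n
    proof -
      have e: "t n - BF (HK n (\<Theta> n)) (GR (\<psi> m)) (GK n (\<Theta> n)) = BF (HK n (\<Theta> n)) (\<lambda>x. WG \<Psi> x - GR (\<psi> m) x) (GK n (\<Theta> n))"
        using BF_combo2[OF BI_244[OF La[of n] Lp_\<Psi>(3) Lb[of n]] BI_244[OF La[of n] L\<psi>[of m] Lb[of n]], where a = 1 and b = "-1"]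
        by (simp add: t_def)
      have "BF (HK n (\<Theta> n)) (\<lambda>x. WG \<Psi> x - GR (\<psi> m) x) (GK n (\<Theta> n)) ^ 4
          \<le> B * ((pint \<Omega> 2 (HK n (\<Theta> n)))\<^sup>2 * pint \<Omega> 4 (\<lambda>x. WG \<Psi> x - GR (\<psi> m) x) * pint \<Omega> 4 (GK n (\<Theta> n)))"
        by (rule B[OF La LP\<psi> Lb])
      also have "\<dots> \<le> B * ((pint \<Omega> 2 (HK n (\<Theta> n)))\<^sup>2 * pint \<Omega> 4 (\<lambda>x. WG \<Psi> x - GR (\<psi> m) x) * K)"
        by (intro mult_left_mono bK) (auto simp: B0)
      finally show ?thesis unfolding e \<Theta>1 by (simp add: mult_ac)
    qed
    show "(\<lambda>m. B * K * pint \<Omega> 4 (\<lambda>x. WG \<Psi> x - GR (\<psi> m) x)) \<longlonglongrightarrow> 0"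
      by (rule tendsto_mult_right_zero[OF \<psi>(3)])
  qed
  \<comment> \<open>The kernel equation tested with \<open>\<Theta> n\<close> reads 1 + 0 +
    \<open>t n\<close> = 0: the energy is normalised and the diagonal trilinear term drops
    out.\<close>
  moreover have "t n = -1" for n
  proof -
    have "AF (HK n (\<Theta> n)) (HK n (\<Theta> n)) + BF (WH \<Psi>) (GK n (\<Theta> n)) (GK n (\<Theta> n)) + t n = 0"
      using ker[OF \<Theta>, of n] unfolding discLinA_XK t_def .
    then show ?thesis using BF_diagonal[OF Lp_\<Psi>(1) Lb] \<Theta>1 by (simp add: AF_self)
  qed
  then have "t = (\<lambda>_. -1)" by blast
  ultimately show False by (simp add: LIMSEQ_const_iff)
qed

end

section \<open>Well-posedness\<close>

lemma linear_on_sum: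
  fixes f :: "'v::real_vector \<Rightarrow> real"
  assumes V: "subspace V" and f: "\<And>u v. u \<in> V \<Longrightarrow> v \<in> V \<Longrightarrow> f (u + v) = f u + f v"
    "\<And>a u. u \<in> V \<Longrightarrow> f (a *\<^sub>R u) = a * f u" and "finite A" "\<And>p. p \<in> A \<Longrightarrow> e p \<in> V"
  shows "f (\<Sum>p\<in>A. x p *\<^sub>R e p) = (\<Sum>p\<in>A. x p * f (e p))"
  using assms(4,5)
proof (induction A rule: finite_induct)
  case empty
  then show ?case using f(2)[of 0 0] subspace_0[OF V] by simp
next
  case (insert p A)
  have "x p *\<^sub>R e p \<in> V" "(\<Sum>p\<in>A. x p *\<^sub>R e p) \<in> V"
    using insert V by (auto intro!: subspace_scale subspace_sum)
  then show ?case using insert f by simp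
qed

text \<open>In the basis \<open>e\<close> the problem has the square matrix
  \<open>M (e q) (e p)\<close>. A kernel vector of the matrix gives an element of \<open>V\<close>
  on which \<open>M\<close> vanishes for all \<open>w\<close>, hence 0; the same injectivity yields
  uniqueness.\<close>

lemma bilinear_system_solvable:
  fixes e :: "'i \<Rightarrow> 'v::real_vector" and M :: "'v \<Rightarrow> 'v \<Rightarrow> real"
  assumes V: "subspace V" and I: "finite I" "\<And>p. p \<in> I \<Longrightarrow> e p \<in> V"
    and coord: "\<And>v. v \<in> V \<Longrightarrow> v = (\<Sum>p\<in>I. c v p *\<^sub>R e p)"
    and indep: "\<And>x. (\<Sum>p\<in>I. x p *\<^sub>R e p) = 0 \<Longrightarrow> \<forall>p\<in>I. x p = 0"
    and M1: "\<And>u v w. u \<in> V \<Longrightarrow> v \<in> V \<Longrightarrow> w \<in> V \<Longrightarrow> M (u + v) w = M u w + M v w"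
    "\<And>a u w. u \<in> V \<Longrightarrow> w \<in> V \<Longrightarrow> M (a *\<^sub>R u) w = a * M u w"
    and M2: "\<And>u v w. u \<in> V \<Longrightarrow> v \<in> V \<Longrightarrow> w \<in> V \<Longrightarrow> M w (u + v) = M w u + M w v"
    "\<And>a u w. u \<in> V \<Longrightarrow> w \<in> V \<Longrightarrow> M w (a *\<^sub>R u) = a * M w u"
    and g: "\<And>u v. u \<in> V \<Longrightarrow> v \<in> V \<Longrightarrow> g (u + v) = g u + g v" "\<And>a u. u \<in> V \<Longrightarrow> g (a *\<^sub>R u) = a * g u"
    and inj: "\<And>u. u \<in> V \<Longrightarrow> (\<And>w. w \<in> V \<Longrightarrow> M u w = 0) \<Longrightarrow> u = 0"
  shows "\<exists>!u. u \<in> V \<and> (\<forall>w. w \<in> V \<longrightarrow> M u w = g w)"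
proof -
  have sV: "(\<Sum>p\<in>I. x p *\<^sub>R e p) \<in> V" for x
    using V I by (intro subspace_sum subspace_scale) auto
  have s1: "M (\<Sum>p\<in>I. x p *\<^sub>R e p) w = (\<Sum>p\<in>I. x p * M (e p) w)" if "w \<in> V" for x w
    by (rule linear_on_sum[OF V, where f = "\<lambda>u. M u w"]) (use M1 that I in auto)
  have s2: "M u w = (\<Sum>p\<in>I. c w p * M u (e p))" if "u \<in> V" "w \<in> V" for u w
    using linear_on_sum[OF V, where f = "M u" and A = I and e = e and x = "c w"] M2 that I coord[OF that(2)] by auto
  have sg: "g w = (\<Sum>p\<in>I. c w p * g (e p))" if "w \<in> V" for w
    using linear_on_sum[OF V, where f = g and A = I and e = e and x = "c w"] g I coord[OF that] by auto
  have "\<exists>x. \<forall>p\<in>I. (\<Sum>q\<in>I. M (e q) (e p) * x q) = g (e p)"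
  proof (rule square_system_solvable[OF I(1) I(1) refl])
    fix x assume x: "\<forall>p\<in>I. (\<Sum>q\<in>I. M (e q) (e p) * x q) = 0"
    have "(\<Sum>q\<in>I. x q *\<^sub>R e q) = 0"
    proof (rule inj[OF sV])
      fix w assume w: "w \<in> V"
      have "M (\<Sum>q\<in>I. x q *\<^sub>R e q) (e p) = 0" if "p \<in> I" for p
        using s1[OF I(2)[OF that]] x that by (simp add: mult.commute)
      then show "M (\<Sum>q\<in>I. x q *\<^sub>R e q) w = 0"
        unfolding s2[OF sV w] by simp
    qed
    then show "\<forall>q\<in>I. x q = 0" by (rule indep)
  qed
  then obtain x where x: "\<And>p. p \<in> I \<Longrightarrow> (\<Sum>q\<in>I. M (e q) (e p) * x q) = g (e p)" by blast
  define u where "u = (\<Sum>q\<in>I. x q *\<^sub>R e q)"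
  have u: "u \<in> V" unfolding u_def by (rule sV)
  have Mu: "M u w = g w" if "w \<in> V" for w
  proof -
    have "M u (e p) = g (e p)" if "p \<in> I" for p
      unfolding u_def s1[OF I(2)[OF that]] x[OF that, symmetric] by (simp add: mult.commute)
    then show ?thesis unfolding s2[OF u that] sg[OF that] by simp
  qed
  show ?thesis
  proof (rule ex1I[of _ u])
    show "u \<in> V \<and> (\<forall>w. w \<in> V \<longrightarrow> M u w = g w)" using u Mu by blast
    fix v assume v: "v \<in> V \<and> (\<forall>w. w \<in> V \<longrightarrow> M v w = g w)"
    have "v + (-1) *\<^sub>R u = 0"
    proof (rule inj)
      show "v + (-1) *\<^sub>R u \<in> V" using v u V by (intro subspace_add subspace_scale) auto
      show "M (v + (-1) *\<^sub>R u) w = 0" if "w \<in> V" for w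
        using M1(1)[of v "(-1) *\<^sub>R u" w] M1(2)[OF u that, of "-1"] v u V that Mu[OF that]
        by (simp add: subspace_neg)
    qed
    then show "v = u" by simp
  qed
qed

context bounded_open
begin

text \<open>Functionals satisfying \<open>Hminus1\<close> are known to be linear on families from
  \<open>H10\<close>, whereas companions take values in \<open>H20\<close>.\<close>

lemma H20_H10: "H20 \<Omega> u \<Longrightarrow> H10 \<Omega> u"
proof -
  assume u: "H20 \<Omega> u"
  have H: "Hm \<Omega> 1 u" using u by (auto simp: H0m_def Hm_def)
  have le: "hnorm \<Omega> 1 v \<le> hnorm \<Omega> 2 v" for v
    unfolding hnorm_def by (intro real_sqrt_le_mono sum_mono2 finite_multisets) auto
  have "\<exists>\<phi>. test_fn \<Omega> \<phi> \<and> hnorm \<Omega> 1 (\<lambda>x. u x - \<phi> x) < e" if "e > 0" for e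
    using u that le le_less_trans unfolding H0m_def by meson
  then show ?thesis using H by (simp add: H0m_def)
qed

end

section \<open>The discrete problem as a finite linear system\<close>

context disc_sequence
begin

lemma subspace_XK: "subspace (XK n)"
  unfolding subspace_def XK_def XD_def by (auto simp: plus_fun_def zero_fun_def scaleR_fun_def)

lemma GK_add:
  assumes V: "V \<in> XK n" and W: "W \<in> XK n"
  shows "GK n (V + W) = (\<lambda>x. 1 *\<^sub>R GK n V x + 1 *\<^sub>R GK n W x)"
proof -
  have "GD n ((V + W) c) = (\<lambda>x. GD n (V c) x + GD n (W c) x)" for c
    using lin_on_combo[OF disc.lin(2)[OF disc_n[of n]] XK_D[OF V, of c] XK_D[OF W, of c], where a = 1 and b = 1]
    by (simp add: plus_fun_def)
  then show ?thesis by (simp add: GK_def fun_eq_iff vec_eq_iff)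
qed

text \<open>The padding by a zero multiple brings scaling into the two-term shape of
  \<open>BF_combo2\<close> and \<open>BF_combo3\<close>.\<close>

lemma GK_scale:
  assumes V: "V \<in> XK n"
  shows "GK n (a *\<^sub>R V) = (\<lambda>x. a *\<^sub>R GK n V x + 0 *\<^sub>R GK n V x)"
proof -
  have "GD n ((a *\<^sub>R V) c) = (\<lambda>x. a *\<^sub>R GD n (V c) x)" for c
    using lin_on_combo[OF disc.lin(2)[OF disc_n[of n]] XK_D[OF V, of c] XK_D[OF V, of c], where a = a and b = 0]
    by (simp add: scaleR_fun_def)
  then show ?thesis by (simp add: GK_def fun_eq_iff vec_eq_iff)
qed

lemma HK_add:
  assumes V: "V \<in> XK n" and W: "W \<in> XK n"
  shows "HK n (V + W) = (\<lambda>x. 1 *\<^sub>R HK n V x + 1 *\<^sub>R HK n W x)"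
proof -
  have "HD n ((V + W) c) = (\<lambda>x. HD n (V c) x + HD n (W c) x)" for c
    using lin_on_combo[OF disc.lin(3)[OF disc_n[of n]] XK_D[OF V, of c] XK_D[OF W, of c], where a = 1 and b = 1]
    by (simp add: plus_fun_def)
  then show ?thesis by (simp add: HK_def fun_eq_iff vec_eq_iff)
qed

lemma HK_scale:
  assumes V: "V \<in> XK n"
  shows "HK n (a *\<^sub>R V) = (\<lambda>x. a *\<^sub>R HK n V x + 0 *\<^sub>R HK n V x)"
proof -
  have "HD n ((a *\<^sub>R V) c) = (\<lambda>x. a *\<^sub>R HD n (V c) x)" for c
    using lin_on_combo[OF disc.lin(3)[OF disc_n[of n]] XK_D[OF V, of c] XK_D[OF V, of c], where a = a and b = 0]
    by (simp add: scaleR_fun_def)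
  then show ?thesis by (simp add: HK_def fun_eq_iff vec_eq_iff)
qed

lemma discLinA_bilinear:
  assumes \<Psi>: "Lp \<Omega> 2 (WH \<Psi>)" "Lp \<Omega> 4 (WG \<Psi>)" and UVW: "U \<in> XK n" "V \<in> XK n" "W \<in> XK n"
  shows "discLinA \<Omega> h \<Psi> (GD n) (HD n) (U + V) W = discLinA \<Omega> h \<Psi> (GD n) (HD n) U W + discLinA \<Omega> h \<Psi> (GD n) (HD n) V W"
    "discLinA \<Omega> h \<Psi> (GD n) (HD n) (a *\<^sub>R U) W = a * discLinA \<Omega> h \<Psi> (GD n) (HD n) U W"
    "discLinA \<Omega> h \<Psi> (GD n) (HD n) W (U + V) = discLinA \<Omega> h \<Psi> (GD n) (HD n) W U + discLinA \<Omega> h \<Psi> (GD n) (HD n) W V"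
    "discLinA \<Omega> h \<Psi> (GD n) (HD n) W (a *\<^sub>R U) = a * discLinA \<Omega> h \<Psi> (GD n) (HD n) W U"
proof -
  note LH = Lp_HK[OF UVW(1)] Lp_HK[OF UVW(2)] Lp_HK[OF UVW(3)]
  note LG = Lp_GK[OF UVW(1)] Lp_GK[OF UVW(2)] Lp_GK[OF UVW(3)]
  note B = BI_244[OF \<Psi>(1) LG(1) LG(3)] BI_244[OF \<Psi>(1) LG(2) LG(3)] BI_244[OF \<Psi>(1) LG(3) LG(1)] BI_244[OF \<Psi>(1) LG(3) LG(2)]
    BI_244[OF LH(1) \<Psi>(2) LG(3)] BI_244[OF LH(2) \<Psi>(2) LG(3)] BI_244[OF LH(3) \<Psi>(2) LG(1)] BI_244[OF LH(3) \<Psi>(2) LG(2)]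
  note E = GK_add[OF UVW(1,2)] HK_add[OF UVW(1,2)] GK_scale[OF UVW(1), of a] HK_scale[OF UVW(1), of a]
  show "discLinA \<Omega> h \<Psi> (GD n) (HD n) (U + V) W = discLinA \<Omega> h \<Psi> (GD n) (HD n) U W + discLinA \<Omega> h \<Psi> (GD n) (HD n) V W"
    unfolding discLinA_XK E AF_combo[OF LH] BF_combo2[OF B(1,2)] BF_combo1[OF B(5,6)] by (simp add: algebra_simps)
  show "discLinA \<Omega> h \<Psi> (GD n) (HD n) (a *\<^sub>R U) W = a * discLinA \<Omega> h \<Psi> (GD n) (HD n) U W"
    unfolding discLinA_XK E AF_combo[OF LH(1) LH(1) LH(3)] BF_combo2[OF B(1) B(1)] BF_combo1[OF B(5) B(5)] by (simp add: algebra_simps)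
  show "discLinA \<Omega> h \<Psi> (GD n) (HD n) W (U + V) = discLinA \<Omega> h \<Psi> (GD n) (HD n) W U + discLinA \<Omega> h \<Psi> (GD n) (HD n) W V"
    unfolding discLinA_XK E AF_combo2[OF LH(3) LH(1) LH(2)] BF_combo3[OF B(3,4)] BF_combo3[OF B(7,8)] by (simp add: algebra_simps)
  show "discLinA \<Omega> h \<Psi> (GD n) (HD n) W (a *\<^sub>R U) = a * discLinA \<Omega> h \<Psi> (GD n) (HD n) W U"
    unfolding discLinA_XK E AF_combo2[OF LH(3) LH(1) LH(1)] BF_combo3[OF B(3) B(3)] BF_combo3[OF B(7) B(7)] by (simp add: algebra_simps)
qed

lemma disc_well_posed_of_kernel:
  assumes \<Psi>: "Lp \<Omega> 2 (WH \<Psi>)" "Lp \<Omega> 4 (WG \<Psi>)"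
    and inj: "\<And>V. V \<in> XK n \<Longrightarrow> (\<And>W. W \<in> XK n \<Longrightarrow> discLinA \<Omega> h \<Psi> (GD n) (HD n) V W = 0) \<Longrightarrow> V = 0"
  shows "disc_well_posed \<Omega> h \<Psi> (N n) (GD n) (HD n) (ED n)"
  unfolding disc_well_posed_def
proof (intro allI impI)
  fix G :: "('k \<Rightarrow> real^'n \<Rightarrow> real) \<Rightarrow> real" assume G: "Hminus1 \<Omega> G"
  define g where "g W = G (\<lambda>c. ED n (W c))" for W
  define I where "I = (UNIV :: 'k set) \<times> {..<N n}"
  \<comment> \<open>Unit coefficient vectors: an index pairs a component of the system with a
    position below \<open>N n\<close>, so that the coordinates of \<open>v\<close> are simply its
    values.\<close>
  define e :: "'k \<times> nat \<Rightarrow> 'k \<Rightarrow> nat \<Rightarrow> real" where "e p c i = (if c = fst p \<and> i = snd p then 1 else 0)" for p c i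
  have lincomb: "(\<Sum>p\<in>I. x p *\<^sub>R e p) c i = (if i < N n then x (c, i) else 0)" for x c i
  proof -
    have ev: "(\<Sum>p\<in>A. x p *\<^sub>R e p) c i = (\<Sum>p\<in>A. x p * e p c i)" if "finite A" for A
      using that by (induction A rule: finite_induct) (auto simp: scaleR_fun_def)
    have "(\<Sum>p\<in>I. x p * e p c i) = (\<Sum>p\<in>I. if p = (c, i) then x p else 0)"
      by (intro sum.cong) (auto simp: e_def prod_eq_iff)
    also have "\<dots> = (if i < N n then x (c, i) else 0)" by (subst sum.delta) (auto simp: I_def)
    finally show ?thesis using ev[of I] by (simp add: I_def)
  qed
  have g: "g (a *\<^sub>R V + b *\<^sub>R W) = a * g V + b * g W" if VW: "V \<in> XK n" "W \<in> XK n" for a b V W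
  proof -
    have H: "H10 \<Omega> (ED n (V c))" if "V \<in> XK n" for V c
      using compn[of n] XK_D[OF that] H20_H10 by (auto simp: companion_def)
    have "(\<lambda>c. ED n ((a *\<^sub>R V + b *\<^sub>R W) c)) = (\<lambda>c x. a * ED n (V c) x + b * ED n (W c) x)"
      using lin_on_combo[OF disc.lin(4)[OF disc_n] XK_D[OF VW(1)] XK_D[OF VW(2)], where a = a and b = b]
      by (auto simp: fun_eq_iff plus_fun_def scaleR_fun_def)
    moreover have "G (\<lambda>c x. a * ED n (V c) x + b * ED n (W c) x) = a * G (\<lambda>c. ED n (V c)) + b * G (\<lambda>c. ED n (W c))"
    proof -
      have "G (\<lambda>c x. a * U c x + b * V c x) = a * G U + b * G V" if "\<forall>c. H10 \<Omega> (U c)" "\<forall>c. H10 \<Omega> (V c)" for U V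
        using G that unfolding Hminus1_def by auto
      from this[of "\<lambda>c. ED n (V c)" "\<lambda>c. ED n (W c)"] show ?thesis
        using H[OF VW(1)] H[OF VW(2)] by blast
    qed
    ultimately show ?thesis by (simp add: g_def)
  qed
  have "\<exists>!u. u \<in> XK n \<and> (\<forall>w. w \<in> XK n \<longrightarrow> discLinA \<Omega> h \<Psi> (GD n) (HD n) u w = g w)"
  proof (rule bilinear_system_solvable[OF subspace_XK, where e = e and I = I and c = "\<lambda>v p. v (fst p) (snd p)"])
    show "finite I" by (simp add: I_def)
    show "e p \<in> XK n" if "p \<in> I" for p using that by (auto simp: XK_def XD_def e_def I_def)
    show "v = (\<Sum>p\<in>I. v (fst p) (snd p) *\<^sub>R e p)" if "v \<in> XK n" for v
      using that by (intro ext) (simp add: lincomb XK_def XD_def)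
    show "\<forall>p\<in>I. x p = 0" if "(\<Sum>p\<in>I. x p *\<^sub>R e p) = 0" for x
    proof
      fix p assume "p \<in> I"
      then show "x p = 0" using lincomb[of x "fst p" "snd p"] that by (auto simp: I_def)
    qed
    show "g (u + v) = g u + g v" if "u \<in> XK n" "v \<in> XK n" for u v using g[OF that, of 1 1] by simp
    show "g (a *\<^sub>R u) = a * g u" if "u \<in> XK n" for a u using g[OF that that, of a 0] by simp
  qed (use discLinA_bilinear[OF \<Psi>] inj in blast)+
  then show "\<exists>!\<Theta>. (\<forall>c. \<Theta> c \<in> XD (N n)) \<and> (\<forall>\<Phi>. (\<forall>c. \<Phi> c \<in> XD (N n)) \<longrightarrow>
      discLinA \<Omega> h \<Psi> (GD n) (HD n) \<Theta> \<Phi> = G (\<lambda>c. ED n (\<Phi> c)))"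
    by (simp add: XK_def g_def)
qed

text \<open>Rescaling a nonzero kernel element to unit energy is possible because one of its
  components is nonzero and has positive discrete norm.\<close>

lemma kernel_of_ill_posed:
  assumes \<Psi>: "Lp \<Omega> 2 (WH \<Psi>)" "Lp \<Omega> 4 (WG \<Psi>)"
    and ill: "\<not> disc_well_posed \<Omega> h \<Psi> (N n) (GD n) (HD n) (ED n)"
  shows "\<exists>V. V \<in> XK n \<and> pint \<Omega> 2 (HK n V) = 1 \<and> (\<forall>W. W \<in> XK n \<longrightarrow> discLinA \<Omega> h \<Psi> (GD n) (HD n) V W = 0)"
proof -
  obtain V where V: "V \<in> XK n" "\<And>W. W \<in> XK n \<Longrightarrow> discLinA \<Omega> h \<Psi> (GD n) (HD n) V W = 0" "V \<noteq> 0"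
    using disc_well_posed_of_kernel[OF \<Psi>] ill by blast
  then obtain c where "V c \<noteq> (\<lambda>_. 0)" by (auto simp: fun_eq_iff)
  then have "0 < (normD \<Omega> (HD n) (V c))\<^sup>2" using disc.normD_pos[OF disc_n XK_D[OF V(1)], of c] by (intro zero_less_power)
  then have t: "pint \<Omega> 2 (HK n V) > 0"
    unfolding disc.normD_sq[OF disc_n] using pint_HD_le[OF V(1), of c] by simp
  define a where "a = 1 / sqrt (pint \<Omega> 2 (HK n V))"
  show ?thesis
  proof (intro exI[of _ "a *\<^sub>R V"] conjI allI impI)
    show "a *\<^sub>R V \<in> XK n" by (rule subspace_scale[OF subspace_XK V(1)])
    have "pint \<Omega> 2 (HK n (a *\<^sub>R V)) = \<bar>a\<bar>\<^sup>2 * pint \<Omega> 2 (HK n V)"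
      unfolding HK_scale[OF V(1)] by (simp add: pint_scale)
    then show "pint \<Omega> 2 (HK n (a *\<^sub>R V)) = 1" using t by (simp add: a_def power_divide)
    show "discLinA \<Omega> h \<Psi> (GD n) (HD n) (a *\<^sub>R V) W = 0" if "W \<in> XK n" for W
      using discLinA_bilinear(2)[OF \<Psi> V(1) V(1) that, of a] V(2)[OF that] by simp
  qed
qed

end

theorem theorem4p4:
  fixes \<Omega> :: "(real^'n::finite) set"
    and h :: "real^'n^'k \<Rightarrow> real^'n^'k \<Rightarrow> real^'n^'n^'k::finite"
    and L :: "('k \<Rightarrow> real^'n \<Rightarrow> real) \<Rightarrow> real"
    and \<Psi> :: "'k \<Rightarrow> real^'n \<Rightarrow> real"
    and Gbar :: real
  assumes "CARD('n) \<le> 3"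
    and "open \<Omega>" and "bounded \<Omega>" and "convex \<Omega>" and "\<Omega> \<noteq> {}"
    and "bilinear h" and "B_continuous \<Omega> h" and "B_antisym \<Omega> h"
    and "Hminus1 \<Omega> L"
    and "\<forall>c. Hm \<Omega> 3 (\<Psi> c) \<and> H20 \<Omega> (\<Psi> c)"
    and "regular_solution \<Omega> h L \<Psi>"
    and "Gbar \<ge> 0"
  shows "\<exists>\<rho>>0. \<forall>N PiD GD HD ED.
     hessian_disc \<Omega> N PiD GD HD \<and> companion \<Omega> N ED \<and>
     CD \<Omega> N PiD GD HD \<le> ereal Gbar \<and> GammaE \<Omega> N HD ED \<le> ereal Gbar \<and>
     omegaE \<Omega> N GD HD ED \<le> ereal \<rho> \<and> alphaD \<Omega> N PiD GD HD \<le> ereal \<rho> \<and>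
     gammaD \<Omega> N GD HD \<le> ereal \<rho>
     \<longrightarrow> disc_well_posed \<Omega> h \<Psi> N GD HD ED"
proof (rule ccontr)
  assume neg: "\<not> ?thesis"
  define bad where "bad \<rho> N PiD GD HD ED \<longleftrightarrow> hessian_disc \<Omega> N PiD GD HD \<and> companion \<Omega> N ED \<and>
     CD \<Omega> N PiD GD HD \<le> ereal Gbar \<and> GammaE \<Omega> N HD ED \<le> ereal Gbar \<and>
     omegaE \<Omega> N GD HD ED \<le> ereal \<rho> \<and> alphaD \<Omega> N PiD GD HD \<le> ereal \<rho> \<and>
     gammaD \<Omega> N GD HD \<le> ereal \<rho> \<and> \<not> disc_well_posed \<Omega> h \<Psi> N GD HD ED" for \<rho> N PiD GD HD ED
  \<comment> \<open>Packing the five data of a discretisation into one tuple lets a single choice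
    over \<open>n\<close> produce the whole sequence.\<close>
  have "\<exists>D. bad (inverse (real (Suc n))) (fst D) (fst (snd D)) (fst (snd (snd D))) (fst (snd (snd (snd D)))) (snd (snd (snd (snd D))))" for n
  proof -
    have "inverse (real (Suc n)) > 0" by simp
    with neg obtain N PiD GD HD ED where "bad (inverse (real (Suc n))) N PiD GD HD ED"
      unfolding bad_def by meson
    then show ?thesis by (intro exI[of _ "(N, PiD, GD, HD, ED)"]) simp
  qed
  then obtain D where D: "\<And>n. bad (inverse (real (Suc n))) (fst (D n)) (fst (snd (D n))) (fst (snd (snd (D n)))) (fst (snd (snd (snd (D n))))) (snd (snd (snd (snd (D n)))))"
    by metis
  define N where "N n = fst (D n)" for n
  define PiD where "PiD n = fst (snd (D n))" for n
  define GD where "GD n = fst (snd (snd (D n)))" for n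
  define HD where "HD n = fst (snd (snd (snd (D n))))" for n
  define ED where "ED n = snd (snd (snd (snd (D n))))" for n
  have bad: "bad (inverse (real (Suc n))) (N n) (PiD n) (GD n) (HD n) (ED n)" for n
    using D by (simp add: N_def PiD_def GD_def HD_def ED_def)
  interpret disc_sequence \<Omega> h Gbar N PiD GD HD ED
    by unfold_locales (use assms bad in \<open>auto simp: bad_def\<close>)
  \<comment> \<open>The Sobolev inequality has to precede the kernel elements: it puts the weak
    gradient of \<Psi> into L^4, which bilinearity of the discrete form requires.\<close>
  interpret sobolev_form \<Omega> h \<Psi> "256 * ((real CARD('k))\<^sup>2 * Gbar ^ 4)"
    by unfold_locales (use assms sobolev_inequality in \<open>auto simp: zero_le_even_power\<close>)
  have "\<exists>V. V \<in> XK n \<and> pint \<Omega> 2 (HK n V) = 1 \<and> (\<forall>W. W \<in> XK n \<longrightarrow> discLinA \<Omega> h \<Psi> (GD n) (HD n) V W = 0)" for n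
    by (rule kernel_of_ill_posed[OF Lp_\<Psi>(1,3)]) (use bad[of n] in \<open>simp add: bad_def\<close>)
  then obtain \<Theta> where \<Theta>: "\<And>n. \<Theta> n \<in> XK n \<and> pint \<Omega> 2 (HK n (\<Theta> n)) = 1 \<and> (\<forall>W. W \<in> XK n \<longrightarrow> discLinA \<Omega> h \<Psi> (GD n) (HD n) (\<Theta> n) W = 0)"
    by metis
  interpret kernel_sequence \<Omega> h Gbar N PiD GD HD ED \<Psi> L \<Theta>
    by unfold_locales (use assms \<Theta> in auto)
  show False by (rule kernel_sequence_contradiction)
qed

end
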